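(* Let $K$ be an algebraically closed field of characteristic zero and let $f,g\in K[[x_1,\ldots,x_n]]$. If $f$ and $g$ are contact equivalent, then $\mu(f)=\mu(g)$.
   Context: Two power series $f,g\in K[[x_1,\ldots,x_n]]$ are contact equivalent if there are a $K$-algebra automorphism $\varphi$ of $K[[x_1,\ldots,x_n]]$ and a unit $u\in K[[x_1,\ldots,x_n]]^*$ with $f=u\cdot\varphi(g)$. The Milnor number of $f$ is $\mu(f)=\dim_K\big(K[[x_1,\ldots,x_n]]/\langle f_{x_1},\ldots,f_{x_n}\rangle\big)\in\mathbb{Z}_{\geq 0}\cup\{\infty\}$, where $f_{x_i}$ is the formal partial derivative of $f$ with respect to $x_i$.
   Formalization: It is additionally assumed that f has zero constant term (f is not a unit); for units the claim fails, e.g. 1 and 1+x in one variable are contact equivalent but have Milnor numbers ∞ and 0. *)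

theory Defs
  imports
    "HOL-Algebra.Algebraic_Closure_Type"
    "HOL-Algebra.Embedded_Algebras"
    "HOL-Algebra.QuotRing"
    "HOL-Library.Poly_Mapping"
    "HOL-Library.Extended_Nat"
begin

text \<open>
  The variables are indexed by a type \<open>'n\<close>; for finite \<open>'n\<close> this is the ring
  $K[[x_1,\ldots,x_n]]$ with $n$ the cardinality of \<open>'n\<close>. A series is its family of
  coefficients, indexed by exponent vectors \<open>'n \<Rightarrow>\<^sub>0 nat\<close>.
\<close>

typedef ('a, 'n) mfps = "UNIV :: (('n \<Rightarrow>\<^sub>0 nat) \<Rightarrow> 'a) set"
  morphisms mfps_nth Abs_mfps ..

setup_lifting type_definition_mfps

lemma mfps_eqI: "(\<And>k. mfps_nth f k = mfps_nth g k) \<Longrightarrow> f = g"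
  by transfer auto

lemma finite_exponent_splits: "finite {(i, j). i + j = (k :: 'n \<Rightarrow>\<^sub>0 nat)}"
proof -
  define N where "N = sum (Poly_Mapping.lookup k) (Poly_Mapping.keys k)"
  define F where "F = {h :: 'n \<Rightarrow> nat. \<forall>x. (x \<in> Poly_Mapping.keys k \<longrightarrow> h x \<in> {..N}) \<and>
                                         (x \<notin> Poly_Mapping.keys k \<longrightarrow> h x = 0)}"
  have "finite F"
    unfolding F_def by (rule finite_set_of_finite_funs) auto
  have F: "Poly_Mapping.lookup i \<in> F" if "i + j = k" for i j
  proof -
    have le: "Poly_Mapping.lookup i x \<le> Poly_Mapping.lookup k x" for x
      using that by (auto simp: lookup_add)
    have "Poly_Mapping.lookup k x \<le> N" if "x \<in> Poly_Mapping.keys k" for x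
      unfolding N_def using that by (intro member_le_sum) auto
    hence "Poly_Mapping.lookup i x \<le> N" if "x \<in> Poly_Mapping.keys k" for x
      using le that by (meson order.trans)
    moreover have "Poly_Mapping.lookup i x = 0" if "x \<notin> Poly_Mapping.keys k" for x
      using le[of x] that by (simp add: in_keys_iff)
    ultimately show ?thesis
      unfolding F_def by simp
  qed
  have "finite (Poly_Mapping.lookup -` F)"
    by (rule finite_vimageI[OF \<open>finite F\<close>]) (metis injI poly_mapping_eqI)
  moreover have "{(i, j). i + j = k} \<subseteq> (Poly_Mapping.lookup -` F) \<times> (Poly_Mapping.lookup -` F)"
    using F F[OF trans[OF add.commute]] by auto
  ultimately show ?thesis
    by (meson finite_SigmaI finite_subset)
qed

instantiation mfps :: (comm_ring_1, type) comm_ring_1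
begin

lift_definition zero_mfps :: "('a, 'b) mfps" is "\<lambda>_. 0" .

lift_definition one_mfps :: "('a, 'b) mfps" is "\<lambda>k. if k = 0 then 1 else 0" .

lift_definition plus_mfps :: "('a, 'b) mfps \<Rightarrow> ('a, 'b) mfps \<Rightarrow> ('a, 'b) mfps"
  is "\<lambda>f g k. f k + g k" .

lift_definition minus_mfps :: "('a, 'b) mfps \<Rightarrow> ('a, 'b) mfps \<Rightarrow> ('a, 'b) mfps"
  is "\<lambda>f g k. f k - g k" .

lift_definition uminus_mfps :: "('a, 'b) mfps \<Rightarrow> ('a, 'b) mfps"
  is "\<lambda>f k. - f k" .

lift_definition times_mfps :: "('a, 'b) mfps \<Rightarrow> ('a, 'b) mfps \<Rightarrow> ('a, 'b) mfps"
  is "\<lambda>f g k. \<Sum>(i, j) | i + j = k. f i * g j" .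

instance
proof
  fix a b c :: "('a, 'b) mfps"
  show "a * b * c = a * (b * c)"
  proof transfer
    fix f g h :: "('b \<Rightarrow>\<^sub>0 nat) \<Rightarrow> 'a"
    let ?S = "\<lambda>k. {(i, j). i + j = (k :: 'b \<Rightarrow>\<^sub>0 nat)}"
    have "(\<Sum>(i, j)\<in>?S k. (\<Sum>(p, q)\<in>?S i. f p * g q) * h j) =
          (\<Sum>(i, j)\<in>?S k. f i * (\<Sum>(p, q)\<in>?S j. g p * h q))" (is "?l = ?r") for k
    proof -
      have "?l = (\<Sum>x\<in>?S k. \<Sum>y\<in>?S (fst x). f (fst y) * g (snd y) * h (snd x))"
        by (simp add: case_prod_unfold sum_distrib_right)
      also have "\<dots> = (\<Sum>(x, y)\<in>(SIGMA x:?S k. ?S (fst x)). f (fst y) * g (snd y) * h (snd x))"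
        using finite_exponent_splits by (intro sum.Sigma) auto
      also have "\<dots> = (\<Sum>(x, y)\<in>(SIGMA x:?S k. ?S (snd x)). f (fst x) * g (fst y) * h (snd y))"
        by (rule sum.reindex_bij_witness[of _
              "\<lambda>((i, j), (p, q)). ((i + p, q), (i, p))" "\<lambda>((i, j), (p, q)). ((p, q + j), (q, j))"])
           (auto simp: add.assoc)
      also have "\<dots> = (\<Sum>x\<in>?S k. \<Sum>y\<in>?S (snd x). f (fst x) * g (fst y) * h (snd y))"
        using finite_exponent_splits by (intro sum.Sigma [symmetric]) auto
      also have "\<dots> = ?r"
        by (simp add: case_prod_unfold sum_distrib_left mult.assoc)
      finally show ?thesis .
    qed
    thus "(\<lambda>k. \<Sum>(i, j)\<in>?S k. (\<Sum>(p, q)\<in>?S i. f p * g q) * h j) =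
          (\<lambda>k. \<Sum>(i, j)\<in>?S k. f i * (\<Sum>(p, q)\<in>?S j. g p * h q))"
      by (rule ext)
  qed
  show "a * b = b * a"
  proof transfer
    fix f g :: "('b \<Rightarrow>\<^sub>0 nat) \<Rightarrow> 'a"
    have "(\<Sum>(i, j) | i + j = k. f i * g j) = (\<Sum>(i, j) | i + j = k. g i * f j)" for k
      by (rule sum.reindex_bij_witness[of _ "\<lambda>(i, j). (j, i)" "\<lambda>(i, j). (j, i)"])
         (auto simp: add.commute mult.commute)
    thus "(\<lambda>k. \<Sum>(i, j) | i + j = k. f i * g j) = (\<lambda>k. \<Sum>(i, j) | i + j = k. g i * f j)"
      by (rule ext)
  qed
  show "1 * a = a"
  proof transfer
    fix f :: "('b \<Rightarrow>\<^sub>0 nat) \<Rightarrow> 'a"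
    have "(\<Sum>(i, j) | i + j = k. (if i = 0 then 1 else 0) * f j) =
          (\<Sum>(i, j)\<in>{(0 :: 'b \<Rightarrow>\<^sub>0 nat, k)}. (if i = 0 then 1 else 0) * f j)" for k
      by (rule sum.mono_neutral_right[OF finite_exponent_splits]) (auto split: if_splits)
    thus "(\<lambda>k. \<Sum>(i, j) | i + j = k. (if i = 0 then 1 else 0) * f j) = f"
      by simp
  qed
  show "(a + b) * c = a * c + b * c"
    by transfer (simp add: case_prod_unfold distrib_right sum.distrib)
  show "(0 :: ('a, 'b) mfps) \<noteq> 1"
    by transfer (auto dest: fun_cong[of _ _ 0])
  show "a + b + c = a + (b + c)" "a + b = b + a" "0 + a = a" "- a + a = 0" "a - b = a + - b"
    by (transfer; simp add: add_ac)+
qed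

end

lift_definition mfps_const :: "'a :: zero \<Rightarrow> ('a, 'n) mfps"
  is "\<lambda>c k. if k = 0 then c else 0" .

lift_definition mfps_deriv :: "'n \<Rightarrow> ('a :: semiring_1, 'n) mfps \<Rightarrow> ('a, 'n) mfps"
  is "\<lambda>i f k. of_nat (Poly_Mapping.lookup k i + 1) * f (k + Poly_Mapping.single i 1)" .

definition mfps_algebra_automorphism ::
    "(('a :: comm_ring_1, 'n) mfps \<Rightarrow> ('a, 'n) mfps) \<Rightarrow> bool" where
  "mfps_algebra_automorphism \<phi> \<longleftrightarrow>
     \<phi> \<in> ring_iso ring_of_type_algebra ring_of_type_algebra \<and>
     (\<forall>c. \<phi> (mfps_const c) = mfps_const c)"

definition contact_equivalent :: "('a :: comm_ring_1, 'n) mfps \<Rightarrow> ('a, 'n) mfps \<Rightarrow> bool" where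
  "contact_equivalent f g \<longleftrightarrow>
     (\<exists>\<phi> u. mfps_algebra_automorphism \<phi> \<and> u dvd 1 \<and> f = u * \<phi> g)"

definition jacobian_ideal :: "('a :: comm_ring_1, 'n) mfps \<Rightarrow> ('a, 'n) mfps set" where
  "jacobian_ideal f = genideal ring_of_type_algebra (range (\<lambda>i. mfps_deriv i f))"

definition milnor_algebra :: "('a :: comm_ring_1, 'n) mfps \<Rightarrow> ('a, 'n) mfps set ring" where
  "milnor_algebra f = ring_of_type_algebra Quot jacobian_ideal f"

text \<open>
  The image of the ground field in the Milnor algebra. The library defines dimensions of
  subspaces of a ring over a subset acting by multiplication, so the \<open>K\<close>-vector space
  structure of the quotient is given by this image. If the Jacobian ideal is the whole ring,
  quotient and image are both the zero ring, and the dimension is \<open>0\<close>.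
\<close>

definition milnor_scalars :: "('a :: comm_ring_1, 'n) mfps \<Rightarrow> ('a, 'n) mfps set set" where
  "milnor_scalars f =
     range (\<lambda>c. jacobian_ideal f +>\<^bsub>ring_of_type_algebra\<^esub> mfps_const c)"

definition milnor_number :: "('a :: field, 'n) mfps \<Rightarrow> enat" where
  "milnor_number f =
     (let A = milnor_algebra f; K = milnor_scalars f
      in if ring.finite_dimension A K (carrier A) then enat (ring.dim A K (carrier A)) else \<infinity>)"

text \<open>
  Contact equivalence does not preserve the Milnor number of units: in one variable,
  \<open>1\<close> and \<open>1 + x\<close> are contact equivalent, with Milnor numbers \<open>\<infinity>\<close> and \<open>0\<close>. The invariance
  theorem therefore concerns series without constant term. Since automorphisms preserve
  (non-)units, it suffices to ask this of one of two contact equivalent series.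
\<close>

end

theory Submission
  imports Defs
begin

text \<open>
  Automorphisms are handled by the chain rule, so let $f$ have no constant term and let $u$ be a
  unit. The Jacobian ideal of $uf$ is generated by the $f_{x_i} + w_i f$ with $w_i = u_{x_i}/u$. For
  arbitrary series $w_i$ we show that the codimension of this ideal is at most that of the Jacobian
  ideal of $f$; exchanging $f$ and $uf$ gives equality.

  The key point is that $f$ is nilpotent modulo the ideal $I$ generated by the $f_{x_i} + w_i f$
  when $I + (f)$ has finite codimension, even if the $w_i$ depend on a parameter. Otherwise the
  quotient by $I$ modulo $f$-torsion would be a nonzero free module of finite rank over $K[[s]]$,
  with $s$ acting as $f$. Let $X_i$ be the matrix of $x_i$. As $f(X) = s$, differentiating with
  respect to $s$ and taking traces gives $\mathrm{rank} = \sum_i \mathrm{Tr}(f_{x_i}(X) X_i') =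
  - s \sum_i \mathrm{Tr}(w_i(X) X_i')$, which is absurd in characteristic zero.

  In the linear family over $K[T]$ that joins the two ideals, $T$ is regular at the end $T = 0$ since the
  Koszul complex of $n$ elements generating an ideal of finite codimension in $n$ variables is
  acyclic. By nilpotency the family is supported at the origin, so that the comparison becomes
  linear algebra in a finite-dimensional space.
\<close>

subsection \<open>Ideals\<close>

text \<open>In general \<open>f\<close> lies outside its Jacobian ideal, so the two ideals differ
  and only their codimensions can agree. In the family the two ends play different roles. At T = 1
  semicontinuity suffices: the elements of the Jacobian ideal deform, and a polynomial relation
  between deformations specialises. At T = 0 the fibre could be larger than its neighbours, and
  regularity of T excludes this. The asymmetry is why an inequality is proved and then applied
  twice. The obstacle is finiteness. Powers of the variables in the fibre ideal at T = 0 lie in the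
  ideal of the family only modulo T, and zeros could leave the origin as T moves. A power x_i^N that
  lies in the ideal of the family itself, over K[[x,T]], is needed; it allows a series to be
  replaced by its coefficients in a finite box of exponents that is the same for all T. Nilpotency
  of \<open>f\<close> in the presence of the parameter provides it.\<close>

definition is_ideal :: "'r::comm_ring_1 set \<Rightarrow> bool" where
  "is_ideal I \<longleftrightarrow> 0 \<in> I \<and> (\<forall>x\<in>I. \<forall>y\<in>I. x + y \<in> I) \<and> (\<forall>r. \<forall>x\<in>I. r * x \<in> I)"

text \<open>With a finite index type every member has one explicit coefficient per generator, so
  that membership can be carried through ring homomorphisms and rewritten as a relation between the
  generators.\<close>

definition generated_ideal :: "('i::finite \<Rightarrow> 'r::comm_ring_1) \<Rightarrow> 'r set" where
  "generated_ideal a = range (\<lambda>b. \<Sum>i\<in>UNIV. a i * b i)"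

lemma is_idealI:
  assumes "0 \<in> I" "\<And>x y. x \<in> I \<Longrightarrow> y \<in> I \<Longrightarrow> x + y \<in> I" "\<And>r x. x \<in> I \<Longrightarrow> r * x \<in> I"
  shows "is_ideal I"
  using assms by (auto simp: is_ideal_def)

lemma ideal_zero: "is_ideal I \<Longrightarrow> 0 \<in> I"
  and ideal_add: "is_ideal I \<Longrightarrow> x \<in> I \<Longrightarrow> y \<in> I \<Longrightarrow> x + y \<in> I"
  and ideal_mult: "is_ideal I \<Longrightarrow> x \<in> I \<Longrightarrow> r * x \<in> I"
  and ideal_mult_right: "is_ideal I \<Longrightarrow> x \<in> I \<Longrightarrow> x * r \<in> I"
  by (auto simp: is_ideal_def mult.commute)

lemma ideal_uminus: "is_ideal I \<Longrightarrow> x \<in> I \<Longrightarrow> - x \<in> I"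
  using ideal_mult[of I x "-1"] by simp

lemma ideal_diff: "is_ideal I \<Longrightarrow> x \<in> I \<Longrightarrow> y \<in> I \<Longrightarrow> x - y \<in> I"
  using ideal_add[of I x "- y"] ideal_uminus[of I y] by simp

lemma ideal_sum: "is_ideal I \<Longrightarrow> (\<And>i. i \<in> A \<Longrightarrow> f i \<in> I) \<Longrightarrow> (\<Sum>i\<in>A. f i) \<in> I"
  by (induction A rule: infinite_finite_induct) (auto intro: ideal_zero ideal_add)

lemma ideal_cong_mult:
  assumes "is_ideal I" "x - y \<in> I" "x' - y' \<in> I" shows "x * x' - y * y' \<in> I"
proof -
  have "x * x' - y * y' = x * (x' - y') + y' * (x - y)" by (simp add: algebra_simps)
  then show ?thesis using assms by (auto intro: ideal_add ideal_mult)
qed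

lemma ideal_cong_power:
  "is_ideal I \<Longrightarrow> x - y \<in> I \<Longrightarrow> x ^ n - y ^ n \<in> I"
  by (induction n) (auto intro: ideal_zero ideal_cong_mult)

lemma is_ideal_gen: "is_ideal (generated_ideal a)"
proof (rule is_idealI)
  show "0 \<in> generated_ideal a" unfolding generated_ideal_def by (rule range_eqI[of _ _ "\<lambda>_. 0"]) simp
  show "x + y \<in> generated_ideal a" if "x \<in> generated_ideal a" "y \<in> generated_ideal a" for x y
  proof -
    from that obtain b c where "x = (\<Sum>i\<in>UNIV. a i * b i)" "y = (\<Sum>i\<in>UNIV. a i * c i)"
      by (auto simp: generated_ideal_def)
    then have "x + y = (\<Sum>i\<in>UNIV. a i * (b i + c i))" by (simp add: distrib_left sum.distrib)
    then show ?thesis unfolding generated_ideal_def by (auto intro!: image_eqI[of _ _ "\<lambda>i. b i + c i"])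
  qed
  show "r * x \<in> generated_ideal a" if "x \<in> generated_ideal a" for r x
  proof -
    from that obtain b where "x = (\<Sum>i\<in>UNIV. a i * b i)" by (auto simp: generated_ideal_def)
    then have "r * x = (\<Sum>i\<in>UNIV. a i * (r * b i))" by (simp add: sum_distrib_left mult_ac)
    then show ?thesis unfolding generated_ideal_def by (auto intro!: image_eqI[of _ _ "\<lambda>i. r * b i"])
  qed
qed

lemma gen_base: "a i \<in> generated_ideal a"
  unfolding generated_ideal_def by (rule range_eqI[of _ _ "\<lambda>j. if j = i then 1 else 0"]) (simp add: if_distrib cong: if_cong)

lemma gen_subset_iff: "is_ideal I \<Longrightarrow> generated_ideal a \<subseteq> I \<longleftrightarrow> (\<forall>i. a i \<in> I)"
  using gen_base[of a] by (auto simp: generated_ideal_def intro!: ideal_sum ideal_mult_right)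

lemma gen_memI: "(\<Sum>i\<in>UNIV. a i * b i) \<in> generated_ideal a"
  by (auto simp: generated_ideal_def)

subsection \<open>Multivariate power series\<close>

definition mdeg :: "('m::finite \<Rightarrow>\<^sub>0 nat) \<Rightarrow> nat" where
  "mdeg a = (\<Sum>i\<in>UNIV. Poly_Mapping.lookup a i)"

lemma mdeg_0 [simp]: "mdeg 0 = 0" and mdeg_add: "mdeg (a + b) = mdeg a + mdeg b"
  by (auto simp: mdeg_def lookup_add sum.distrib)

lemma mdeg_single [simp]: "mdeg (Poly_Mapping.single i n) = n"
  by (simp add: mdeg_def lookup_single when_def)

lemma mdeg_eq_0_iff: "mdeg a = 0 \<longleftrightarrow> a = 0"
  by (auto simp: mdeg_def intro!: poly_mapping_eqI)

lemma nth_zero [simp]: "mfps_nth 0 a = 0"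
  and nth_one: "mfps_nth 1 a = (if a = 0 then 1 else 0)"
  and nth_add [simp]: "mfps_nth (f + g) a = mfps_nth f a + mfps_nth g a"
  and nth_diff [simp]: "mfps_nth (f - g) a = mfps_nth f a - mfps_nth g a"
  and nth_uminus [simp]: "mfps_nth (- f) a = - mfps_nth f a"
  and nth_const: "mfps_nth (mfps_const c) a = (if a = 0 then c else 0)"
  by (transfer; simp)+

lemma nth_mult: "mfps_nth (f * g) a = (\<Sum>(i, j) | i + j = a. mfps_nth f i * mfps_nth g j)"
  by (simp only: times_mfps.rep_eq)

lemma nth_sum [simp]: "mfps_nth (sum f A) a = (\<Sum>i\<in>A. mfps_nth (f i) a)"
  by (induction A rule: infinite_finite_induct) auto

lemma nth_Abs [simp]: "mfps_nth (Abs_mfps h) a = h a"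
  by (simp add: Abs_mfps_inverse)

lemma poly_mapping_add_eq_0_iff: "i + j = 0 \<longleftrightarrow> i = 0 \<and> j = 0" for i j :: "'m \<Rightarrow>\<^sub>0 nat"
proof
  assume "i + j = 0"
  then have "Poly_Mapping.lookup i x + Poly_Mapping.lookup j x = 0" for x
    by (metis lookup_add lookup_zero)
  then show "i = 0 \<and> j = 0" by (auto intro!: poly_mapping_eqI)
qed simp

lemma splits_0: "{(i, j). i + j = (0 :: 'm \<Rightarrow>\<^sub>0 nat)} = {(0, 0)}"
  by (auto simp: poly_mapping_add_eq_0_iff)

lemma nth_mult_0: "mfps_nth (f * g) 0 = mfps_nth f 0 * mfps_nth g 0"
  unfolding nth_mult splits_0 by simp

definition mfps_monom :: "('m \<Rightarrow>\<^sub>0 nat) \<Rightarrow> ('a::comm_ring_1, 'm) mfps" where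
  "mfps_monom k = Abs_mfps (\<lambda>a. if a = k then 1 else 0)"

lemma nth_monom: "mfps_nth (mfps_monom k) a = (if a = k then 1 else 0)"
  by (simp add: mfps_monom_def)

lemma nth_monom_mult:
  "mfps_nth (mfps_monom k * f) a = (if \<exists>b. a = k + b then mfps_nth f (a - k) else 0)"
proof -
  have *: "mfps_nth (mfps_monom k * f) a =
        (\<Sum>(i, j) \<in> {(i, j). i + j = a} \<inter> {(i, j). i = k}. mfps_nth f j)"
    unfolding nth_mult
  proof (rule sum.mono_neutral_cong_right[OF finite_exponent_splits], goal_cases)
    case 2
    have "mfps_nth (mfps_monom k) p * mfps_nth f q = 0" if "p \<noteq> k" for p q
      using that by (simp add: nth_monom)
    then show ?case by fastforce
  next
    case (3 x)
    then show ?case by (auto simp: nth_monom)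
  qed auto
  show ?thesis
  proof (cases "\<exists>b. a = k + b")
    case True
    then obtain b where b: "a = k + b" by auto
    have "{(i, j). i + j = a} \<inter> {(i, j). i = k} = {(k, b)}" using b by auto
    then show ?thesis using * b by auto
  next
    case False
    then have "{(i, j). i + j = a} \<inter> {(i, j). i = k} = {}" by auto
    then show ?thesis using * False by simp
  qed
qed

lemma nth_monom_mult_add [simp]: "mfps_nth (mfps_monom k * f) (k + b) = mfps_nth f b"
  by (auto simp: nth_monom_mult)

lemma monom_0: "mfps_monom 0 = 1"
  by (rule mfps_eqI) (simp add: nth_monom nth_one)

lemma monom_mult: "mfps_monom k * mfps_monom l = mfps_monom (k + l)"
  by (rule mfps_eqI) (auto simp: nth_monom_mult nth_monom)

lemma mfps_const_0 [simp]: "mfps_const 0 = 0" and mfps_const_1 [simp]: "mfps_const 1 = 1"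
  and mfps_const_add: "mfps_const (c + d) = mfps_const c + mfps_const d"
  and mfps_const_diff: "mfps_const (c - d) = mfps_const c - mfps_const d"
  and mfps_const_uminus: "mfps_const (- c) = - mfps_const c"
  by (rule mfps_eqI, simp add: nth_const nth_one)+

lemma nth_const_mult [simp]:
  fixes f :: "('a::comm_ring_1, 'm) mfps"
  shows "mfps_nth (mfps_const c * f) a = c * mfps_nth f a"
proof -
  have "mfps_nth (mfps_const c * f) a =
      (\<Sum>(i, j) \<in> {(0 :: 'm \<Rightarrow>\<^sub>0 nat, a)}. mfps_nth (mfps_const c) i * mfps_nth f j)"
    unfolding nth_mult
  proof (rule sum.mono_neutral_right[OF finite_exponent_splits], goal_cases)
    case 2
    show ?case
    proof
      fix x assume x: "x \<in> {(i, j). i + j = a} - {(0, a)}"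
      obtain p q where pq: "x = (p, q)" by force
      have "p \<noteq> 0" using x by (auto simp: pq)
      then show "(case x of (i, j) \<Rightarrow> mfps_nth (mfps_const c) i * mfps_nth f j) = 0"
        by (simp add: pq nth_const)
    qed
  qed auto
  then show ?thesis by (simp add: nth_const)
qed

lemma mfps_const_mult: "mfps_const (c * d) = mfps_const c * (mfps_const d :: ('a::comm_ring_1, 'm) mfps)"
  by (rule mfps_eqI) (simp add: nth_const)

definition Var :: "'m \<Rightarrow> ('a::comm_ring_1, 'm) mfps" where
  "Var i = mfps_monom (Poly_Mapping.single i 1)"

lemma Var_power: "Var i ^ n = mfps_monom (Poly_Mapping.single i n)"
  by (induction n) (auto simp: Var_def monom_0 monom_mult single_add[symmetric])

lemma ex_single_add_iff:
  "(\<exists>b. a = Poly_Mapping.single i n + b) \<longleftrightarrow> n \<le> Poly_Mapping.lookup a i" for a :: "'m \<Rightarrow>\<^sub>0 nat"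
proof
  assume "\<exists>b. a = Poly_Mapping.single i n + b"
  then obtain b where b: "a = Poly_Mapping.single i n + b" by (rule exE)
  show "n \<le> Poly_Mapping.lookup a i" unfolding b lookup_add by simp
next
  assume n: "n \<le> Poly_Mapping.lookup a i"
  have "Poly_Mapping.lookup a j = Poly_Mapping.lookup (Poly_Mapping.single i n + (a - Poly_Mapping.single i n)) j" for j
    using n by (cases "i = j") (simp_all add: lookup_add lookup_minus lookup_single)
  then show "\<exists>b. a = Poly_Mapping.single i n + b"
    by (intro exI[of _ "a - Poly_Mapping.single i n"] poly_mapping_eqI)
qed

lemma nth_Var_power_mult:
  "mfps_nth (Var i ^ n * f) a =
     (if n \<le> Poly_Mapping.lookup a i then mfps_nth f (a - Poly_Mapping.single i n) else 0)"
  by (simp add: Var_power nth_monom_mult ex_single_add_iff)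

lemma Var_mult_cancel: "Var i * f = Var i * g \<Longrightarrow> f = g"
  by (rule mfps_eqI) (metis Var_def nth_monom_mult_add)

subsection \<open>Boxes of exponents\<close>

text \<open>These are the exponents outside the monomial ideal generated by the N-th powers of the
  variables in \<open>S\<close>.\<close>

definition box :: "'m set \<Rightarrow> nat \<Rightarrow> ('m \<Rightarrow>\<^sub>0 nat) set" where
  "box S N = {a. \<forall>i\<in>S. Poly_Mapping.lookup a i < N}"

text \<open>The k-th power of the ideal generated by the variables, encoded through the order of
  vanishing. \<open>mpow_eqI\<close>, the fact that these powers intersect in 0, is the form in
  which completeness arguments conclude.\<close>

definition mpow :: "nat \<Rightarrow> ('a::comm_ring_1, 'm::finite) mfps set" where
  "mpow k = {f. \<forall>a. mdeg a < k \<longrightarrow> mfps_nth f a = 0}"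

lemma mpow_1_iff: "f \<in> mpow 1 \<longleftrightarrow> mfps_nth f 0 = 0"
  by (auto simp: mpow_def mdeg_eq_0_iff)

lemma mpow_0 [simp]: "f \<in> mpow 0"
  by (simp add: mpow_def)

lemma mpow_mult: "f \<in> mpow j \<Longrightarrow> g \<in> mpow k \<Longrightarrow> f * g \<in> mpow (j + k)"
proof -
  assume *: "f \<in> mpow j" "g \<in> mpow k"
  have "mfps_nth f p * mfps_nth g q = 0" if "mdeg (p + q) < j + k" for p q
    using that * by (cases "mdeg p < j") (auto simp: mpow_def mdeg_add)
  then show ?thesis
    by (auto simp: mpow_def nth_mult intro!: sum.neutral)
qed

lemma is_ideal_mpow: "is_ideal (mpow k)"
proof (rule is_idealI)
  show "r * x \<in> mpow k" if "x \<in> mpow k" for r x :: "('a,'b) mfps"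
    using mpow_mult[of r 0 x k] that by simp
qed (auto simp: mpow_def)

lemma mpow_power: "f \<in> mpow 1 \<Longrightarrow> f ^ k \<in> mpow k"
  using mpow_mult[of f 1] by (induction k) auto

lemma mpow_eqI: "(\<And>N. f - g \<in> mpow N) \<Longrightarrow> f = g"
proof (rule mfps_eqI)
  fix a assume "\<And>N. f - g \<in> mpow N"
  from this[of "Suc (mdeg a)"] show "mfps_nth f a = mfps_nth g a" by (auto simp: mpow_def)
qed

lemma Var_in_mpow: "Var i \<in> mpow 1"
proof -
  have "Poly_Mapping.single i (1::nat) \<noteq> 0"
    by (metis lookup_single_eq lookup_zero zero_neq_one)
  then show ?thesis unfolding mpow_1_iff Var_def nth_monom by auto
qed

lemma vanishes_on_box:
  assumes "a \<in> box S N"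
  shows "mfps_nth (\<Sum>i\<in>S. Var i ^ N * h i) a = 0"
  using assms by (auto simp: nth_Var_power_mult box_def intro!: sum.neutral)

text \<open>An exponent outside the box has some coordinate in \<open>S\<close> that is at least
  \<open>N\<close>. The choice \<open>ind\<close> fixes one such coordinate, so the terms of
  \<open>f\<close> are distributed without overlap and \<open>h i\<close> collects those assigned to
  \<open>i\<close>, divided by x_i^N. The division lowers the order by at most
  \<open>N\<close>.\<close>

lemma box_decomposition:
  fixes f :: "('a::comm_ring_1, 'm::finite) mfps"
  assumes "\<And>a. a \<in> box S N \<Longrightarrow> mfps_nth f a = 0" and "f \<in> mpow j"
  shows "\<exists>h. f = (\<Sum>i\<in>S. Var i ^ N * h i) \<and> (\<forall>i. h i \<in> mpow (j - N))"
proof -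
  define ind where "ind a = (SOME i. i \<in> S \<and> N \<le> Poly_Mapping.lookup a i)" for a :: "'m \<Rightarrow>\<^sub>0 nat"
  have ind: "ind a \<in> S \<and> N \<le> Poly_Mapping.lookup a (ind a)" if "a \<notin> box S N" for a
    unfolding ind_def by (rule someI_ex) (use that in \<open>auto simp: box_def not_less\<close>)
  define h where "h i = Abs_mfps (\<lambda>b. if b + Poly_Mapping.single i N \<notin> box S N \<and>
      ind (b + Poly_Mapping.single i N) = i then mfps_nth f (b + Poly_Mapping.single i N) else 0)" for i
  have *: "mfps_nth (Var i ^ N * h i) a = (if a \<notin> box S N \<and> ind a = i then mfps_nth f a else 0)" for i a
  proof (cases "N \<le> Poly_Mapping.lookup a i")
    case True
    have "a - Poly_Mapping.single i N + Poly_Mapping.single i N = a"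
      using True by (intro poly_mapping_eqI) (auto simp: lookup_add lookup_minus lookup_single when_def)
    then show ?thesis using True by (simp add: nth_Var_power_mult h_def)
  next
    case False
    then show ?thesis using ind[of a] by (auto simp: nth_Var_power_mult)
  qed
  have "f = (\<Sum>i\<in>S. Var i ^ N * h i)"
  proof (rule mfps_eqI)
    fix a
    show "mfps_nth f a = mfps_nth (\<Sum>i\<in>S. Var i ^ N * h i) a"
    proof (cases "a \<in> box S N")
      case False
      then have "mfps_nth (\<Sum>i\<in>S. Var i ^ N * h i) a = (\<Sum>i\<in>S. if i = ind a then mfps_nth f a else 0)"
        by (simp add: * eq_commute cong: if_cong)
      then show ?thesis using ind[OF False] by simp
    qed (simp add: assms *)
  qed
  moreover have "h i \<in> mpow (j - N)" for i
    using assms(2) by (auto simp: mpow_def h_def mdeg_add)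
  ultimately show ?thesis by blast
qed

lemma finite_box: "finite (box (UNIV :: 'm::finite set) N)"
proof -
  have "finite (PiE (UNIV::'m set) (\<lambda>_. {..<N}))" by (intro finite_PiE) auto
  moreover have "Poly_Mapping.lookup ` box UNIV N \<subseteq> PiE (UNIV::'m set) (\<lambda>_. {..<N})"
    by (auto simp: box_def)
  moreover have "inj_on Poly_Mapping.lookup (box (UNIV :: 'm set) N)"
    by (auto intro!: inj_onI poly_mapping_eqI)
  ultimately show ?thesis by (meson finite_imageD finite_subset)
qed

lemma mdeg_box: "a \<in> box (UNIV :: 'm::finite set) N \<Longrightarrow> mdeg a \<le> card (UNIV :: 'm set) * N"
  using sum_bounded_above[of "UNIV :: 'm set" "Poly_Mapping.lookup a" N]
  by (auto simp: box_def mdeg_def less_imp_le)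

lemma mpow_decomposition:
  fixes f :: "('a::comm_ring_1, 'm::finite) mfps"
  assumes "f \<in> mpow j" "card (UNIV :: 'm set) * N < j"
  shows "\<exists>h. f = (\<Sum>i\<in>UNIV. Var i ^ N * h i) \<and> (\<forall>i. h i \<in> mpow (j - N))"
proof (rule box_decomposition)
  show "mfps_nth f a = 0" if "a \<in> box UNIV N" for a
    using mdeg_box[OF that] assms by (auto simp: mpow_def)
qed (use assms in auto)

lemma const_plus_Var_decomposition:
  fixes f :: "('a::comm_ring_1, 'm::finite) mfps"
  shows "\<exists>h. f = mfps_const (mfps_nth f 0) + (\<Sum>i\<in>UNIV. Var i * h i)"
proof -
  have "mfps_nth (f - mfps_const (mfps_nth f 0)) a = 0" if "a \<in> box UNIV 1" for a
  proof -
    have "a = 0" using that by (auto simp: box_def intro: poly_mapping_eqI)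
    then show ?thesis by (simp add: nth_const)
  qed
  from box_decomposition[where S = UNIV and N = 1, OF this mpow_0] obtain h
    where "f - mfps_const (mfps_nth f 0) = (\<Sum>i\<in>UNIV. Var i * h i)" by auto
  then show ?thesis by (auto simp: algebra_simps intro!: exI[of _ h])
qed

subsection \<open>Infinite sums\<close>

text \<open>The truncation at \<open>mdeg a\<close> is harmless only if \<open>p\<close> has no constant term.\<close>

definition psum :: "('a::comm_ring_1, 'm::finite) mfps \<Rightarrow> (nat \<Rightarrow> ('a, 'm) mfps) \<Rightarrow> ('a, 'm) mfps" where
  "psum p b = Abs_mfps (\<lambda>a. \<Sum>k\<le>mdeg a. mfps_nth (p ^ k * b k) a)"

lemma psum_approx:
  assumes "p \<in> mpow 1"
  shows "psum p b - (\<Sum>k<N. p ^ k * b k) \<in> mpow N"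
  unfolding mpow_def
proof safe
  fix a :: "'b \<Rightarrow>\<^sub>0 nat" assume a: "mdeg a < N"
  have "mfps_nth (p ^ k * b k) a = 0" if "mdeg a < k" for k
    using mpow_mult[OF mpow_power[OF assms, of k] mpow_0[of "b k"]] that by (auto simp: mpow_def)
  then have "(\<Sum>k<N. mfps_nth (p ^ k * b k) a) = (\<Sum>k\<le>mdeg a. mfps_nth (p ^ k * b k) a)"
    using a by (intro sum.mono_neutral_right) auto
  then show "mfps_nth (psum p b - (\<Sum>k<N. p ^ k * b k)) a = 0" by (simp add: psum_def)
qed

lemma psum_eqI:
  assumes "p \<in> mpow 1" "\<And>N. g - (\<Sum>k<N. p ^ k * b k) \<in> mpow N"
  shows "g = psum p b"
proof (rule mpow_eqI)
  fix N
  have "g - psum p b = (g - (\<Sum>k<N. p ^ k * b k)) - (psum p b - (\<Sum>k<N. p ^ k * b k))" by simp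
  then show "g - psum p b \<in> mpow N"
    by (simp only: ideal_diff[OF is_ideal_mpow assms(2) psum_approx[OF assms(1)]])
qed

lemma psum_mult:
  assumes "p \<in> mpow 1"
  shows "psum p b * g = psum p (\<lambda>k. b k * g)"
proof (rule psum_eqI[OF assms])
  fix N
  have "psum p b * g - (\<Sum>k<N. p ^ k * (b k * g)) = g * (psum p b - (\<Sum>k<N. p ^ k * b k))"
    by (simp add: algebra_simps sum_distrib_left)
  then show "psum p b * g - (\<Sum>k<N. p ^ k * (b k * g)) \<in> mpow N"
    by (simp only: ideal_mult[OF is_ideal_mpow psum_approx[OF assms]])
qed

lemma psum_add:
  assumes "p \<in> mpow 1"
  shows "psum p b + psum p c = psum p (\<lambda>k. b k + c k)"
  by (rule mfps_eqI) (simp add: psum_def distrib_left sum.distrib)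

text \<open>After scaling the constant term to 1, the inverse is the geometric series in
  \<open>g\<close>.\<close>

lemma unit_if_const_nonzero:
  fixes f :: "('a::field, 'm::finite) mfps"
  assumes "mfps_nth f 0 \<noteq> 0"
  shows "f dvd 1"
proof -
  define g where "g = 1 - mfps_const (1 / mfps_nth f 0) * f"
  have g: "g \<in> mpow 1" using assms unfolding mpow_1_iff g_def by (simp add: nth_one)
  have "(1 - g) * psum g (\<lambda>_. 1) = 1"
  proof (rule mpow_eqI)
    fix N
    have "(1 - g) * (\<Sum>k<N. g ^ k) = 1 - g ^ N"
      by (rule one_diff_power_eq[symmetric])
    then have "(1 - g) * psum g (\<lambda>_. 1) - 1 = (1 - g) * (psum g (\<lambda>_. 1) - (\<Sum>k<N. g ^ k * 1)) - g ^ N"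
      by (simp add: algebra_simps)
    then show "(1 - g) * psum g (\<lambda>_. 1) - 1 \<in> mpow N"
      using psum_approx[OF g, of "\<lambda>_. 1" N] mpow_power[OF g, of N]
      by (simp add: ideal_diff ideal_mult is_ideal_mpow)
  qed
  then have "f * (mfps_const (1 / mfps_nth f 0) * psum g (\<lambda>_. 1)) = 1"
    by (simp add: g_def mult_ac)
  then show ?thesis by (metis dvdI)
qed

subsection \<open>Evaluation of a univariate power series\<close>

text \<open>Substitution of \<open>p\<close> for the variable of a univariate series. For
  \<open>p\<close> in \<open>mpow 1\<close> it makes the ring an algebra over K[[s]], with s acting
  as multiplication by \<open>p\<close>.\<close>

definition ev :: "('a::comm_ring_1, 'm::finite) mfps \<Rightarrow> 'a fps \<Rightarrow> ('a, 'm) mfps" where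
  "ev p c = psum p (\<lambda>k. mfps_const (fps_nth c k))"

lemma ev_add: "p \<in> mpow 1 \<Longrightarrow> ev p (c + d) = ev p c + ev p d"
  by (simp add: ev_def psum_add mfps_const_add)

lemma ev_const: 
  assumes "p \<in> mpow 1" shows "ev p (fps_const c) = mfps_const c"
  unfolding ev_def
proof (rule psum_eqI[OF assms, symmetric])
  fix N
  show "mfps_const c - (\<Sum>k<N. p ^ k * mfps_const (fps_nth (fps_const c) k)) \<in> mpow N"
  proof (cases N)
    case (Suc M)
    have "(\<Sum>k<N. p ^ k * mfps_const (fps_nth (fps_const c) k)) = (\<Sum>k\<in>{0}. p ^ k * mfps_const (fps_nth (fps_const c) k))"
      by (rule sum.mono_neutral_right) (auto simp: Suc)
    then show ?thesis by (simp add: ideal_zero is_ideal_mpow)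
  qed auto
qed

lemma ev_0 [simp]: "ev p 0 = 0"
  by (simp add: ev_def psum_def mfps_eqI)

lemma ev_1: "p \<in> mpow 1 \<Longrightarrow> ev p 1 = 1"
  using ev_const[of p 1] by (simp flip: fps_const_1_eq_1)

lemma ev_X_mult: 
  assumes "p \<in> mpow 1"
  shows "ev p (fps_X * c) = p * ev p c"
  unfolding ev_def
proof (rule psum_eqI[OF assms, symmetric])
  fix N
  show "p * psum p (\<lambda>k. mfps_const (fps_nth c k)) - (\<Sum>k<N. p ^ k * mfps_const (fps_nth (fps_X * c) k)) \<in> mpow N"
  proof (cases N)
    case (Suc M)
    have "(\<Sum>k<N. p ^ k * mfps_const (fps_nth (fps_X * c) k)) = p * (\<Sum>k<M. p ^ k * mfps_const (fps_nth c k))"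
      unfolding Suc sum.lessThan_Suc_shift by (simp add: sum_distrib_left mult_ac)
    then have "p * psum p (\<lambda>k. mfps_const (fps_nth c k)) - (\<Sum>k<N. p ^ k * mfps_const (fps_nth (fps_X * c) k))
       = p * (psum p (\<lambda>k. mfps_const (fps_nth c k)) - (\<Sum>k<M. p ^ k * mfps_const (fps_nth c k)))"
      by (simp add: algebra_simps)
    then show ?thesis using mpow_mult[OF assms psum_approx[OF assms]] Suc by simp
  qed auto
qed

lemma ev_X: "p \<in> mpow 1 \<Longrightarrow> ev p fps_X = p"
  using ev_X_mult[of p 1] by (simp add: ev_1)

lemma ev_X_power_mult: "p \<in> mpow 1 \<Longrightarrow> ev p (fps_X ^ k * c) = p ^ k * ev p c"
  by (induction k) (auto simp: ev_X_mult mult.assoc)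

lemma ev_X_power: "p \<in> mpow 1 \<Longrightarrow> ev p (fps_X ^ k) = p ^ k"
  using ev_X_power_mult[of p k 1] by (simp add: ev_1)

lemma ev_const_mult: 
  assumes "p \<in> mpow 1"
  shows "ev p (fps_const a * c) = mfps_const a * ev p c"
proof -
  have "ev p c * mfps_const a = psum p (\<lambda>k. mfps_const (fps_nth c k) * mfps_const a)"
    unfolding ev_def by (rule psum_mult[OF assms])
  then show ?thesis by (simp add: ev_def mfps_const_mult mult.commute)
qed

lemma ev_uminus: "p \<in> mpow 1 \<Longrightarrow> ev p (- c) = - ev p c"
  using ev_add[of p c "- c"] by (simp add: eq_neg_iff_add_eq_0 add.commute)

lemma ev_diff: "p \<in> mpow 1 \<Longrightarrow> ev p (c - d) = ev p c - ev p d"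
  using ev_add[of p c "- d"] ev_uminus[of p d] by simp

lemma ev_sum: "p \<in> mpow 1 \<Longrightarrow> ev p (sum c A) = (\<Sum>i\<in>A. ev p (c i))"
  by (induction A rule: infinite_finite_induct) (auto simp: ev_add)

lemma fps_split_shift:
  fixes c :: "'a::comm_ring_1 fps"
  shows "c = (\<Sum>k<N. fps_const (fps_nth c k) * fps_X ^ k) + fps_X ^ N * fps_shift N c"
proof (rule fps_ext)
  fix n
  have *: "fps_nth (\<Sum>k<N. fps_const (fps_nth c k) * fps_X ^ k) n = (\<Sum>k<N. if n = k then fps_nth c k else 0)"
    unfolding fps_sum_nth by (rule sum.cong) (auto simp: fps_mult_left_const_nth fps_X_power_nth)
  show "fps_nth c n = fps_nth ((\<Sum>k<N. fps_const (fps_nth c k) * fps_X ^ k) + fps_X ^ N * fps_shift N c) n"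
    unfolding fps_add_nth * by (simp add: fps_X_power_mult_nth)
qed

text \<open>Cutting \<open>c\<close> at degree \<open>N\<close> leaves a polynomial, for which
  linearity and \<open>ev_X_power_mult\<close> suffice. The remainders are divisible by p^N on both
  sides, and \<open>N\<close> is arbitrary.\<close>

lemma ev_mult: 
  assumes "p \<in> mpow 1"
  shows "ev p (c * d) = ev p c * ev p d"
proof (rule mpow_eqI)
  fix N
  have "c * d = (\<Sum>k<N. fps_const (fps_nth c k) * (fps_X ^ k * d)) + fps_X ^ N * (fps_shift N c * d)"
    by (subst fps_split_shift[of c N]) (simp add: distrib_right sum_distrib_right mult.assoc)
  then have 1: "ev p (c * d) = (\<Sum>k<N. mfps_const (fps_nth c k) * (p ^ k * ev p d)) + p ^ N * ev p (fps_shift N c * d)"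
    using assms by (simp only: ev_add ev_sum ev_const_mult ev_X_power_mult)
  have "ev p c = ev p ((\<Sum>k<N. fps_const (fps_nth c k) * (fps_X ^ k * 1)) + fps_X ^ N * fps_shift N c)"
    using fps_split_shift[of c N] by simp
  also have "\<dots> = (\<Sum>k<N. mfps_const (fps_nth c k) * p ^ k) + p ^ N * ev p (fps_shift N c)"
    using assms by (simp only: ev_add ev_sum ev_const_mult ev_X_power_mult ev_X_power mult_1_right)
  finally have 2: "ev p c * ev p d = (\<Sum>k<N. mfps_const (fps_nth c k) * (p ^ k * ev p d)) + p ^ N * ev p (fps_shift N c) * ev p d"
    by (simp add: distrib_right sum_distrib_right mult.assoc)
  have "ev p (c * d) - ev p c * ev p d = p ^ N * (ev p (fps_shift N c * d) - ev p (fps_shift N c) * ev p d)"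
    unfolding 1 2 by (simp add: algebra_simps)
  then show "ev p (c * d) - ev p c * ev p d \<in> mpow N"
    using mpow_mult[OF mpow_power[OF assms, of N] mpow_0] by simp
qed

subsection \<open>Derivatives\<close>

lemma nth_deriv:
  "mfps_nth (mfps_deriv i f) a = of_nat (Poly_Mapping.lookup a i + 1) * mfps_nth f (a + Poly_Mapping.single i 1)"
  by transfer simp

lemma deriv_add: "mfps_deriv i (f + g) = mfps_deriv i f + mfps_deriv i g"
  by (rule mfps_eqI) (simp add: nth_deriv algebra_simps)

lemma deriv_const [simp]: "mfps_deriv i (mfps_const c) = 0"
proof (rule mfps_eqI)
  fix a :: "'b \<Rightarrow>\<^sub>0 nat"
  have "a + Poly_Mapping.single i 1 \<noteq> 0"
    by (auto dest: arg_cong[of _ _ "\<lambda>a. Poly_Mapping.lookup a i"] simp: lookup_add)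
  then show "mfps_nth (mfps_deriv i (mfps_const c)) a = mfps_nth 0 a"
    by (simp add: nth_deriv nth_const)
qed

lemma deriv_Var: "mfps_deriv i (Var j) = (if i = j then 1 else 0)"
proof (rule mfps_eqI)
  fix a :: "'b \<Rightarrow>\<^sub>0 nat"
  have "a + Poly_Mapping.single i 1 = Poly_Mapping.single j 1 \<longleftrightarrow> i = j \<and> a = 0"
  proof
    assume *: "a + Poly_Mapping.single i 1 = Poly_Mapping.single j 1"
    then have "Poly_Mapping.lookup (a + Poly_Mapping.single i 1) i = Poly_Mapping.lookup (Poly_Mapping.single j 1) i"
      by simp
    then have "i = j" by (auto simp: lookup_add lookup_single when_def split: if_splits)
    with * show "i = j \<and> a = 0" by simp
  qed auto
  then show "mfps_nth (mfps_deriv i (Var j)) a = mfps_nth (if i = j then 1 else 0) a"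
    by (auto simp: nth_deriv Var_def nth_monom nth_one)
qed

text \<open>One half of the Leibniz rule: the factor that differentiation produces is the exponent
  of \<open>i\<close> in p + q, and the share that belongs to \<open>p\<close> differentiates
  \<open>f\<close>. The sum is reindexed by lowering \<open>p\<close> by one in direction
  \<open>i\<close>.\<close>

lemma deriv_mult_aux:
  fixes f g :: "('a::comm_ring_1, 'm) mfps"
  shows "(\<Sum>(p, q) | p + q = a + Poly_Mapping.single i 1.
       of_nat (Poly_Mapping.lookup p i) * (mfps_nth f p * mfps_nth g q)) = mfps_nth (mfps_deriv i f * g) a"
proof -
  let ?e = "Poly_Mapping.single i (1::nat)"
  let ?S = "{(p, q). p + q = a + ?e} \<inter> {(p, q). Poly_Mapping.lookup p i \<noteq> 0}"
  have "(\<Sum>(p, q) | p + q = a + ?e. of_nat (Poly_Mapping.lookup p i) * (mfps_nth f p * mfps_nth g q))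
     = (\<Sum>(p, q)\<in>?S. of_nat (Poly_Mapping.lookup p i) * (mfps_nth f p * mfps_nth g q))"
    by (rule sum.mono_neutral_right[OF finite_exponent_splits]) (auto intro: gr0I)
  also have "\<dots> = (\<Sum>(p, q) | p + q = a. mfps_nth (mfps_deriv i f) p * mfps_nth g q)"
  proof (rule sum.reindex_bij_witness[of _ "\<lambda>(p, q). (p + ?e, q)" "\<lambda>(p, q). (p - ?e, q)"])
    fix x assume x: "x \<in> ?S"
    obtain p q where pq: "x = (p, q)" by force
    have pe: "p - ?e + ?e = p"
      using x pq by (intro poly_mapping_eqI) (auto simp: lookup_add lookup_minus lookup_single when_def)
    show "(case case x of (p, q) \<Rightarrow> (p - ?e, q) of (p, q) \<Rightarrow> (p + ?e, q)) = x"
      using pe by (simp add: pq)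
    have "(p - ?e) + q + ?e = (p - ?e + ?e) + q" by (simp only: add_ac)
    also have "\<dots> = a + ?e" using x pq pe by simp
    finally show "(case x of (p, q) \<Rightarrow> (p - ?e, q)) \<in> {(p, q). p + q = a}"
      by (simp add: pq)
    have "Poly_Mapping.lookup (p - ?e) i + 1 = Poly_Mapping.lookup p i"
      using x pq by (auto simp: lookup_minus)
    then show "(case case x of (p, q) \<Rightarrow> (p - ?e, q) of (p, q) \<Rightarrow> mfps_nth (mfps_deriv i f) p * mfps_nth g q) =
       (case x of (p, q) \<Rightarrow> of_nat (Poly_Mapping.lookup p i) * (mfps_nth f p * mfps_nth g q))"
      by (simp only: pq prod.case nth_deriv pe mult.assoc)
  next
    fix y assume y: "y \<in> {(p, q). p + q = a}"
    then show "(case case y of (p, q) \<Rightarrow> (p + ?e, q) of (p, q) \<Rightarrow> (p - ?e, q)) = y"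
       "(case y of (p, q) \<Rightarrow> (p + ?e, q)) \<in> ?S"
      by (auto simp: add_ac lookup_add)
  qed
  also have "\<dots> = mfps_nth (mfps_deriv i f * g) a" by (simp add: nth_mult)
  finally show ?thesis .
qed

lemma deriv_mult:
  fixes f g :: "('a::comm_ring_1, 'm) mfps"
  shows "mfps_deriv i (f * g) = mfps_deriv i f * g + f * mfps_deriv i g"
proof (rule mfps_eqI)
  fix a :: "'m \<Rightarrow>\<^sub>0 nat"
  let ?e = "Poly_Mapping.single i (1::nat)"
  let ?S = "{(p, q). p + q = a + ?e}"
  have "mfps_nth (mfps_deriv i (f * g)) a =
     (\<Sum>(p, q)\<in>?S. of_nat (Poly_Mapping.lookup (a + ?e) i) * (mfps_nth f p * mfps_nth g q))"
    by (simp add: nth_deriv nth_mult sum_distrib_left case_prod_unfold lookup_add)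
  also have "\<dots> = (\<Sum>(p, q)\<in>?S. of_nat (Poly_Mapping.lookup p i) * (mfps_nth f p * mfps_nth g q) +
      of_nat (Poly_Mapping.lookup q i) * (mfps_nth f p * mfps_nth g q))"
  proof (rule sum.cong[OF refl])
    fix x assume x: "x \<in> ?S"
    obtain p q where pq: "x = (p, q)" by force
    have "Poly_Mapping.lookup (a + ?e) i = Poly_Mapping.lookup p i + Poly_Mapping.lookup q i"
      using x by (simp add: pq flip: lookup_add)
    then show "(case x of (p, q) \<Rightarrow> of_nat (Poly_Mapping.lookup (a + ?e) i) * (mfps_nth f p * mfps_nth g q)) =
      (case x of (p, q) \<Rightarrow> of_nat (Poly_Mapping.lookup p i) * (mfps_nth f p * mfps_nth g q) +
      of_nat (Poly_Mapping.lookup q i) * (mfps_nth f p * mfps_nth g q))"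
      by (simp add: pq distrib_right)
  qed
  also have "\<dots> = (\<Sum>(p, q)\<in>?S. of_nat (Poly_Mapping.lookup p i) * (mfps_nth f p * mfps_nth g q)) +
     (\<Sum>(p, q)\<in>?S. of_nat (Poly_Mapping.lookup q i) * (mfps_nth f p * mfps_nth g q))"
    by (simp add: sum.distrib case_prod_unfold)
  also have "(\<Sum>(p, q)\<in>?S. of_nat (Poly_Mapping.lookup q i) * (mfps_nth f p * mfps_nth g q)) =
     (\<Sum>(p, q)\<in>?S. of_nat (Poly_Mapping.lookup p i) * (mfps_nth g p * mfps_nth f q))"
    by (rule sum.reindex_bij_witness[of _ "\<lambda>(i, j). (j, i)" "\<lambda>(i, j). (j, i)"])
       (auto simp: add.commute mult.commute)
  finally show "mfps_nth (mfps_deriv i (f * g)) a = mfps_nth (mfps_deriv i f * g + f * mfps_deriv i g) a"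
    unfolding deriv_mult_aux nth_add mult.commute[of f] .
qed

subsection \<open>Linear dependence\<close>

text \<open>Fraction-free Gaussian elimination, valid over any integral domain: with the pivot
  \<open>v k b\<close>, the combinations \<open>v k b * v i b' - v i b * v k b'\<close> vanish in
  column \<open>b\<close>. It serves for a field, for K[[s]] and for K[T].\<close>

lemma linear_dependence:
  fixes v :: "'i \<Rightarrow> 'b \<Rightarrow> 'd::idom"
  assumes "finite B" "finite I" "card B < card I"
  shows "\<exists>c. (\<exists>i\<in>I. c i \<noteq> 0) \<and> (\<forall>b\<in>B. (\<Sum>i\<in>I. c i * v i b) = 0)"
  using assms
proof (induction B arbitrary: I v rule: finite_induct)
  case empty
  then have "I \<noteq> {}" by auto
  then show ?case by (intro exI[of _ "\<lambda>_. 1"]) auto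
next
  case (insert b B)
  show ?case
  proof (cases "\<forall>i\<in>I. v i b = 0")
    case True
    from insert.IH[of I v] insert.prems insert.hyps obtain c
      where "\<exists>i\<in>I. c i \<noteq> 0" "\<forall>b\<in>B. (\<Sum>i\<in>I. c i * v i b) = 0" by auto
    with True show ?thesis by (intro exI[of _ c]) auto
  next
    case False
    then obtain k where k: "k \<in> I" "v k b \<noteq> 0" by auto
    define I' where "I' = I - {k}"
    have I': "finite I'" "k \<notin> I'" "I = insert k I'" using k insert.prems by (auto simp: I'_def)
    then have "card B < card I'" using insert.prems insert.hyps by simp
    from insert.IH[OF I'(1) this, of "\<lambda>i b'. v k b * v i b' - v i b * v k b'"] obtain c
      where c: "\<exists>i\<in>I'. c i \<noteq> 0" "\<forall>b'\<in>B. (\<Sum>i\<in>I'. c i * (v k b * v i b' - v i b * v k b')) = 0"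
      by auto
    define d where "d i = (if i = k then - (\<Sum>i\<in>I'. c i * v i b) else v k b * c i)" for i
    have *: "(\<Sum>i\<in>I. d i * v i b') = (\<Sum>i\<in>I'. c i * (v k b * v i b' - v i b * v k b'))" for b'
    proof -
      have "(\<Sum>i\<in>I. d i * v i b') = d k * v k b' + (\<Sum>i\<in>I'. d i * v i b')"
        using I' by simp
      also have "(\<Sum>i\<in>I'. d i * v i b') = (\<Sum>i\<in>I'. v k b * c i * v i b')"
        using I' by (intro sum.cong) (auto simp: d_def)
      also have "d k * v k b' = - (\<Sum>i\<in>I'. c i * v i b * v k b')"
        by (simp add: d_def sum_distrib_right)
      finally show ?thesis
        by (simp add: sum_subtractf right_diff_distrib mult_ac)
    qed
    have "(\<Sum>i\<in>I. d i * v i b') = 0" if "b' \<in> insert b B" for b'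
      using that c(2) unfolding * by (auto simp: mult.commute)
    moreover have "\<exists>i\<in>I. d i \<noteq> 0"
      using c(1) k I' by (auto simp: d_def)
    ultimately show ?thesis by blast
  qed
qed

text \<open>Applied to the powers of one element, this supplies an algebraic equation modulo
  \<open>I\<close>. The map \<open>ph\<close> is the structure map of the coefficient ring, either
  \<open>mfps_const\<close> or \<open>ev\<close>.\<close>

lemma linear_dependence_mod_ideal:
  fixes ph :: "'d::idom \<Rightarrow> 'r::comm_ring_1"
  assumes ph: "\<And>x y. ph (x + y) = ph x + ph y" "\<And>x y. ph (x * y) = ph x * ph y" "ph 0 = 0"
    and I: "is_ideal I"
    and g: "\<And>j. j \<in> J \<Longrightarrow> \<exists>c. g j - (\<Sum>l<r. ph (c l) * e l) \<in> I"
    and J: "finite J" "r < card J"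
  shows "\<exists>d. (\<exists>j\<in>J. d j \<noteq> 0) \<and> (\<Sum>j\<in>J. ph (d j) * g j) \<in> I"
proof -
  have ph_sum: "ph (sum f A) = (\<Sum>i\<in>A. ph (f i))" for f :: "'z \<Rightarrow> 'd" and A
    by (induction A rule: infinite_finite_induct) (auto simp: ph)
  from g obtain c where c: "\<And>j. j \<in> J \<Longrightarrow> g j - (\<Sum>l<r. ph (c j l) * e l) \<in> I" by metis
  obtain d where d: "\<exists>j\<in>J. d j \<noteq> 0" "\<And>l. l < r \<Longrightarrow> (\<Sum>j\<in>J. d j * c j l) = 0"
    using linear_dependence[of "{..<r}" J c] J by auto
  have "(\<Sum>j\<in>J. ph (d j) * (\<Sum>l<r. ph (c j l) * e l)) = (\<Sum>j\<in>J. \<Sum>l<r. ph (d j * c j l) * e l)"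
    by (simp add: sum_distrib_left ph mult.assoc)
  also have "\<dots> = (\<Sum>l<r. \<Sum>j\<in>J. ph (d j * c j l) * e l)" by (rule sum.swap)
  also have "\<dots> = (\<Sum>l<r. ph (\<Sum>j\<in>J. d j * c j l) * e l)"
    by (simp only: ph_sum sum_distrib_right)
  also have "\<dots> = 0" by (simp add: d ph)
  finally have "(\<Sum>j\<in>J. ph (d j) * g j) = (\<Sum>j\<in>J. ph (d j) * (g j - (\<Sum>l<r. ph (c j l) * e l)))"
    by (simp add: right_diff_distrib sum_subtractf)
  also have "\<dots> \<in> I" by (intro ideal_sum ideal_mult I c)
  finally show ?thesis using d(1) by blast
qed

lemma is_ideal_plus_principal:
  assumes A: "is_ideal A" shows "is_ideal {g. \<exists>h. g - p * h \<in> A}"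
proof (rule is_idealI; safe)
  show "\<exists>h. 0 - p * h \<in> A" using A by (auto intro!: exI[of _ 0] ideal_zero)
next
  fix x y h h' assume "x - p * h \<in> A" "y - p * h' \<in> A"
  from ideal_add[OF A this] have "x + y - p * (h + h') \<in> A" by (simp add: algebra_simps)
  then show "\<exists>h. x + y - p * h \<in> A" by (rule exI)
next
  fix r x h assume "x - p * h \<in> A"
  from ideal_mult[OF A this, of r] have "r * x - p * (r * h) \<in> A" by (simp add: algebra_simps)
  then show "\<exists>h. r * x - p * h \<in> A" by (rule exI)
qed

text \<open>The saturation of \<open>I\<close> by \<open>f\<close>: dividing by it is dividing by
  \<open>I\<close> and then by the f-torsion.\<close>

lemma is_ideal_colon_powers:
  assumes I: "is_ideal I" shows "is_ideal {g. \<exists>k. f ^ k * g \<in> I}"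
proof (rule is_idealI; safe)
  show "\<exists>k. f ^ k * 0 \<in> I" using I by (auto intro: ideal_zero)
next
  fix x y k l assume "f ^ k * x \<in> I" "f ^ l * y \<in> I"
  then have "f ^ l * (f ^ k * x) + f ^ k * (f ^ l * y) \<in> I"
    by (simp add: ideal_add[OF I] ideal_mult[OF I])
  then have "f ^ (k + l) * (x + y) \<in> I" by (simp add: power_add algebra_simps)
  then show "\<exists>k. f ^ k * (x + y) \<in> I" by (rule exI)
next
  fix r x k assume "f ^ k * x \<in> I"
  from ideal_mult[OF I this, of r] have "f ^ k * (r * x) \<in> I" by (simp add: mult.left_commute)
  then show "\<exists>k. f ^ k * (r * x) \<in> I" by (rule exI)
qed

subsection \<open>Ideals of finite codimension\<close>

text \<open>The quotient is spanned over K by \<open>r\<close> classes. Asking only for a spanning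
  family avoids quotient spaces; the codimension is the least such \<open>r\<close>.\<close>

definition codim_le :: "('a::field, 'm::finite) mfps set \<Rightarrow> nat \<Rightarrow> bool" where
  "codim_le I r \<longleftrightarrow> (\<exists>e. \<forall>g. \<exists>c. g - (\<Sum>j<r. mfps_const (c j) * e j) \<in> I)"

lemma codim_le_superset: "codim_le I r \<Longrightarrow> I \<subseteq> J \<Longrightarrow> codim_le J r"
  unfolding codim_le_def by (meson subsetD)

text \<open>The r + 1 powers of \<open>g\<close> up to g^r are linearly dependent modulo
  \<open>I\<close>. Since \<open>g\<close> has no constant term, the relation is its lowest power
  g^k times a unit.\<close>

lemma nilpotent_mod_finite_codim:
  fixes g :: "('a::field, 'm::finite) mfps"
  assumes I: "is_ideal I" and "codim_le I r" and g: "g \<in> mpow 1"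
  shows "\<exists>k. g ^ k \<in> I"
proof -
  from assms obtain e where e: "\<And>g. \<exists>c. g - (\<Sum>l<r. mfps_const (c l) * e l) \<in> I"
    unfolding codim_le_def by blast
  obtain d where d: "\<exists>j\<in>{..r}. d j \<noteq> 0" "(\<Sum>j\<le>r. mfps_const (d j) * g ^ j) \<in> I"
    using linear_dependence_mod_ideal[where ph = mfps_const and I = I and J = "{..r}" and
        g = "\<lambda>j. g ^ j" and r = r and e = e] e I
    by (auto simp: mfps_const_add mfps_const_mult)
  define k where "k = (LEAST j. d j \<noteq> 0)"
  have k: "d k \<noteq> 0" unfolding k_def by (rule LeastI_ex) (use d in auto)
  have k': "d j = 0" if "j < k" for j using not_less_Least[of j "\<lambda>j. d j \<noteq> 0"] that by (auto simp: k_def)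
  have "k \<le> r" using d(1) k' by (meson atMost_iff le_trans not_le_imp_less)
  define w where "w = (\<Sum>j\<in>{k..r}. mfps_const (d j) * g ^ (j - k))"
  have "(\<Sum>j\<le>r. mfps_const (d j) * g ^ j) = (\<Sum>j\<in>{k..r}. mfps_const (d j) * g ^ j)"
    by (rule sum.mono_neutral_right) (auto simp: k')
  also have "\<dots> = g ^ k * w"
    unfolding w_def sum_distrib_left
    by (rule sum.cong) (auto simp: mult_ac simp flip: power_add)
  finally have gw: "g ^ k * w \<in> I" using d by simp
  have g0: "mfps_nth (g ^ j) 0 = (if j = 0 then 1 else 0)" for j
    using g unfolding mpow_1_iff by (cases j) (auto simp: nth_mult_0 nth_one)
  have "mfps_nth w 0 = (\<Sum>j\<in>{k..r}. if j = k then d k else 0)"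
    unfolding w_def nth_sum by (rule sum.cong) (auto simp: g0)
  also have "\<dots> = d k" using \<open>k \<le> r\<close> by simp
  finally have "w dvd 1" using k by (intro unit_if_const_nonzero) simp
  then obtain w' where "1 = w * w'" by (auto simp: dvd_def)
  then have "g ^ k = g ^ k * w * w'" by (simp add: mult.assoc)
  then show ?thesis using ideal_mult_right[OF I gw] by metis
qed

text \<open>The sum of the individual exponents is a common exponent \<open>N\<close>, and the
  monomials in the box of side \<open>N\<close> span the quotient.\<close>

lemma finite_codim_if_Var_powers:
  fixes I :: "('a::field, 'm::finite) mfps set"
  assumes I: "is_ideal I" and V: "\<And>i. \<exists>k. Var i ^ k \<in> I"
  shows "\<exists>N. \<forall>i. Var i ^ N \<in> I" "\<exists>r. codim_le I r"
proof -
  from V obtain k where k: "\<And>i. Var i ^ k i \<in> I" by metis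
  define N where "N = (\<Sum>i\<in>UNIV. k i)"
  have N: "Var i ^ N \<in> I" for i
  proof -
    have "k i \<le> N" unfolding N_def by (intro member_le_sum) auto
    then have "Var i ^ N = (Var i :: ('a, 'm) mfps) ^ (N - k i) * Var i ^ k i" by (simp flip: power_add)
    then show ?thesis by (simp only: ideal_mult[OF I k])
  qed
  then show "\<exists>N. \<forall>i. Var i ^ N \<in> I" by blast
  let ?B = "box (UNIV :: 'm set) N"
  obtain b where b: "bij_betw b {..<card ?B} ?B"
    using ex_bij_betw_nat_finite[OF finite_box[of N]] by (auto simp: atLeast0LessThan)
  have "\<exists>c. g - (\<Sum>j<card ?B. mfps_const (c j) * mfps_monom (b j)) \<in> I" for g
  proof (intro exI)
    let ?g = "g - (\<Sum>j<card ?B. mfps_const (mfps_nth g (b j)) * mfps_monom (b j))"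
    have "mfps_nth ?g a = 0" if "a \<in> ?B" for a
    proof -
      have "mfps_nth (\<Sum>j<card ?B. mfps_const (mfps_nth g (b j)) * mfps_monom (b j)) a =
         (\<Sum>j<card ?B. mfps_nth g (b j) * (if a = b j then 1 else 0))"
        by (simp add: nth_monom)
      also have "\<dots> = (\<Sum>x\<in>?B. mfps_nth g x * (if a = x then 1 else 0))"
        by (rule sum.reindex_bij_betw[OF b])
      also have "\<dots> = mfps_nth g a" using that by (simp add: if_distrib finite_box cong: if_cong)
      finally show ?thesis by simp
    qed
    from box_decomposition[OF this mpow_0] obtain h where "?g = (\<Sum>i\<in>UNIV. Var i ^ N * h i)" by blast
    then show "?g \<in> I" using N I by (auto intro: ideal_sum ideal_mult_right)
  qed
  then show "\<exists>r. codim_le I r"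
    unfolding codim_le_def by (intro exI[of _ "card ?B"] exI[of _ "\<lambda>j. mfps_monom (b j)"] allI)
qed

subsection \<open>Finite generation over a power series ring in one element\<close>

lemma psum_sum:
  assumes "p \<in> mpow 1"
  shows "(\<Sum>i\<in>A. psum p (b i)) = psum p (\<lambda>k. \<Sum>i\<in>A. b i k)"
proof (induction A rule: infinite_finite_induct)
  case (insert x A)
  then show ?case by (simp add: psum_add[OF assms])
qed (simp_all add: psum_def mfps_eqI)

text \<open>A complete form of Nakayama's lemma: what spans over K modulo \<open>p\<close> and the
  ideal generates over K[[s]] modulo the ideal. The remainder of each step is divided by
  \<open>p\<close> and treated again; as there are finitely many generators \<open>a i\<close>, the
  contributions to each coefficient form a convergent series, and the limit stays in the
  ideal.\<close>

lemma generated_by_successive_approximation: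
  fixes p :: "('a::field, 'm::finite) mfps" and a :: "'i::finite \<Rightarrow> ('a, 'm) mfps"
  assumes p: "p \<in> mpow 1"
    and approx: "\<And>g. \<exists>c h. g - (\<Sum>j<r. mfps_const (c j) * e j) - p * h \<in> generated_ideal a"
  shows "\<exists>c. g - (\<Sum>j<r. ev p (c j) * e j) \<in> generated_ideal a"
proof -
  have "\<forall>g. \<exists>c h b. g = (\<Sum>j<r. mfps_const (c j) * e j) + (\<Sum>i\<in>UNIV. a i * b i) + p * h"
  proof
    fix g
    from approx[of g] obtain c h b
      where "g - (\<Sum>j<r. mfps_const (c j) * e j) - p * h = (\<Sum>i\<in>UNIV. a i * b i)"
      by (auto simp: generated_ideal_def)
    then have "g = (\<Sum>j<r. mfps_const (c j) * e j) + (\<Sum>i\<in>UNIV. a i * b i) + p * h"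
      by (simp add: algebra_simps)
    then show "\<exists>c h b. g = (\<Sum>j<r. mfps_const (c j) * e j) + (\<Sum>i\<in>UNIV. a i * b i) + p * h"
      by (intro exI)
  qed
  from choice[OF this] obtain C where
    "\<forall>g. \<exists>h b. g = (\<Sum>j<r. mfps_const (C g j) * e j) + (\<Sum>i\<in>UNIV. a i * b i) + p * h" by (rule exE)
  from choice[OF this] obtain H where
    "\<forall>g. \<exists>b. g = (\<Sum>j<r. mfps_const (C g j) * e j) + (\<Sum>i\<in>UNIV. a i * b i) + p * H g" by (rule exE)
  from choice[OF this] obtain B where step:
    "\<forall>g. g = (\<Sum>j<r. mfps_const (C g j) * e j) + (\<Sum>i\<in>UNIV. a i * B g i) + p * H g" by (rule exE)
  \<comment> \<open>\<open>G k\<close> is the remainder after k divisions by \<open>p\<close>, and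
    \<open>t k\<close> is what is split off from it in the next step.\<close>
  define G where "G k = (H ^^ k) g" for k
  define t where "t k = (\<Sum>j<r. mfps_const (C (G k) j) * e j) + (\<Sum>i\<in>UNIV. B (G k) i * a i)" for k
  have G: "G k = t k + p * G (Suc k)" for k
    using spec[OF step, of "G k"] by (simp add: G_def t_def mult.commute)
  have "g = psum p t"
  proof (rule psum_eqI[OF p])
    fix N
    have "g - (\<Sum>k<N. p ^ k * t k) = p ^ N * G N"
    proof (induction N)
      case (Suc N)
      then show ?case using G[of N] by (simp add: algebra_simps)
    qed (simp add: G_def)
    then show "g - (\<Sum>k<N. p ^ k * t k) \<in> mpow N"
      using ideal_mult_right[OF is_ideal_mpow mpow_power[OF p]] by simp
  qed
  also have "\<dots> = (\<Sum>j<r. psum p (\<lambda>k. mfps_const (C (G k) j)) * e j) + (\<Sum>i\<in>UNIV. psum p (\<lambda>k. B (G k) i) * a i)"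
    unfolding t_def using p by (simp add: psum_add psum_mult psum_sum)
  finally have "g - (\<Sum>j<r. ev p (Abs_fps (\<lambda>k. C (G k) j)) * e j) = (\<Sum>i\<in>UNIV. a i * psum p (\<lambda>k. B (G k) i))"
    by (simp add: ev_def mult.commute)
  then show ?thesis
    by (intro exI[of _ "\<lambda>j. Abs_fps (\<lambda>k. C (G k) j)"]) (simp only: gen_memI)
qed

lemma fps_eq_X_power_mult_shift:
  fixes c :: "'a::comm_ring_1 fps"
  assumes "\<And>i. i < k \<Longrightarrow> fps_nth c i = 0"
  shows "c = fps_X ^ k * fps_shift k c"
  using fps_split_shift[of c k] assms by simp

text \<open>Over the discrete valuation ring K[[s]] a finitely generated torsion-free module is
  free. In a nontrivial relation between generators of minimal number, the common power of s cancels
  by torsion-freeness; then some coefficient is a unit, and its generator could be dropped.\<close>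

lemma basis_of_torsion_free_quotient:
  fixes p :: "('a::field, 'm::finite) mfps" and e :: "nat \<Rightarrow> ('a, 'm) mfps"
  assumes p: "p \<in> mpow 1" and A: "is_ideal A"
    and tf: "\<And>g. p * g \<in> A \<Longrightarrow> g \<in> A"
    and gens: "\<And>g. \<exists>c. g - (\<Sum>j<r. ev p (c j) * e j) \<in> A"
  shows "\<exists>S. finite S \<and> (\<forall>g. \<exists>c. g - (\<Sum>j\<in>S. ev p (c j) * e j) \<in> A) \<and>
    (\<forall>c. (\<Sum>j\<in>S. ev p (c j) * e j) \<in> A \<longrightarrow> (\<forall>j\<in>S. c j = 0))"
proof -
  define Q where "Q S \<longleftrightarrow> finite S \<and> (\<forall>g. \<exists>c. g - (\<Sum>j\<in>S. ev p (c j) * e j) \<in> A)" for S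
  have "Q {..<r}" using gens by (auto simp: Q_def)
  then obtain S where S: "Q S" and minimal: "\<And>S'. Q S' \<Longrightarrow> card S \<le> card S'"
    using ex_has_least_nat[of Q _ card] by auto
  have fin: "finite S" using S by (simp add: Q_def)
  have "c j = 0" if rel: "(\<Sum>j\<in>S. ev p (c j) * e j) \<in> A" and j: "j \<in> S" for c j
  proof (rule ccontr)
    assume "c j \<noteq> 0"
    then have ex: "\<exists>k. \<exists>j\<in>S. fps_nth (c j) k \<noteq> 0" using j by (auto simp: fps_eq_iff)
    define k where "k = (LEAST k. \<exists>j\<in>S. fps_nth (c j) k \<noteq> 0)"
    from LeastI_ex[OF ex] obtain i where i: "i \<in> S" "fps_nth (c i) k \<noteq> 0" unfolding k_def by blast
    define c' where "c' j = fps_shift k (c j)" for j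
    have c': "c j = fps_X ^ k * c' j" if "j \<in> S" for j
      unfolding c'_def
    proof (rule fps_eq_X_power_mult_shift)
      show "fps_nth (c j) l = 0" if "l < k" for l
        using not_less_Least[of l "\<lambda>k. \<exists>j\<in>S. fps_nth (c j) k \<noteq> 0"] that \<open>j \<in> S\<close> by (auto simp: k_def)
    qed
    have "(\<Sum>j\<in>S. ev p (c j) * e j) = (\<Sum>j\<in>S. p ^ k * (ev p (c' j) * e j))"
      by (rule sum.cong) (auto simp: c' ev_X_power_mult[OF p] mult.assoc)
    then have *: "p ^ k * (\<Sum>j\<in>S. ev p (c' j) * e j) \<in> A" using rel by (simp add: sum_distrib_left)
    have tf': "p ^ n * g \<in> A \<Longrightarrow> g \<in> A" for n g
      by (induction n) (auto simp: mult.assoc dest: tf)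
    have rel': "(\<Sum>j\<in>S. ev p (c' j) * e j) \<in> A" using tf'[OF *] .
    define d where "d = inverse (c' i)"
    have d: "d * c' i = 1" using i by (auto simp: d_def c'_def intro!: inverse_mult_eq_1)
    have "(\<Sum>j\<in>S. ev p (d * c' j) * e j) = ev p d * (\<Sum>j\<in>S. ev p (c' j) * e j)"
      by (simp add: sum_distrib_left ev_mult[OF p] mult.assoc)
    then have "(\<Sum>j\<in>S. ev p (d * c' j) * e j) \<in> A" using ideal_mult[OF A rel'] by simp
    then have ei: "e i + (\<Sum>j\<in>S-{i}. ev p (d * c' j) * e j) \<in> A"
      using d by (simp add: sum.remove[OF fin i(1)] ev_1[OF p])
    have "Q (S - {i})"
      unfolding Q_def
    proof safe
      fix g
      obtain b where b: "g - (\<Sum>j\<in>S. ev p (b j) * e j) \<in> A" using S by (auto simp: Q_def)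
      have "g - (\<Sum>j\<in>S-{i}. ev p (b j - b i * (d * c' j)) * e j) =
         (g - (\<Sum>j\<in>S. ev p (b j) * e j)) + ev p (b i) * (e i + (\<Sum>j\<in>S-{i}. ev p (d * c' j) * e j))"
        by (simp add: sum.remove[OF fin i(1)] ev_diff[OF p] ev_mult[OF p] sum_distrib_left
            sum_subtractf algebra_simps)
      also have "\<dots> \<in> A" by (intro ideal_add ideal_mult A b ei)
      finally show "\<exists>c. g - (\<Sum>j\<in>S-{i}. ev p (c j) * e j) \<in> A"
        by (rule exI[of _ "\<lambda>j. b j - b i * (d * c' j)"])
    qed (use fin in auto)
    from minimal[OF this] show False using card_Diff1_less[OF fin i(1)] by simp
  qed
  then show ?thesis using S by (auto simp: Q_def)
qed

subsection \<open>Traces\<close>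

text \<open>
  With $s$ acting as \<open>p\<close>, the quotient by \<open>A\<close> is a free $K[[s]]$-module with basis
  \<open>e\<close> indexed by \<open>S\<close>. Multiplication by \<open>g\<close> has the matrix \<open>M g\<close>, and \<open>T c g\<close> is the
  trace of \<open>M c\<close> times the derivative of \<open>M g\<close> with respect to $s$. The matrices commute,
  but not with their derivatives; under the trace this does not matter, so that \<open>E c\<close>, the
  defect of the chain rule, satisfies a Leibniz rule.
\<close>

locale free_quotient =
  fixes p :: "('a::field_char_0, 'm::finite) mfps" and A S and e :: "nat \<Rightarrow> ('a, 'm) mfps"
  assumes p: "p \<in> mpow 1" and A: "is_ideal A" and fin: "finite S"
    and gens: "\<And>g. \<exists>c. g - (\<Sum>j\<in>S. ev p (c j) * e j) \<in> A"
    and indep: "\<And>c j. (\<Sum>j\<in>S. ev p (c j) * e j) \<in> A \<Longrightarrow> j \<in> S \<Longrightarrow> c j = 0"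
begin

definition M where "M g = (SOME m. \<forall>i. g * e i - (\<Sum>j\<in>S. ev p (m i j) * e j) \<in> A)"

lemma M: "g * e i - (\<Sum>j\<in>S. ev p (M g i j) * e j) \<in> A"
proof -
  have "\<exists>m. \<forall>i. g * e i - (\<Sum>j\<in>S. ev p (m i j) * e j) \<in> A" by (intro choice allI gens)
  from someI_ex[OF this] show ?thesis unfolding M_def by blast
qed

lemma M_unique:
  assumes "g * e i - (\<Sum>j\<in>S. ev p (c j) * e j) \<in> A" "j \<in> S"
  shows "M g i j = c j"
proof -
  have "(\<Sum>j\<in>S. ev p (M g i j - c j) * e j) =
     (g * e i - (\<Sum>j\<in>S. ev p (c j) * e j)) - (g * e i - (\<Sum>j\<in>S. ev p (M g i j) * e j))"
    by (simp add: ev_diff[OF p] left_diff_distrib sum_subtractf)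
  also have "\<dots> \<in> A" by (intro ideal_diff A assms M)
  finally show ?thesis using indep[of "\<lambda>j. M g i j - c j" j] assms by auto
qed

lemma M_add: "j \<in> S \<Longrightarrow> M (g + h) i j = M g i j + M h i j"
proof (rule M_unique)
  have "(g + h) * e i - (\<Sum>j\<in>S. ev p (M g i j + M h i j) * e j) =
    (g * e i - (\<Sum>j\<in>S. ev p (M g i j) * e j)) + (h * e i - (\<Sum>j\<in>S. ev p (M h i j) * e j))"
    by (simp add: ev_add[OF p] distrib_right sum.distrib)
  also have "\<dots> \<in> A" by (intro ideal_add A M)
  finally show "(g + h) * e i - (\<Sum>j\<in>S. ev p (M g i j + M h i j) * e j) \<in> A" .
qed

lemma M_cong:
  assumes "g - h \<in> A" "j \<in> S" shows "M g i j = M h i j"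
proof (rule M_unique[OF _ assms(2)])
  have "g * e i - (\<Sum>j\<in>S. ev p (M h i j) * e j) = (g - h) * e i + (h * e i - (\<Sum>j\<in>S. ev p (M h i j) * e j))"
    by (simp add: algebra_simps)
  also have "\<dots> \<in> A" by (intro ideal_add ideal_mult_right A M assms)
  finally show "g * e i - (\<Sum>j\<in>S. ev p (M h i j) * e j) \<in> A" .
qed

lemma M_ev_mult: "j \<in> S \<Longrightarrow> M (ev p d * g) i j = d * M g i j"
proof (rule M_unique)
  have "ev p d * g * e i - (\<Sum>j\<in>S. ev p (d * M g i j) * e j) = ev p d * (g * e i - (\<Sum>j\<in>S. ev p (M g i j) * e j))"
    by (simp add: ev_mult[OF p] right_diff_distrib sum_distrib_left mult.assoc)
  also have "\<dots> \<in> A" by (intro ideal_mult A M)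
  finally show "ev p d * g * e i - (\<Sum>j\<in>S. ev p (d * M g i j) * e j) \<in> A" .
qed

lemma M_ev: "i \<in> S \<Longrightarrow> j \<in> S \<Longrightarrow> M (ev p d) i j = (if i = j then d else 0)"
proof (rule M_unique)
  assume "i \<in> S"
  have "(\<Sum>j\<in>S. ev p (if i = j then d else 0) * e j) = (\<Sum>j\<in>S. if i = j then ev p d * e j else 0)"
    by (rule sum.cong) auto
  also have "\<dots> = ev p d * e i" using fin \<open>i \<in> S\<close> by simp
  finally show "ev p d * e i - (\<Sum>j\<in>S. ev p (if i = j then d else 0) * e j) \<in> A"
    by (simp add: ideal_zero A)
qed

lemma M_mult: "k \<in> S \<Longrightarrow> M (g * h) i k = (\<Sum>j\<in>S. M g i j * M h j k)"
proof (rule M_unique)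
  have "(\<Sum>k\<in>S. ev p (\<Sum>j\<in>S. M g i j * M h j k) * e k) = (\<Sum>k\<in>S. \<Sum>j\<in>S. ev p (M g i j) * (ev p (M h j k) * e k))"
    by (simp add: ev_sum[OF p] ev_mult[OF p] sum_distrib_right mult.assoc)
  also have "\<dots> = (\<Sum>j\<in>S. \<Sum>k\<in>S. ev p (M g i j) * (ev p (M h j k) * e k))" by (rule sum.swap)
  also have "\<dots> = (\<Sum>j\<in>S. ev p (M g i j) * (\<Sum>k\<in>S. ev p (M h j k) * e k))" by (simp add: sum_distrib_left)
  finally have eq: "(\<Sum>k\<in>S. ev p (\<Sum>j\<in>S. M g i j * M h j k) * e k) =
    (\<Sum>j\<in>S. ev p (M g i j) * (\<Sum>k\<in>S. ev p (M h j k) * e k))" .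
  have "g * h * e i - (\<Sum>j\<in>S. a j * w j) =
     h * (g * e i - (\<Sum>j\<in>S. a j * e j)) + (\<Sum>j\<in>S. a j * (h * e j - w j))" for a w
    by (simp add: right_diff_distrib sum_subtractf sum_distrib_left mult_ac)
  then have "g * h * e i - (\<Sum>k\<in>S. ev p (\<Sum>j\<in>S. M g i j * M h j k) * e k) =
     h * (g * e i - (\<Sum>j\<in>S. ev p (M g i j) * e j)) +
     (\<Sum>j\<in>S. ev p (M g i j) * (h * e j - (\<Sum>k\<in>S. ev p (M h j k) * e k)))"
    unfolding eq .
  also have "\<dots> \<in> A" by (intro ideal_add ideal_mult ideal_sum A M)
  finally show "g * h * e i - (\<Sum>k\<in>S. ev p (\<Sum>j\<in>S. M g i j * M h j k) * e k) \<in> A" .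
qed

definition T where "T c g = (\<Sum>i\<in>S. \<Sum>j\<in>S. M c i j * fps_deriv (M g j i))"

lemma T_add_left: "T (c + d) g = T c g + T d g"
  by (simp add: T_def M_add distrib_right sum.distrib)

lemma T_add_right: "T c (g + h) = T c g + T c h"
  by (simp add: T_def M_add distrib_left sum.distrib)

lemma T_cong_left: "c - d \<in> A \<Longrightarrow> T c g = T d g"
  by (simp add: T_def M_cong[of c d])

lemma T_ev_mult_left: "T (ev p d * c) g = d * T c g"
  by (simp add: T_def M_ev_mult sum_distrib_left mult.assoc)

lemma T_0_left [simp]: "T 0 g = 0"
  using T_add_left[of 0 0 g] by simp

lemma T_uminus_left: "T (- c) g = - T c g"
  using T_add_left[of c "- c" g] by (simp add: eq_neg_iff_add_eq_0 add.commute)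

lemma T_const_right: "T c (mfps_const x) = 0"
proof -
  have "M (mfps_const x) i j = fps_const (if i = j then x else 0)" if "i \<in> S" "j \<in> S" for i j
    using M_ev[OF that, of "fps_const x"] by (simp add: ev_const[OF p])
  then show ?thesis by (simp add: T_def)
qed

text \<open>The product rule for M g M h gives two traces, and cyclicity turns Tr(C G' H) into Tr(H
  C G').\<close>

lemma T_mult_right: "T c (g * h) = T (c * h) g + T (c * g) h"
proof -
  have "T c (g * h) = (\<Sum>i\<in>S. \<Sum>j\<in>S. \<Sum>k\<in>S. M c i j * (fps_deriv (M g j k) * M h k i)) +
     (\<Sum>i\<in>S. \<Sum>j\<in>S. \<Sum>k\<in>S. M c i j * (M g j k * fps_deriv (M h k i)))"
    by (simp add: T_def M_mult fps_deriv_sum sum_distrib_left sum.distrib distrib_left add.commute)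
  also have "(\<Sum>i\<in>S. \<Sum>j\<in>S. \<Sum>k\<in>S. M c i j * (M g j k * fps_deriv (M h k i))) =
     (\<Sum>i\<in>S. \<Sum>k\<in>S. \<Sum>j\<in>S. M c i j * (M g j k * fps_deriv (M h k i)))"
    by (rule sum.cong[OF refl], rule sum.swap)
  also have "\<dots> = T (c * g) h"
    by (simp add: T_def M_mult sum_distrib_right mult.assoc)
  also have "(\<Sum>i\<in>S. \<Sum>j\<in>S. \<Sum>k\<in>S. M c i j * (fps_deriv (M g j k) * M h k i)) =
     (\<Sum>i\<in>S. \<Sum>k\<in>S. \<Sum>j\<in>S. M c i j * (fps_deriv (M g j k) * M h k i))"
    by (rule sum.cong[OF refl], rule sum.swap)
  also have "\<dots> = (\<Sum>k\<in>S. \<Sum>i\<in>S. \<Sum>j\<in>S. M h k i * M c i j * fps_deriv (M g j k))"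
    by (subst sum.swap) (simp add: mult_ac)
  also have "\<dots> = (\<Sum>k\<in>S. \<Sum>j\<in>S. \<Sum>i\<in>S. M h k i * M c i j * fps_deriv (M g j k))"
    by (rule sum.cong[OF refl], rule sum.swap)
  also have "\<dots> = T (h * c) g"
    by (simp add: T_def M_mult sum_distrib_right)
  finally show ?thesis by (simp add: mult.commute)
qed

definition E where "E c g = T c g - (\<Sum>i\<in>UNIV. T (c * mfps_deriv i g) (Var i))"

lemma E_add_right: "E c (g + h) = E c g + E c h"
  by (simp add: E_def T_add_right deriv_add distrib_left T_add_left sum.distrib)

lemma E_const_right: "E c (mfps_const x) = 0"
  by (simp add: E_def T_const_right)

lemma E_sum_right: "E c (sum g B) = (\<Sum>x\<in>B. E c (g x))"
  using E_const_right[of c 0] by (induction B rule: infinite_finite_induct) (auto simp: E_add_right)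

lemma E_Var_right: "E c (Var j) = 0"
proof -
  have "(\<Sum>i\<in>UNIV. T (c * mfps_deriv i (Var j)) (Var i)) = (\<Sum>i\<in>UNIV. if i = j then T c (Var i) else 0)"
    by (rule sum.cong) (auto simp: deriv_Var)
  then show ?thesis by (simp add: E_def)
qed

lemma E_mult_right: "E c (g * h) = E (c * h) g + E (c * g) h"
  by (simp add: E_def T_mult_right deriv_mult distrib_left T_add_left sum.distrib mult_ac)

text \<open>
  Iterating this pushes arbitrarily many variables into the factor \<open>c\<close>, and a product of many
  variables is divisible by a high power of $s$.
\<close>

lemma E_expand: "\<exists>h. E c g = (\<Sum>i\<in>UNIV. E (c * Var i) (h i))"
proof -
  obtain h where "g = mfps_const (mfps_nth g 0) + (\<Sum>i\<in>UNIV. Var i * h i)"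
    using const_plus_Var_decomposition by blast
  then have "E c g = E c (mfps_const (mfps_nth g 0) + (\<Sum>i\<in>UNIV. Var i * h i))" by simp
  also have "\<dots> = (\<Sum>i\<in>UNIV. E (c * Var i) (h i))"
    by (simp add: E_add_right E_const_right E_sum_right E_mult_right E_Var_right)
  finally show ?thesis by blast
qed

text \<open>The trace form is K[[s]]-linear in its first argument, where multiplication by p^k
  becomes multiplication by s^k.\<close>

lemma E_divisible:
  assumes "c - p ^ k * q \<in> A" shows "fps_X ^ k dvd E c g"
proof -
  have "T (c * d) h = fps_X ^ k * T (q * d) h" for d h
  proof -
    have "c * d - ev p (fps_X ^ k) * (q * d) = (c - p ^ k * q) * d"
      by (simp add: ev_X_power[OF p] algebra_simps)
    then have "c * d - ev p (fps_X ^ k) * (q * d) \<in> A" using ideal_mult_right[OF A assms] by simp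
    from T_cong_left[OF this] show ?thesis by (simp only: T_ev_mult_left)
  qed
  from this this[of 1] have "E c g = fps_X ^ k * E q g"
    by (simp add: E_def right_diff_distrib sum_distrib_left)
  then show ?thesis by simp
qed

text \<open>The quotient by \<open>A\<close> and \<open>p\<close> is spanned by the basis over K, so
  some x_i^N is divisible by \<open>p\<close> modulo \<open>A\<close>. An element of large order is
  a combination of such powers, and each passage extracts one factor \<open>p\<close>.\<close>

lemma mpow_divisible: "\<exists>m. \<forall>c\<in>mpow m. \<exists>q. c - p ^ k * q \<in> A"
proof -
  define B where "B = {g. \<exists>h. g - p * h \<in> A}"
  have B: "is_ideal B" unfolding B_def by (rule is_ideal_plus_principal[OF A])
  have "codim_le B (card S)"
  proof -
    obtain b where b: "bij_betw b {..<card S} S"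
      using ex_bij_betw_nat_finite[OF fin] by (auto simp: atLeast0LessThan)
    have "\<exists>c. g - (\<Sum>j<card S. mfps_const (c j) * e (b j)) \<in> B" for g
    proof -
      obtain c where c: "g - (\<Sum>j\<in>S. ev p (c j) * e j) \<in> A" using gens by blast
      have split: "ev p d = mfps_const (fps_nth d 0) + p * ev p (fps_shift 1 d)" for d
      proof -
        have "ev p d = ev p (fps_const (fps_nth d 0) + fps_X * fps_shift 1 d)"
          using fps_split_shift[of d 1] by simp
        then show ?thesis by (simp only: ev_add[OF p] ev_const[OF p] ev_X_mult[OF p])
      qed
      have "(\<Sum>j\<in>S. ev p (c j) * e j) = (\<Sum>j\<in>S. mfps_const (fps_nth (c j) 0) * e j) +
         p * (\<Sum>j\<in>S. ev p (fps_shift 1 (c j)) * e j)"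
        by (subst split) (simp add: distrib_right sum.distrib sum_distrib_left mult.assoc)
      moreover have "(\<Sum>j\<in>S. mfps_const (fps_nth (c j) 0) * e j) =
         (\<Sum>j<card S. mfps_const (fps_nth (c (b j)) 0) * e (b j))"
        by (rule sum.reindex_bij_betw[OF b, symmetric])
      ultimately have "g - (\<Sum>j<card S. mfps_const (fps_nth (c (b j)) 0) * e (b j)) -
         p * (\<Sum>j\<in>S. ev p (fps_shift 1 (c j)) * e j) \<in> A"
        using c by (simp add: algebra_simps)
      then show ?thesis
        unfolding B_def by (intro exI[of _ "\<lambda>j. fps_nth (c (b j)) 0"] CollectI exI)
    qed
    then show ?thesis unfolding codim_le_def by (intro exI[of _ "\<lambda>j. e (b j)"] allI)
  qed
  then have "\<exists>k. Var i ^ k \<in> B" for i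
    using nilpotent_mod_finite_codim[OF B _ Var_in_mpow] by blast
  then obtain N where "\<And>i. Var i ^ N \<in> B"
    using finite_codim_if_Var_powers(1)[OF B] by blast
  then have "\<forall>i. \<exists>t. Var i ^ N - p * t \<in> A" by (simp add: B_def)
  from choice[OF this] obtain t where t: "\<And>i. Var i ^ N - p * t i \<in> A" by blast
  define n where "n = card (UNIV :: 'm set)"
  \<comment> \<open>Order n * N + 1 exceeds every degree in the box of side \<open>N\<close>, so a
    decomposition is still possible; each of the k extractions costs at most \<open>N\<close> in
    order.\<close>
  have "\<forall>c\<in>mpow (n * N + 1 + k * N). \<exists>q. c - p ^ k * q \<in> A"
  proof (induction k)
    case 0
    have "\<exists>q. c - p ^ 0 * q \<in> A" for c by (rule exI[of _ c]) (simp add: ideal_zero A)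
    then show ?case by blast
  next
    case (Suc k)
    show ?case
    proof
      fix c :: "('a, 'm) mfps" assume "c \<in> mpow (n * N + 1 + Suc k * N)"
      then obtain h where h: "c = (\<Sum>i\<in>UNIV. Var i ^ N * h i)" "\<And>i. h i \<in> mpow (n * N + 1 + k * N)"
        using mpow_decomposition[of c "n * N + 1 + Suc k * N" N] by (auto simp: n_def)
      from h(2) Suc.IH have "\<forall>i. \<exists>q. h i - p ^ k * q \<in> A" by blast
      from choice[OF this] obtain q where q: "\<And>i. h i - p ^ k * q i \<in> A" by blast
      have "c - p ^ Suc k * (\<Sum>i\<in>UNIV. t i * q i) = (\<Sum>i\<in>UNIV. Var i ^ N * h i - (p * t i) * (p ^ k * q i))"
        unfolding h by (simp add: sum_subtractf sum_distrib_left mult_ac)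
      also have "\<dots> \<in> A" by (intro ideal_sum ideal_cong_mult A t q)
      finally show "\<exists>q. c - p ^ Suc k * q \<in> A" by blast
    qed
  qed
  then show ?thesis by blast
qed

lemma trace_derivative: "T c g = (\<Sum>i\<in>UNIV. T (c * mfps_deriv i g) (Var i))"
proof -
  have "fps_X ^ k dvd E c g" for k
  proof -
    obtain m where m: "\<And>c g. c \<in> mpow m \<Longrightarrow> fps_X ^ k dvd E c g"
      using mpow_divisible[of k] E_divisible by blast
    \<comment> \<open>The order required of \<open>c\<close> decreases with \<open>j\<close>: each
      expansion multiplies \<open>c\<close> by one more variable, and at j = m nothing is
      required.\<close>
    have "c \<in> mpow (m - j) \<Longrightarrow> fps_X ^ k dvd E c g" if "j \<le> m" for j c g
      using that
    proof (induction j arbitrary: c g)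
      case (Suc j)
      obtain h where h: "E c g = (\<Sum>i\<in>UNIV. E (c * Var i) (h i))" using E_expand by blast
      have "c * Var i \<in> mpow (m - j)" for i
        using mpow_mult[OF Suc.prems(1) Var_in_mpow[of i]] Suc.prems(2) by (simp add: Suc_diff_Suc)
      then show ?case unfolding h using Suc by (intro dvd_sum) auto
    qed (use m in auto)
    from this[of m c g] show ?thesis by simp
  qed
  then have "fps_nth (E c g) n = 0" for n
  proof -
    from \<open>\<And>k. fps_X ^ k dvd E c g\<close>[of "Suc n"] obtain q where "E c g = fps_X ^ Suc n * q" by blast
    then show ?thesis by (simp add: fps_X_power_mult_nth del: power_Suc)
  qed
  then have "E c g = 0" by (simp add: fps_eq_iff)
  then show ?thesis by (simp add: E_def)
qed

text \<open>
  Since \<open>p\<close> acts as $s$, the trace of its derivative is the rank. The hypothesis makes this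
  trace a multiple of $s$, so that the rank vanishes.
\<close>

lemma trivial_if_logarithmic:
  assumes "\<And>i. \<exists>W. mfps_deriv i p + W * p \<in> A"
  shows "1 \<in> A"
proof -
  have "\<exists>W. \<forall>i. mfps_deriv i p + W i * p \<in> A" by (intro choice allI assms)
  then obtain W where W: "\<And>i. mfps_deriv i p + W i * p \<in> A" by blast
  have "T (1 * mfps_deriv i p) (Var i) = - (fps_X * T (W i) (Var i))" for i
  proof -
    have "mfps_deriv i p - ev p fps_X * (- W i) \<in> A" using W[of i] by (simp add: ev_X[OF p] mult.commute)
    from T_cong_left[OF this] show ?thesis
      unfolding T_ev_mult_left by (simp add: T_uminus_left)
  qed
  then have "T 1 p = - fps_X * (\<Sum>i\<in>UNIV. T (W i) (Var i))"
    using trace_derivative[of 1 p] by (simp add: sum_distrib_left sum_negf)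
  then have "fps_nth (T 1 p) 0 = 0" by simp
  moreover have "T 1 p = of_nat (card S)"
  proof -
    have "T 1 p = (\<Sum>i\<in>S. \<Sum>j\<in>S. if i = j then 1 else 0)"
      unfolding T_def
    proof (intro sum.cong refl)
      fix i j assume ij: "i \<in> S" "j \<in> S"
      have "M 1 i j = (if i = j then 1 else 0)" using M_ev[OF ij, of 1] by (simp add: ev_1[OF p])
      moreover have "M p j i = (if j = i then fps_X else 0)" using M_ev[OF ij(2,1), of fps_X] by (simp add: ev_X[OF p])
      ultimately show "M 1 i j * fps_deriv (M p j i) = (if i = j then 1 else 0)" by auto
    qed
    then show ?thesis using fin by simp
  qed
  ultimately have "card S = 0" by (simp add: fps_of_nat[symmetric])
  then have "S = {}" using fin by simp
  then show ?thesis using gens[of 1] by simp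
qed

end

text \<open>On the quotient by the saturation \<open>A\<close> multiplication by \<open>f\<close> is
  injective, so this quotient is free over K[[f]]. Membership of 1 in \<open>A\<close> is the
  assertion, and a logarithmic relation is only needed up to a power of \<open>f\<close>.\<close>

lemma nilpotent_if_logarithmic:
  fixes f :: "('a::field_char_0, 'm::finite) mfps" and a :: "'i::finite \<Rightarrow> ('a, 'm) mfps"
  assumes f: "f \<in> mpow 1"
    and log: "\<And>i. \<exists>W k. f ^ k * (mfps_deriv i f + W * f) \<in> generated_ideal a"
    and codim: "codim_le {g. \<exists>h. g - f * h \<in> generated_ideal a} r"
  shows "\<exists>k. f ^ k \<in> generated_ideal a"
proof -
  define A where "A = {g. \<exists>k. f ^ k * g \<in> generated_ideal a}"
  have I: "is_ideal (generated_ideal a)" by (rule is_ideal_gen)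
  have A: "is_ideal A" unfolding A_def by (rule is_ideal_colon_powers[OF I])
  have gA: "generated_ideal a \<subseteq> A" by (auto simp: A_def intro!: exI[of _ 0])
  from codim obtain e where "\<And>g. \<exists>c h. g - (\<Sum>j<r. mfps_const (c j) * e j) - f * h \<in> generated_ideal a"
    unfolding codim_le_def by auto
  from generated_by_successive_approximation[OF f this]
  have "\<exists>c. g - (\<Sum>j<r. ev f (c j) * e j) \<in> A" for g using gA by blast
  moreover have tf: "g \<in> A" if fg: "f * g \<in> A" for g
  proof -
    from fg obtain k where "f ^ k * (f * g) \<in> generated_ideal a" by (auto simp: A_def)
    then have "f ^ Suc k * g \<in> generated_ideal a" by (simp add: mult_ac)
    then show ?thesis by (auto simp: A_def simp del: power_Suc)
  qed
  ultimately obtain S where S: "finite S" "\<And>g. \<exists>c. g - (\<Sum>j\<in>S. ev f (c j) * e j) \<in> A"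
    "\<And>c j. (\<Sum>j\<in>S. ev f (c j) * e j) \<in> A \<Longrightarrow> j \<in> S \<Longrightarrow> c j = 0"
    using basis_of_torsion_free_quotient[OF f A, where r = r and e = e] by blast
  interpret free_quotient f A S e by unfold_locales (use f A S in auto)
  have "1 \<in> A" by (rule trivial_if_logarithmic) (use log in \<open>auto simp: A_def\<close>)
  then show ?thesis by (auto simp: A_def)
qed

subsection \<open>Koszul complexes\<close>

definition koszul_sign :: "nat \<Rightarrow> nat set \<Rightarrow> 'r::comm_ring_1" where
  "koszul_sign j A = (-1) ^ card {a\<in>A. a < j}"

text \<open>The Koszul boundary in coordinates: \<open>c A\<close> is the coefficient of the
  exterior monomial indexed by \<open>A\<close>. The value of the boundary at \<open>A\<close>
  collects the coefficients one degree higher, and the sign accounts for moving \<open>j\<close>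
  past the smaller elements of \<open>A\<close>.\<close>

definition koszul_d :: "nat set \<Rightarrow> (nat \<Rightarrow> 'r) \<Rightarrow> (nat set \<Rightarrow> 'r) \<Rightarrow> nat set \<Rightarrow> 'r::comm_ring_1" where
  "koszul_d S h c A = (\<Sum>j\<in>S-A. koszul_sign j A * h j * c (insert j A))"

text \<open>
  The homology vanishes in degrees above \<open>p\<close>. Chains are functions on all sets, not assumed
  homogeneous, and only their values on subsets of \<open>S\<close> matter.
\<close>

definition exact_above :: "nat set \<Rightarrow> (nat \<Rightarrow> 'r::comm_ring_1) \<Rightarrow> nat \<Rightarrow> bool" where
  "exact_above S h p \<longleftrightarrow> (\<forall>c. (\<forall>A\<subseteq>S. card A \<le> p \<longrightarrow> c A = 0) \<and> (\<forall>A\<subseteq>S. koszul_d S h c A = 0) \<longrightarrow>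
     (\<exists>b. (\<forall>A\<subseteq>S. card A \<le> Suc p \<longrightarrow> b A = 0) \<and> (\<forall>A\<subseteq>S. c A = koszul_d S h b A)))"

lemma exact_aboveE:
  assumes "exact_above S h p" "\<And>A. A \<subseteq> S \<Longrightarrow> card A \<le> p \<Longrightarrow> c A = 0" "\<And>A. A \<subseteq> S \<Longrightarrow> koszul_d S h c A = 0"
  obtains b where "\<And>A. A \<subseteq> S \<Longrightarrow> card A \<le> Suc p \<Longrightarrow> b A = 0" "\<And>A. A \<subseteq> S \<Longrightarrow> c A = koszul_d S h b A"
proof -
  have "(\<forall>A\<subseteq>S. card A \<le> p \<longrightarrow> c A = 0) \<and> (\<forall>A\<subseteq>S. koszul_d S h c A = 0)"
    using assms(2,3) by blast
  with assms(1) have "\<exists>b. (\<forall>A\<subseteq>S. card A \<le> Suc p \<longrightarrow> b A = 0) \<and> (\<forall>A\<subseteq>S. c A = koszul_d S h b A)"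
    unfolding exact_above_def by (elim allE[of _ c]) (rule mp)
  then show ?thesis using that by blast
qed

lemma koszul_sign_square [simp]: "koszul_sign j A * koszul_sign j A = 1"
  by (simp add: koszul_sign_def flip: power_mult_distrib)

lemma koszul_sign_square_mult [simp]: "koszul_sign j A * (koszul_sign j A * x) = x"
  by (simp flip: mult.assoc)

lemma koszul_sign_empty [simp]: "koszul_sign j {} = 1"
  by (simp add: koszul_sign_def)

lemma koszul_sign_insert:
  assumes "finite A" "s \<notin> A"
  shows "koszul_sign j (insert s A) = (if s < j then - koszul_sign j A else koszul_sign j A)"
proof (cases "s < j")
  case True
  then have "{a \<in> insert s A. a < j} = insert s {a\<in>A. a < j}" by auto
  then show ?thesis using True assms by (simp add: koszul_sign_def)
next
  case False
  then have "{a \<in> insert s A. a < j} = {a\<in>A. a < j}" by auto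
  then show ?thesis using False by (simp add: koszul_sign_def)
qed

lemma koszul_sign_swap:
  assumes "finite A" "s \<notin> A" "j \<notin> A" "s \<noteq> j"
  shows "koszul_sign s A * koszul_sign j (insert s A) = - (koszul_sign j A * koszul_sign s (insert j A))"
  using assms by (auto simp: koszul_sign_insert)

lemma koszul_d_cong: "(\<And>A. A \<subseteq> S \<Longrightarrow> c A = d A) \<Longrightarrow> A \<subseteq> S \<Longrightarrow> koszul_d S h c A = koszul_d S h d A"
  unfolding koszul_d_def by (intro sum.cong) auto

lemma koszul_d_add: "koszul_d S h (\<lambda>A. c A + d A) A = koszul_d S h c A + koszul_d S h d A"
  by (simp add: koszul_d_def algebra_simps sum.distrib)

lemma koszul_d_mult: "koszul_d S h (\<lambda>A. x * c A) A = x * koszul_d S h c A"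
  by (simp add: koszul_d_def sum_distrib_left mult_ac)

lemma koszul_d_uminus: "koszul_d S h (\<lambda>A. - c A) A = - koszul_d S h c A"
  by (simp add: koszul_d_def sum_negf)

lemma koszul_d_sum: "koszul_d S h (\<lambda>A. \<Sum>i\<in>I. c i A) A = (\<Sum>i\<in>I. koszul_d S h (c i) A)"
  unfolding koszul_d_def by (subst sum.swap) (simp add: sum_distrib_left)

text \<open>
  With respect to a new index \<open>s\<close> a chain \<open>c\<close> splits into its restriction to subsets of
  \<open>S\<close> and the chain \<open>part s c\<close>; this exhibits the complex of \<open>insert s S\<close> as a mapping cone.
\<close>

definition part :: "nat \<Rightarrow> (nat set \<Rightarrow> 'r) \<Rightarrow> nat set \<Rightarrow> 'r::comm_ring_1" where
  "part s c A = koszul_sign s A * c (insert s A)"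

definition glue :: "nat \<Rightarrow> (nat set \<Rightarrow> 'r) \<Rightarrow> (nat set \<Rightarrow> 'r) \<Rightarrow> nat set \<Rightarrow> 'r::comm_ring_1" where
  "glue s b0 b1 A = (if s \<in> A then koszul_sign s (A - {s}) * b1 (A - {s}) else b0 A)"

lemma glue_simps: "s \<notin> A \<Longrightarrow> glue s b0 b1 A = b0 A" "s \<notin> A \<Longrightarrow> part s (glue s b0 b1) A = b1 A"
  by (simp_all add: glue_def part_def)

lemma part_0_iff: "part s c A = 0 \<longleftrightarrow> c (insert s A) = 0"
  unfolding part_def by (metis koszul_sign_square_mult mult_zero_right)

lemma part_eq_iff: "part s c A = part s d A \<longleftrightarrow> c (insert s A) = d (insert s A)"
  unfolding part_def by (metis koszul_sign_square_mult)

lemma koszul_d_insert: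
  assumes "finite S" "s \<notin> S" "A \<subseteq> S"
  shows "koszul_d (insert s S) h c A = koszul_d S h c A + h s * part s c A"
proof -
  have "insert s S - A = insert s (S - A)" using assms by auto
  then show ?thesis using assms by (simp add: koszul_d_def part_def mult_ac add.commute)
qed

lemma part_koszul_d:
  assumes "finite S" "s \<notin> S" "A \<subseteq> S"
  shows "part s (koszul_d (insert s S) h c) A = - koszul_d S h (part s c) A"
proof -
  have "insert s S - insert s A = S - A" using assms by auto
  then have "part s (koszul_d (insert s S) h c) A = (\<Sum>j\<in>S-A. (koszul_sign s A * koszul_sign j (insert s A)) * (h j * c (insert j (insert s A))))"
    by (simp add: part_def koszul_d_def sum_distrib_left mult.assoc)
  also have "\<dots> = (\<Sum>j\<in>S-A. - (koszul_sign j A * h j * part s c (insert j A)))"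
  proof (rule sum.cong[OF refl])
    fix j assume j: "j \<in> S - A"
    have "koszul_sign s A * koszul_sign j (insert s A) = - (koszul_sign j A * koszul_sign s (insert j A) :: 'a)"
      using assms j by (intro koszul_sign_swap) (auto intro: finite_subset)
    then show "(koszul_sign s A * koszul_sign j (insert s A)) * (h j * c (insert j (insert s A))) = - (koszul_sign j A * h j * part s c (insert j A))"
      by (simp add: part_def insert_commute mult_ac)
  qed
  finally show ?thesis by (simp add: koszul_d_def sum_negf)
qed

lemma subset_insert_cases:
  assumes "A \<subseteq> insert s S"
  obtains "A \<subseteq> S" | B where "B \<subseteq> S" "A = insert s B"
  using assms by (metis Diff_subset_conv insert_Diff insert_is_Un subset_insert)

text \<open>In the mapping cone the two cross terms carry opposite signs, by
  \<open>part_koszul_d\<close>; the rest is the smaller complex.\<close>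

lemma koszul_d_square: "finite S \<Longrightarrow> A \<subseteq> S \<Longrightarrow> koszul_d S h (koszul_d S h c) A = 0"
proof (induction S arbitrary: A c rule: finite_induct)
  case (insert s S)
  from insert.prems show ?case
  proof (cases rule: subset_insert_cases)
    case 1
    have "koszul_d S h (koszul_d (insert s S) h c) A = koszul_d S h (\<lambda>A. koszul_d S h c A + h s * part s c A) A"
      using insert.hyps 1 by (intro koszul_d_cong koszul_d_insert)
    also have "\<dots> = h s * koszul_d S h (part s c) A"
      using insert.IH[OF 1] by (simp add: koszul_d_add koszul_d_mult)
    finally show ?thesis using insert.hyps 1 by (simp add: koszul_d_insert part_koszul_d)
  next
    case (2 B)
    have "part s (koszul_d (insert s S) h (koszul_d (insert s S) h c)) B = - koszul_d S h (part s (koszul_d (insert s S) h c)) B"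
      using insert.hyps 2 by (intro part_koszul_d)
    also have "koszul_d S h (part s (koszul_d (insert s S) h c)) B = koszul_d S h (\<lambda>A. - koszul_d S h (part s c) A) B"
      using insert.hyps 2 by (intro koszul_d_cong part_koszul_d)
    finally have "part s (koszul_d (insert s S) h (koszul_d (insert s S) h c)) B = 0"
      using insert.IH[OF 2(1)] by (simp add: koszul_d_uminus)
    then show ?thesis by (simp add: part_0_iff 2)
  qed
qed (simp add: koszul_d_def)

text \<open>Chains may mix degrees, so a primitive has to be truncated. The boundary lowers the
  degree by exactly one, hence the truncation leaves the boundary unchanged in the degrees where
  \<open>c\<close> can be nonzero.\<close>

lemma exact_above_Suc:
  assumes "finite S" "exact_above S h p"
  shows "exact_above S h (Suc p)"
  unfolding exact_above_def
proof (intro allI impI)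
  fix c :: "nat set \<Rightarrow> 'a"
  assume "(\<forall>A\<subseteq>S. card A \<le> Suc p \<longrightarrow> c A = 0) \<and> (\<forall>A\<subseteq>S. koszul_d S h c A = 0)"
  then have c: "\<And>A. A \<subseteq> S \<Longrightarrow> card A \<le> Suc p \<Longrightarrow> c A = 0" "\<And>A. A \<subseteq> S \<Longrightarrow> koszul_d S h c A = 0"
    by blast+
  obtain b where b: "\<And>A. A \<subseteq> S \<Longrightarrow> c A = koszul_d S h b A"
    by (rule exact_aboveE[OF assms(2), of c]) (use c in auto)
  define b' where "b' A = (if card A \<le> Suc (Suc p) then 0 else b A)" for A
  have "c A = koszul_d S h b' A" if A: "A \<subseteq> S" for A
  proof (cases "card A \<le> Suc p")
    case True
    have "card (insert j A) \<le> Suc (Suc p)" for j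
      using True card_insert_le_m1[of "Suc (Suc p)" A j] by simp
    then show ?thesis using c A True by (simp add: koszul_d_def b'_def)
  next
    case False
    have "\<not> card (insert j A) \<le> Suc (Suc p)" if "j \<in> S - A" for j
      using that False A assms(1) finite_subset[OF A] by auto
    then have "koszul_d S h b A = koszul_d S h b' A" by (auto simp: koszul_d_def b'_def intro!: sum.cong)
    then show ?thesis using b A by simp
  qed
  then show "\<exists>b. (\<forall>A\<subseteq>S. card A \<le> Suc (Suc p) \<longrightarrow> b A = 0) \<and> (\<forall>A\<subseteq>S. c A = koszul_d S h b A)"
    by (intro exI[of _ b']) (auto simp: b'_def)
qed

text \<open>If \<open>b1\<close> is a primitive of \<open>part s c\<close>, then c + h_s b1 is a
  cycle of the smaller complex. A primitive \<open>b0\<close> of it, glued with -b1, bounds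
  \<open>c\<close>.\<close>

lemma exact_glue:
  assumes fin: "finite S" and s: "s \<notin> S"
    and ex: "exact_above S h p"
    and c0: "\<And>A. A \<subseteq> S \<Longrightarrow> card A \<le> p \<Longrightarrow> c A = 0"
    and c: "\<And>A. A \<subseteq> insert s S \<Longrightarrow> koszul_d (insert s S) h c A = 0"
    and b1: "\<And>A. A \<subseteq> S \<Longrightarrow> card A \<le> p \<Longrightarrow> b1 A = 0" "\<And>A. A \<subseteq> S \<Longrightarrow> part s c A = koszul_d S h b1 A"
  shows "\<exists>b. (\<forall>A\<subseteq>insert s S. card A \<le> Suc p \<longrightarrow> b A = 0) \<and> (\<forall>A\<subseteq>insert s S. c A = koszul_d (insert s S) h b A)"
proof -
  have "koszul_d S h (\<lambda>A. c A + h s * b1 A) A = 0" if A: "A \<subseteq> S" for A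
    using c[of A] A fin s by (simp add: koszul_d_add koszul_d_mult koszul_d_insert b1(2) subset_insertI2)
  then obtain b0 where b0: "\<And>A. A \<subseteq> S \<Longrightarrow> card A \<le> Suc p \<Longrightarrow> b0 A = 0"
      "\<And>A. A \<subseteq> S \<Longrightarrow> c A + h s * b1 A = koszul_d S h b0 A"
    by (rule exact_aboveE[OF ex, of "\<lambda>A. c A + h s * b1 A", rotated]) (auto simp: c0 b1(1))
  define b where "b = glue s b0 (\<lambda>A. - b1 A)"
  have bS: "b A = b0 A" "part s b A = - b1 A" if "A \<subseteq> S" for A
  proof -
    have "s \<notin> A" using that s by blast
    then show "b A = b0 A" "part s b A = - b1 A" by (simp_all add: b_def glue_simps)
  qed
  have "b A = 0" if A: "A \<subseteq> insert s S" "card A \<le> Suc p" for A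
    using A(1)
  proof (cases rule: subset_insert_cases)
    case 1
    then show ?thesis using b0 A by (simp add: bS)
  next
    case (2 B)
    then have "card A = Suc (card B)" using s fin by (metis card_insert_disjoint finite_subset subsetD)
    then have "part s b B = 0" using A b1(1)[OF 2(1)] by (simp add: bS 2)
    then show ?thesis using 2 by (simp add: part_0_iff)
  qed
  moreover have "c A = koszul_d (insert s S) h b A" if A: "A \<subseteq> insert s S" for A
    using A
  proof (cases rule: subset_insert_cases)
    case 1
    have "koszul_d S h b A = koszul_d S h b0 A" using 1 bS by (intro koszul_d_cong)
    then show ?thesis using fin s by (simp add: koszul_d_insert[OF fin s 1] bS(2)[OF 1] b0(2)[OF 1, symmetric])
  next
    case (2 B)
    have "koszul_d S h (part s b) B = koszul_d S h (\<lambda>A. - b1 A) B" using 2 bS by (intro koszul_d_cong)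
    then have "part s c B = part s (koszul_d (insert s S) h b) B"
      using 2 fin s by (simp add: part_koszul_d koszul_d_uminus b1(2))
    then show ?thesis using 2 by (simp add: part_eq_iff)
  qed
  ultimately show ?thesis by blast
qed

lemma part_cycle:
  assumes "finite S" "s \<notin> S" "\<And>A. A \<subseteq> insert s S \<Longrightarrow> koszul_d (insert s S) h c A = 0" "A \<subseteq> S"
  shows "koszul_d S h (part s c) A = 0"
proof -
  have "part s (koszul_d (insert s S) h c) A = 0"
    using assms(3)[OF insert_mono[OF assms(4)]] by (simp add: part_0_iff)
  then show ?thesis using assms by (simp add: part_koszul_d)
qed

text \<open>\<open>part s\<close> lowers the degree by one, which is what the new element
  costs.\<close>

lemma exact_above_insert:
  assumes fin: "finite S" and s: "s \<notin> S" and ex: "exact_above S h p"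
  shows "exact_above (insert s S) h (Suc p)"
  unfolding exact_above_def
proof (intro allI impI)
  fix c :: "nat set \<Rightarrow> 'a"
  assume "(\<forall>A\<subseteq>insert s S. card A \<le> Suc p \<longrightarrow> c A = 0) \<and> (\<forall>A\<subseteq>insert s S. koszul_d (insert s S) h c A = 0)"
  then have c: "\<And>A. A \<subseteq> insert s S \<Longrightarrow> card A \<le> Suc p \<Longrightarrow> c A = 0"
    "\<And>A. A \<subseteq> insert s S \<Longrightarrow> koszul_d (insert s S) h c A = 0" by blast+
  have 1: "part s c A = 0" if "A \<subseteq> S" "card A \<le> p" for A
  proof -
    have "card (insert s A) \<le> Suc p" using that(2) card_insert_le_m1[of "Suc p" A s] by simp
    then show ?thesis using c(1)[OF insert_mono[OF that(1)]] by (simp add: part_0_iff)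
  qed
  have 2: "\<And>A. A \<subseteq> S \<Longrightarrow> koszul_d S h (part s c) A = 0" by (rule part_cycle[OF fin s c(2)])
  obtain b1 where b1: "\<And>A. A \<subseteq> S \<Longrightarrow> card A \<le> Suc p \<Longrightarrow> b1 A = 0"
    "\<And>A. A \<subseteq> S \<Longrightarrow> part s c A = koszul_d S h b1 A"
    using exact_aboveE[OF ex 1 2] by blast
  show "\<exists>b. (\<forall>A\<subseteq>insert s S. card A \<le> Suc (Suc p) \<longrightarrow> b A = 0) \<and> (\<forall>A\<subseteq>insert s S. c A = koszul_d (insert s S) h b A)"
    by (rule exact_glue[OF fin s exact_above_Suc[OF fin ex]])
       (use c b1 in \<open>auto simp: subset_insertI2\<close>)
qed

text \<open>The degree bound is kept if the only remaining homology, the quotient by the ideal in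
  degree 0, causes no kernel. The hypothesis \<open>reg\<close> says that h_s is a nonzerodivisor on
  it.\<close>

lemma exact_above_insert_regular:
  assumes fin: "finite S" and s: "s \<notin> S" and ex: "exact_above S h 0"
    and reg: "\<And>g a. h s * g = (\<Sum>j\<in>S. h j * a j) \<Longrightarrow> \<exists>a. g = (\<Sum>j\<in>S. h j * a j)"
  shows "exact_above (insert s S) h 0"
  unfolding exact_above_def
proof (intro allI impI)
  fix c :: "nat set \<Rightarrow> 'a"
  assume "(\<forall>A\<subseteq>insert s S. card A \<le> 0 \<longrightarrow> c A = 0) \<and> (\<forall>A\<subseteq>insert s S. koszul_d (insert s S) h c A = 0)"
  then have c: "\<And>A. A \<subseteq> insert s S \<Longrightarrow> card A \<le> 0 \<Longrightarrow> c A = 0"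
    "\<And>A. A \<subseteq> insert s S \<Longrightarrow> koszul_d (insert s S) h c A = 0" by blast+
  have "0 = koszul_d S h c {} + h s * part s c {}"
    using c(2)[of "{}"] fin s by (simp add: koszul_d_insert)
  then have "h s * part s c {} = (\<Sum>j\<in>S. h j * (- c {j}))"
    by (simp add: koszul_d_def sum_negf eq_neg_iff_add_eq_0 add.commute)
  from reg[OF this] obtain a where a: "part s c {} = (\<Sum>j\<in>S. h j * a j)" by blast
  \<comment> \<open>A chain of degree one whose boundary at the empty set is the offending value
    \<open>part s c {}\<close>; subtracting its boundary leaves a cycle in positive degrees.\<close>
  define b' where "b' A = (if card A = 1 then a (the_elem A) else 0)" for A :: "nat set"
  have b': "koszul_d S h b' {} = part s c {}"
    unfolding a by (simp add: koszul_d_def b'_def)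
  define c' where "c' A = part s c A + (-1) * koszul_d S h b' A" for A
  have 1: "koszul_d S h c' A = 0" if "A \<subseteq> S" for A
    unfolding c'_def koszul_d_add koszul_d_mult
    using koszul_d_square[OF fin that] part_cycle[OF fin s c(2) that] by simp
  have 2: "c' A = 0" if "A \<subseteq> S" "card A \<le> 0" for A
    using that fin finite_subset[OF that(1)] by (simp add: c'_def b')
  obtain b'' where b'': "\<And>A. A \<subseteq> S \<Longrightarrow> card A \<le> Suc 0 \<Longrightarrow> b'' A = 0" "\<And>A. A \<subseteq> S \<Longrightarrow> c' A = koszul_d S h b'' A"
    using exact_aboveE[OF ex 2 1] by blast
  define b1 where "b1 A = b' A + b'' A" for A
  have "part s c A = koszul_d S h b1 A" if "A \<subseteq> S" for A
  proof -
    have "koszul_d S h b1 A = koszul_d S h b' A + koszul_d S h b'' A"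
      unfolding b1_def[abs_def] by (rule koszul_d_add)
    then show ?thesis using b''(2)[OF that] by (simp add: c'_def algebra_simps)
  qed
  moreover have "b1 A = 0" if "A \<subseteq> S" "card A \<le> 0" for A
    using that b''(1)[of A] by (simp add: b1_def b'_def)
  ultimately show "\<exists>b. (\<forall>A\<subseteq>insert s S. card A \<le> Suc 0 \<longrightarrow> b A = 0) \<and> (\<forall>A\<subseteq>insert s S. c A = koszul_d (insert s S) h b A)"
    by (intro exact_glue[OF fin s ex]) (use c in \<open>auto simp: subset_insertI2\<close>)
qed

text \<open>Multiplication by h_j is null-homotopic on the Koszul complex. The homotopy is the
  exterior product with the j-th basis vector, which is what \<open>glue j (\<lambda>_. 0)\<close>
  computes.\<close>

lemma koszul_d_contraction:
  assumes fin: "finite S" and j: "j \<in> S" and c: "\<And>A. A \<subseteq> S \<Longrightarrow> koszul_d S h c A = 0" and A: "A \<subseteq> S"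
  shows "koszul_d S h (glue j (\<lambda>_. 0) c) A = h j * c A"
proof -
  define S0 where "S0 = S - {j}"
  have S0: "finite S0" "j \<notin> S0" "S = insert j S0" using fin j by (auto simp: S0_def)
  from A have "A \<subseteq> insert j S0" by (simp add: S0)
  then show ?thesis
  proof (cases rule: subset_insert_cases)
    case 1
    then have "j \<notin> A" using S0 by auto
    moreover have "koszul_d S0 h (glue j (\<lambda>_. 0) c) A = koszul_d S0 h (\<lambda>_. 0) A"
      using S0 1 by (intro koszul_d_cong) (auto simp: glue_def)
    ultimately show ?thesis using 1 S0 by (simp add: koszul_d_insert glue_simps) (simp add: koszul_d_def)
  next
    case (2 B)
    have jB: "j \<notin> B" using 2 S0 by auto
    have "0 = koszul_d S0 h c B + h j * part j c B" using c[of B] 2 S0 by (simp add: koszul_d_insert subset_insertI2)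
    moreover have "koszul_d S0 h (part j (glue j (\<lambda>_. 0) c)) B = koszul_d S0 h c B"
      using S0 2 by (intro koszul_d_cong) (subst glue_simps, auto)
    ultimately have "part j (koszul_d S h (glue j (\<lambda>_. 0) c)) B = h j * part j c B"
      using S0 2 by (simp add: part_koszul_d eq_neg_iff_add_eq_0 neg_eq_iff_add_eq_0)
    also have "\<dots> = part j (\<lambda>A. h j * c A) B" by (simp add: part_def mult_ac)
    finally show ?thesis using 2 by (simp add: part_eq_iff)
  qed
qed

text \<open>As h_s is a combination of the other elements, multiplication by it is null-homotopic,
  with homotopy built from the \<open>r j\<close>. Hence a cycle \<open>c\<close> is the
  \<open>part s\<close> of a cycle of the larger complex, one degree higher, and the
  \<open>part s\<close> of a primitive of the latter is, up to sign, a primitive of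
  \<open>c\<close>.\<close>

lemma exact_above_remove:
  assumes fin: "finite S" and s: "s \<notin> S" and ex: "exact_above (insert s S) h (Suc p)"
    and hs: "h s = (\<Sum>j\<in>S. h j * r j)"
  shows "exact_above S h p"
  unfolding exact_above_def
proof (intro allI impI)
  fix c :: "nat set \<Rightarrow> 'a"
  assume "(\<forall>A\<subseteq>S. card A \<le> p \<longrightarrow> c A = 0) \<and> (\<forall>A\<subseteq>S. koszul_d S h c A = 0)"
  then have c: "\<And>A. A \<subseteq> S \<Longrightarrow> card A \<le> p \<Longrightarrow> c A = 0" "\<And>A. A \<subseteq> S \<Longrightarrow> koszul_d S h c A = 0" by blast+
  define e where "e A = (\<Sum>j\<in>S. - r j * glue j (\<lambda>_. 0) c A)" for A
  have e: "koszul_d S h e A = - h s * c A" if "A \<subseteq> S" for A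
  proof -
    have "koszul_d S h e A = (\<Sum>j\<in>S. - r j * (h j * c A))"
      unfolding e_def koszul_d_sum by (rule sum.cong[OF refl]) (simp only: koszul_d_mult koszul_d_contraction[OF fin _ c(2) that])
    then show ?thesis by (simp add: hs sum_distrib_right sum_distrib_left sum_negf mult_ac)
  qed
  have e0: "e A = 0" if "A \<subseteq> S" "card A \<le> Suc p" for A
  proof -
    have "glue j (\<lambda>_. 0) c A = 0" for j
    proof (cases "j \<in> A")
      case True
      then have "card (A - {j}) \<le> p" "A - {j} \<subseteq> S"
        using that finite_subset[OF that(1) fin] by auto
      then have "c (A - {j}) = 0" by (intro c(1))
      then show ?thesis by (simp add: glue_def)
    qed (simp add: glue_def)
    then show ?thesis by (simp add: e_def)
  qed
  define c' where "c' = glue s e c"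
  have c'S: "c' A = e A" "part s c' A = c A" if "A \<subseteq> S" for A
  proof -
    have "s \<notin> A" using that s by blast
    then show "c' A = e A" "part s c' A = c A" by (simp_all add: c'_def glue_simps)
  qed
  have 1: "koszul_d (insert s S) h c' A = 0" if "A \<subseteq> insert s S" for A
    using that
  proof (cases rule: subset_insert_cases)
    case 1
    have "koszul_d S h c' A = koszul_d S h e A" using 1 c'S by (intro koszul_d_cong)
    then show ?thesis using 1 fin s by (simp add: koszul_d_insert c'S e)
  next
    case (2 B)
    have "koszul_d S h (part s c') B = koszul_d S h c B" using 2 c'S by (intro koszul_d_cong)
    then have "part s (koszul_d (insert s S) h c') B = 0" using 2 fin s c(2) by (simp add: part_koszul_d)
    then show ?thesis using 2 by (simp add: part_0_iff)
  qed
  have 2: "c' A = 0" if A: "A \<subseteq> insert s S" "card A \<le> Suc p" for A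
    using A(1)
  proof (cases rule: subset_insert_cases)
    case 1
    then show ?thesis using e0 A by (simp add: c'S)
  next
    case (2 B)
    then have "card A = Suc (card B)" using s fin by (metis card_insert_disjoint finite_subset subsetD)
    then have "part s c' B = 0" using A c(1)[OF 2(1)] by (simp add: c'S 2)
    then show ?thesis using 2 by (simp add: part_0_iff)
  qed
  obtain b where b: "\<And>A. A \<subseteq> insert s S \<Longrightarrow> card A \<le> Suc (Suc p) \<Longrightarrow> b A = 0"
    "\<And>A. A \<subseteq> insert s S \<Longrightarrow> c' A = koszul_d (insert s S) h b A"
    using exact_aboveE[OF ex 2 1] by blast
  have "c A = koszul_d S h (\<lambda>A. - part s b A) A" if "A \<subseteq> S" for A
  proof -
    have "part s c' A = part s (koszul_d (insert s S) h b) A"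
      using b(2)[OF insert_mono[OF that]] by (simp add: part_eq_iff)
    then show ?thesis using that fin s by (simp add: part_koszul_d koszul_d_uminus c'S)
  qed
  moreover have "- part s b A = 0" if "A \<subseteq> S" "card A \<le> Suc p" for A
  proof -
    have "card (insert s A) \<le> Suc (Suc p)" using that(2) card_insert_le_m1[of "Suc (Suc p)" A s] by simp
    then have "part s b A = 0" using b(1)[OF insert_mono[OF that(1)]] by (simp add: part_0_iff)
    then show ?thesis by simp
  qed
  ultimately show "\<exists>b. (\<forall>A\<subseteq>S. card A \<le> Suc p \<longrightarrow> b A = 0) \<and> (\<forall>A\<subseteq>S. c A = koszul_d S h b A)"
    by (intro exI[of _ "\<lambda>A. - part s b A"]) blast
qed

text \<open>Vanishing of the first homology means that every relation is a combination of the
  trivial ones h_i h_j = h_j h_i; the skew matrix \<open>C\<close> holds the coefficients of a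
  primitive on two-element sets.\<close>

lemma exact_above_0_syzygy:
  assumes fin: "finite S" and ex: "exact_above S h 0" and rel: "(\<Sum>j\<in>S. h j * a j) = 0"
  shows "\<exists>C. (\<forall>i j. C i j = - C j i) \<and> (\<forall>i. C i i = 0) \<and> (\<forall>j\<in>S. a j = (\<Sum>l\<in>S. C j l * h l))"
proof -
  define c where "c A = (if card A = 1 then a (the_elem A) else 0)" for A :: "nat set"
  have 1: "koszul_d S h c A = 0" if "A \<subseteq> S" for A
  proof (cases "A = {}")
    case True
    then show ?thesis using rel by (simp add: koszul_d_def c_def)
  next
    case False
    then have "card (insert j A) \<noteq> 1" if "j \<in> S - A" for j
      using that \<open>A \<subseteq> S\<close> fin finite_subset[OF \<open>A \<subseteq> S\<close>] by auto
    then show ?thesis by (simp add: koszul_d_def c_def)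
  qed
  have 2: "c A = 0" if "A \<subseteq> S" "card A \<le> 0" for A using that by (simp add: c_def)
  obtain b where b: "\<And>A. A \<subseteq> S \<Longrightarrow> c A = koszul_d S h b A"
    using exact_aboveE[OF ex 2 1] by blast
  define C where "C i j = (if i = j then 0 else (if i < j then -1 else 1) * b {i, j})" for i j
  have 3: "a j = (\<Sum>l\<in>S. C j l * h l)" if j: "j \<in> S" for j
  proof -
    have "a j = koszul_d S h b {j}" using b[of "{j}"] j by (simp add: c_def)
    also have "\<dots> = (\<Sum>l\<in>S-{j}. C j l * h l)"
      unfolding koszul_d_def by (rule sum.cong) (auto simp: C_def koszul_sign_insert insert_commute)
    also have "\<dots> = (\<Sum>l\<in>S. C j l * h l)"
      by (rule sum.mono_neutral_left) (auto simp: fin C_def)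
    finally show ?thesis .
  qed
  have 4: "C i j = - C j i" for i j by (auto simp: C_def insert_commute)
  have 5: "C i i = 0" for i by (simp add: C_def)
  show ?thesis by (intro exI[of _ C] conjI allI ballI 3 4 5)
qed

text \<open>Powers of distinct variables form a regular sequence: multiplication by a power of
  \<open>Var (v k)\<close> shifts exponents in a direction that does not affect the box of the
  earlier variables.\<close>

lemma exact_above_Var_powers:
  assumes "inj_on v {..<n}" and h: "\<And>j. j < n \<Longrightarrow> h j = (Var (v j) :: ('a::comm_ring_1, 'm::finite) mfps) ^ N"
  shows "exact_above {..<n} h 0"
proof -
  have "exact_above {..<k} h 0" if "k \<le> n" for k
    using that
  proof (induction k)
    case 0
    show ?case by (auto simp: exact_above_def intro!: exI[of _ "\<lambda>_. 0"] simp: koszul_d_def)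
  next
    case (Suc k)
    have inj: "inj_on v {..<k}" using assms(1) Suc.prems by (auto intro: inj_on_subset)
    have reindex: "(\<Sum>j<k. h j * a j) = (\<Sum>i\<in>v ` {..<k}. Var i ^ N * a (the_inv_into {..<k} v i))" for a
      unfolding sum.reindex[OF inj] using Suc.prems
      by (intro sum.cong) (auto simp: h the_inv_into_f_f[OF inj])
    have "exact_above (insert k {..<k}) h 0"
    proof (rule exact_above_insert_regular)
      show "exact_above {..<k} h 0" using Suc by simp
      fix g a assume "h k * g = (\<Sum>j<k. h j * a j)"
      then have eq: "Var (v k) ^ N * g = (\<Sum>i\<in>v ` {..<k}. Var i ^ N * a (the_inv_into {..<k} v i))"
        unfolding reindex using Suc.prems by (simp add: h)
      have "mfps_nth g b = 0" if b: "b \<in> box (v ` {..<k}) N" for b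
      proof -
        have "v k \<noteq> v j" if "j < k" for j
          using inj_onD[OF assms(1), of k j] that Suc.prems by auto
        then have "v k \<notin> v ` {..<k}" by auto
        then have "Poly_Mapping.single (v k) N + b \<in> box (v ` {..<k}) N"
          using b by (auto simp: box_def lookup_add lookup_single when_def)
        from vanishes_on_box[OF this] have "mfps_nth (Var (v k) ^ N * g) (Poly_Mapping.single (v k) N + b) = 0"
          by (simp only: eq)
        then show ?thesis by (simp add: Var_power)
      qed
      from box_decomposition[OF this mpow_0] obtain d
        where "g = (\<Sum>i\<in>v ` {..<k}. Var i ^ N * d i)" by blast
      also have "\<dots> = (\<Sum>j<k. h j * d (v j))"
        unfolding sum.reindex[OF inj] using Suc.prems by (intro sum.cong) (auto simp: h)
      finally show "\<exists>a. g = (\<Sum>j<k. h j * a j)" by (rule exI[of _ "\<lambda>j. d (v j)"])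
    qed auto
    then show ?case by (simp add: lessThan_Suc)
  qed
  then show ?thesis by simp
qed

text \<open>
  The Koszul complex of the powers of the variables together with \<open>e\<close> is exact above degree
  \<open>n\<close>, since adding an element raises this bound by at most one. Removing the powers of
  the variables, which lie in the ideal generated by \<open>e\<close>, lowers the bound by one at each step.
\<close>

lemma syzygies_of_parameters:
  fixes e :: "'m::finite \<Rightarrow> ('a::comm_ring_1, 'm) mfps"
  assumes V: "\<And>i. Var i ^ N \<in> generated_ideal e" and rel: "(\<Sum>i\<in>UNIV. e i * a i) = 0"
  shows "\<exists>C. (\<forall>i j. C i j = - C j i) \<and> (\<forall>i. C i i = 0) \<and> (\<forall>i. a i = (\<Sum>j\<in>UNIV. C i j * e j))"
proof -
  define n where "n = card (UNIV :: 'm set)"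
  obtain v where v: "bij_betw v {..<n} (UNIV :: 'm set)"
    using ex_bij_betw_nat_finite[of "UNIV :: 'm set"] by (auto simp: n_def atLeast0LessThan)
  \<comment> \<open>Indices below \<open>n\<close> carry the powers of the variables and the next
    \<open>n\<close> carry \<open>e\<close>. Elements of \<open>e\<close> are thus added at the
    upper end of an interval, and powers are removed at its lower end.\<close>
  define h where "h j = (if j < n then Var (v j) ^ N else e (v (j - n)))" for j
  have bij: "bij_betw (\<lambda>j. v (j - n)) {n..<n + n} UNIV"
  proof -
    have "bij_betw (\<lambda>j. j - n) {n..<n + n} {..<n}"
      by (rule bij_betw_byWitness[of _ "\<lambda>j. j + n"]) auto
    from bij_betw_trans[OF this v] show ?thesis by (simp add: o_def)
  qed
  have "exact_above {..<n} h 0"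
    by (rule exact_above_Var_powers[of v _ _ N]) (use v in \<open>auto simp: bij_betw_def h_def\<close>)
  then have "exact_above {..<n + k} h k" for k
  proof (induction k)
    case (Suc k)
    then have "exact_above (insert (n + k) {..<n + k}) h (Suc k)" by (intro exact_above_insert) auto
    then show ?case by (simp add: lessThan_Suc)
  qed simp
  then have full: "exact_above {0..<n + n} h n" by (simp add: atLeast0LessThan)
  have "exact_above {k..<n + n} h (n - k)" if "k \<le> n" for k
    using that
  proof (induction k)
    case 0
    then show ?case using full by simp
  next
    case (Suc k)
    obtain b where b: "Var (v k) ^ N = (\<Sum>i\<in>UNIV. e i * b i)" using V[of "v k"] by (auto simp: generated_ideal_def)
    have "h k = (\<Sum>j=n..<n + n. e (v (j - n)) * b (v (j - n)))"
      using Suc.prems sum.reindex_bij_betw[OF bij, of "\<lambda>i. e i * b i"] by (simp add: h_def b)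
    also have "\<dots> = (\<Sum>j\<in>{Suc k..<n + n}. h j * (if j < n then 0 else b (v (j - n))))"
      using Suc.prems by (intro sum.mono_neutral_cong_left) (auto simp: h_def)
    finally have hk: "h k = (\<Sum>j\<in>{Suc k..<n + n}. h j * (if j < n then 0 else b (v (j - n))))" .
    have "{k..<n + n} = insert k {Suc k..<n + n}" using Suc.prems by auto
    moreover have "n - k = Suc (n - Suc k)" using Suc.prems by simp
    ultimately have "exact_above (insert k {Suc k..<n + n}) h (Suc (n - Suc k))" using Suc by simp
    from exact_above_remove[OF _ _ this hk] show ?case by simp
  qed
  from this[of n] have ex: "exact_above {n..<n + n} h 0" by simp
  have "(\<Sum>j\<in>{n..<n + n}. h j * a (v (j - n))) = (\<Sum>j\<in>{n..<n + n}. e (v (j - n)) * a (v (j - n)))"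
    by (rule sum.cong) (auto simp: h_def)
  also have "\<dots> = 0" using rel sum.reindex_bij_betw[OF bij, of "\<lambda>i. e i * a i"] by simp
  finally have "(\<Sum>j\<in>{n..<n + n}. h j * a (v (j - n))) = 0" .
  from exact_above_0_syzygy[OF finite_atLeastLessThan ex this]
  obtain C where C: "\<And>i j. C i j = - C j i" "\<And>i. C i i = 0"
    "\<And>j. j \<in> {n..<n + n} \<Longrightarrow> a (v (j - n)) = (\<Sum>l\<in>{n..<n + n}. C j l * h l)"
    by blast
  define w where "w = the_inv_into {n..<n + n} (\<lambda>j. v (j - n))"
  have w: "w (v (j - n)) = j" if "j \<in> {n..<n + n}" for j
    unfolding w_def using bij that by (auto simp: bij_betw_def intro: the_inv_into_f_f)
  have w': "w i \<in> {n..<n + n}" "v (w i - n) = i" for i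
  proof -
    have inj: "inj_on (\<lambda>j. v (j - n)) {n..<n + n}" and i: "i \<in> (\<lambda>j. v (j - n)) ` {n..<n + n}"
      using bij by (simp_all add: bij_betw_def)
    show "w i \<in> {n..<n + n}" unfolding w_def by (rule the_inv_into_into[OF inj i subset_refl])
    show "v (w i - n) = i" unfolding w_def by (rule f_the_inv_into_f[OF inj i])
  qed
  have "a i = (\<Sum>j\<in>UNIV. C (w i) (w j) * e j)" for i
  proof -
    have "a i = (\<Sum>l\<in>{n..<n + n}. C (w i) l * h l)" using C(3)[OF w'(1)[of i]] w'(2) by simp
    also have "\<dots> = (\<Sum>l\<in>{n..<n + n}. C (w i) (w (v (l - n))) * e (v (l - n)))"
      by (rule sum.cong) (auto simp: w h_def)
    also have "\<dots> = (\<Sum>j\<in>UNIV. C (w i) (w j) * e j)"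
      by (rule sum.reindex_bij_betw[OF bij])
    finally show ?thesis .
  qed
  then show ?thesis by (intro exI[of _ "\<lambda>i j. C (w i) (w j)"] conjI allI C(1,2))
qed

subsection \<open>Adjoining a parameter\<close>

definition opt_exp :: "('n::finite \<Rightarrow>\<^sub>0 nat) \<Rightarrow> nat \<Rightarrow> ('n option \<Rightarrow>\<^sub>0 nat)" where
  "opt_exp a k = Abs_poly_mapping (case_option k (Poly_Mapping.lookup a))"

definition rest_exp :: "('n::finite option \<Rightarrow>\<^sub>0 nat) \<Rightarrow> ('n \<Rightarrow>\<^sub>0 nat)" where
  "rest_exp b = Abs_poly_mapping (\<lambda>i. Poly_Mapping.lookup b (Some i))"

lemma lookup_opt_exp [simp]:
  "Poly_Mapping.lookup (opt_exp a k) None = k"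
  "Poly_Mapping.lookup (opt_exp a k) (Some i) = Poly_Mapping.lookup a i"
  by (simp_all add: opt_exp_def)

lemma lookup_rest_exp [simp]: "Poly_Mapping.lookup (rest_exp b) i = Poly_Mapping.lookup b (Some i)"
  by (simp add: rest_exp_def)

lemma option_exp_eqI:
  assumes "Poly_Mapping.lookup a None = Poly_Mapping.lookup b None"
    "\<And>i. Poly_Mapping.lookup a (Some i) = Poly_Mapping.lookup b (Some i)"
  shows "a = b"
proof (rule poly_mapping_eqI)
  show "Poly_Mapping.lookup a k = Poly_Mapping.lookup b k" for k
    using assms by (cases k) auto
qed

lemma opt_exp_rest_exp: "opt_exp (rest_exp b) (Poly_Mapping.lookup b None) = b"
  by (rule option_exp_eqI) auto

lemma rest_exp_opt_exp [simp]: "rest_exp (opt_exp a k) = a"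
  by (rule poly_mapping_eqI) simp

lemma opt_exp_add: "opt_exp a k + opt_exp b l = opt_exp (a + b) (k + l)"
  by (rule option_exp_eqI) (simp_all add: lookup_add)

lemma rest_exp_add: "rest_exp (a + b) = rest_exp a + rest_exp b"
  by (rule poly_mapping_eqI) (simp add: lookup_add)

lemma opt_exp_eq_0_iff: "opt_exp a k = 0 \<longleftrightarrow> a = 0 \<and> k = 0"
proof
  assume *: "opt_exp a k = 0"
  have "k = 0" using arg_cong[OF *, of "\<lambda>b. Poly_Mapping.lookup b None"] by simp
  moreover have "a = 0"
    using arg_cong[OF *, of "\<lambda>b. Poly_Mapping.lookup b (Some i)" for i] by (intro poly_mapping_eqI) simp
  ultimately show "a = 0 \<and> k = 0" by simp
next
  assume "a = 0 \<and> k = 0"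
  then show "opt_exp a k = 0" by (intro option_exp_eqI) auto
qed

definition emb :: "('a::comm_ring_1, 'n::finite) mfps \<Rightarrow> ('a, 'n option) mfps" where
  "emb f = Abs_mfps (\<lambda>b. if Poly_Mapping.lookup b None = 0 then mfps_nth f (rest_exp b) else 0)"

text \<open>Specialisation of the parameter \<open>Var None\<close> to 0; \<open>emb\<close> is a
  section of it, and its kernel consists of the multiples of the parameter by
  \<open>emb_res\<close>.\<close>

definition res :: "('a::comm_ring_1, 'n::finite option) mfps \<Rightarrow> ('a, 'n) mfps" where
  "res g = Abs_mfps (\<lambda>a. mfps_nth g (opt_exp a 0))"

lemma nth_res: "mfps_nth (res g) a = mfps_nth g (opt_exp a 0)"
  by (simp add: res_def)

lemma nth_emb: "mfps_nth (emb f) (opt_exp a k) = (if k = 0 then mfps_nth f a else 0)"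
  by (simp add: emb_def)

lemma nth_emb': "mfps_nth (emb f) b = (if Poly_Mapping.lookup b None = 0 then mfps_nth f (rest_exp b) else 0)"
  by (simp add: emb_def)

lemma option_mfps_eqI: "(\<And>a k. mfps_nth f (opt_exp a k) = mfps_nth g (opt_exp a k)) \<Longrightarrow> f = g"
  by (rule mfps_eqI) (metis opt_exp_rest_exp)

lemma res_emb [simp]: "res (emb f) = f"
  by (rule mfps_eqI) (simp add: nth_res nth_emb)

lemma sum_splits_opt_exp:
  "(\<Sum>(p, q) | p + q = opt_exp a 0. F p q) = (\<Sum>(p, q) | p + q = a. F (opt_exp p 0) (opt_exp q 0))"
proof (rule sum.reindex_bij_witness[of _ "\<lambda>(p, q). (opt_exp p 0, opt_exp q 0)" "\<lambda>(p, q). (rest_exp p, rest_exp q)"])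
  fix x assume x: "x \<in> {(p, q). p + q = opt_exp a 0}"
  obtain p q where pq: "x = (p, q)" by force
  have sum: "p + q = opt_exp a 0" using x by (simp add: pq)
  have "Poly_Mapping.lookup p None + Poly_Mapping.lookup q None = 0"
    using arg_cong[OF sum, of "\<lambda>b. Poly_Mapping.lookup b None"] by (simp add: lookup_add)
  then have *: "opt_exp (rest_exp p) 0 = p" "opt_exp (rest_exp q) 0 = q"
    using opt_exp_rest_exp[of p] opt_exp_rest_exp[of q] by simp_all
  show "(case case x of (p, q) \<Rightarrow> (rest_exp p, rest_exp q) of (p, q) \<Rightarrow> (opt_exp p 0, opt_exp q 0)) = x"
    by (simp add: pq *)
  show "(case x of (p, q) \<Rightarrow> (rest_exp p, rest_exp q)) \<in> {(p, q). p + q = a}"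
    using arg_cong[OF sum, of rest_exp] by (simp add: pq rest_exp_add)
  show "(case case x of (p, q) \<Rightarrow> (rest_exp p, rest_exp q) of (p, q) \<Rightarrow> F (opt_exp p 0) (opt_exp q 0)) =
      (case x of (p, q) \<Rightarrow> F p q)"
    by (simp add: pq *)
qed (auto simp: opt_exp_add)

lemma res_0 [simp]: "res 0 = 0" and res_add: "res (g + h) = res g + res h"
  and res_diff: "res (g - h) = res g - res h" and res_const: "res (mfps_const c) = mfps_const c"
  by (rule mfps_eqI, simp add: nth_res nth_const opt_exp_eq_0_iff)+

lemma res_mult: "res (g * h) = res g * res h"
  by (rule mfps_eqI) (simp add: nth_res nth_mult sum_splits_opt_exp)

lemma res_sum: "res (sum g A) = (\<Sum>i\<in>A. res (g i))"
  by (induction A rule: infinite_finite_induct) (auto simp: res_add)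

lemma emb_0 [simp]: "emb 0 = 0" and emb_add: "emb (f + g) = emb f + emb g"
  and emb_diff: "emb (f - g) = emb f - emb g" and emb_const: "emb (mfps_const c) = mfps_const c"
  by (rule option_mfps_eqI, simp add: nth_emb nth_const opt_exp_eq_0_iff)+

lemma emb_mult: "emb (f * g) = emb f * emb g"
proof (rule option_mfps_eqI)
  fix a k
  show "mfps_nth (emb (f * g)) (opt_exp a k) = mfps_nth (emb f * emb g) (opt_exp a k)"
  proof (cases "k = 0")
    case True
    then show ?thesis by (simp add: nth_emb nth_mult sum_splits_opt_exp)
  next
    case False
    have "mfps_nth (emb f) p * mfps_nth (emb g) q = 0" if "p + q = opt_exp a k" for p q
    proof -
      have "Poly_Mapping.lookup p None + Poly_Mapping.lookup q None = k"
        using arg_cong[OF that, of "\<lambda>b. Poly_Mapping.lookup b None"] by (simp add: lookup_add)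
      then show ?thesis using False by (auto simp: nth_emb')
    qed
    then have "mfps_nth (emb f * emb g) (opt_exp a k) = 0"
      unfolding nth_mult by (intro sum.neutral ballI) (auto split: prod.splits)
    then show ?thesis using False by (simp add: nth_emb)
  qed
qed

lemma emb_sum: "emb (sum f A) = (\<Sum>i\<in>A. emb (f i))"
  by (induction A rule: infinite_finite_induct) (auto simp: emb_add)

lemma emb_1 [simp]: "emb 1 = 1" and res_1 [simp]: "res 1 = 1"
  using emb_const[of 1] res_const[of 1] by simp_all

lemma emb_power: "emb (f ^ k) = emb f ^ k"
  by (induction k) (auto simp: emb_mult)

lemma emb_Var: "emb (Var i) = Var (Some i)"
proof (rule option_mfps_eqI)
  fix a k
  have "opt_exp a k = Poly_Mapping.single (Some i) 1 \<longleftrightarrow> k = 0 \<and> a = Poly_Mapping.single i 1"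
  proof
    assume *: "opt_exp a k = Poly_Mapping.single (Some i) 1"
    have "k = 0" using arg_cong[OF *, of "\<lambda>b. Poly_Mapping.lookup b None"] by (simp add: lookup_single)
    moreover have "a = Poly_Mapping.single i 1"
    proof (rule poly_mapping_eqI)
      show "Poly_Mapping.lookup a j = Poly_Mapping.lookup (Poly_Mapping.single i 1) j" for j
        using arg_cong[OF *, of "\<lambda>b. Poly_Mapping.lookup b (Some j)"] by (simp add: lookup_single)
    qed
    ultimately show "k = 0 \<and> a = Poly_Mapping.single i 1" by simp
  next
    assume "k = 0 \<and> a = Poly_Mapping.single i 1"
    then show "opt_exp a k = Poly_Mapping.single (Some i) 1"
      by (intro option_exp_eqI) (simp_all add: lookup_single)
  qed
  then show "mfps_nth (emb (Var i)) (opt_exp a k) = mfps_nth (Var (Some i)) (opt_exp a k)"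
    by (simp add: nth_emb Var_def nth_monom)
qed

lemma res_Var_None: "res (Var None) = 0"
proof (rule mfps_eqI)
  fix a :: "'b \<Rightarrow>\<^sub>0 nat"
  have "opt_exp a 0 \<noteq> Poly_Mapping.single None 1"
  proof
    assume "opt_exp a 0 = Poly_Mapping.single None 1"
    from arg_cong[OF this, of "\<lambda>b. Poly_Mapping.lookup b None"] show False by simp
  qed
  then show "mfps_nth (res (Var None)) a = mfps_nth 0 a" by (simp add: nth_res Var_def nth_monom)
qed

lemma emb_res: "\<exists>h. g = emb (res g) + Var None * h"
proof -
  have "mfps_nth (g - emb (res g)) b = 0" if "b \<in> box {None} 1" for b
  proof -
    have "Poly_Mapping.lookup b None = 0" using that by (simp add: box_def)
    then have "b = opt_exp (rest_exp b) 0" using opt_exp_rest_exp[of b] by simp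
    then have "mfps_nth (g - emb (res g)) b = mfps_nth (g - emb (res g)) (opt_exp (rest_exp b) 0)"
      by (rule arg_cong)
    also have "\<dots> = 0" by (simp add: nth_emb nth_res)
    finally show ?thesis .
  qed
  from box_decomposition[where S = "{None}" and N = 1, OF this mpow_0] obtain h
    where "g - emb (res g) = Var None * h None" by auto
  then have "g = emb (res g) + Var None * h None" by (simp add: diff_eq_eq add.commute)
  then show ?thesis by (rule exI)
qed

lemma res_ev: "res (ev (Var None) c) = mfps_const (fps_nth c 0)"
proof -
  have "ev (Var None) c = ev (Var None) (fps_const (fps_nth c 0) + fps_X * fps_shift 1 c)"
    using fps_split_shift[of c 1] by simp
  also have "\<dots> = mfps_const (fps_nth c 0) + Var None * ev (Var None) (fps_shift 1 c)"
    by (simp only: ev_add[OF Var_in_mpow] ev_const[OF Var_in_mpow] ev_X_mult[OF Var_in_mpow])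
  finally have "ev (Var None) c = mfps_const (fps_nth c 0) + Var None * ev (Var None) (fps_shift 1 c)" .
  from arg_cong[OF this, of res] show ?thesis by (simp add: res_add res_mult res_Var_None res_const)
qed

lemma nth_Var_None_power_mult:
  "mfps_nth (Var None ^ m * g) (opt_exp a k) = (if m \<le> k then mfps_nth g (opt_exp a (k - m)) else 0)"
proof -
  have "opt_exp a k - Poly_Mapping.single None m = opt_exp a (k - m)"
    by (rule option_exp_eqI) (simp_all add: lookup_minus lookup_single)
  then show ?thesis by (simp add: nth_Var_power_mult)
qed

lemma nth_ev_mult_emb:
  "mfps_nth (ev (Var None) c * emb f) (opt_exp a k) = fps_nth c k * mfps_nth f a"
proof -
  let ?T = "Var None :: ('a, 'b option) mfps"
  have "ev ?T c = ev ?T ((\<Sum>m<Suc k. fps_const (fps_nth c m) * fps_X ^ m) + fps_X ^ Suc k * fps_shift (Suc k) c)"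
    using fps_split_shift[of c "Suc k"] by simp
  also have "\<dots> = (\<Sum>m<Suc k. mfps_const (fps_nth c m) * ?T ^ m) + ?T ^ Suc k * ev ?T (fps_shift (Suc k) c)"
    by (simp only: ev_add[OF Var_in_mpow] ev_sum[OF Var_in_mpow] ev_const_mult[OF Var_in_mpow]
        ev_X_power_mult[OF Var_in_mpow] ev_X_power[OF Var_in_mpow])
  finally have "ev ?T c * emb f = (\<Sum>m<Suc k. mfps_const (fps_nth c m) * (?T ^ m * emb f)) +
     ?T ^ Suc k * (ev ?T (fps_shift (Suc k) c) * emb f)"
    by (simp only: distrib_right sum_distrib_right mult.assoc)
  then have "mfps_nth (ev ?T c * emb f) (opt_exp a k) =
     (\<Sum>m<Suc k. fps_nth c m * (if m \<le> k then mfps_nth (emb f) (opt_exp a (k - m)) else 0))"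
    by (simp only: nth_add nth_sum nth_const_mult nth_Var_None_power_mult) simp
  also have "\<dots> = (\<Sum>m<Suc k. if m = k then fps_nth c k * mfps_nth f a else 0)"
    by (rule sum.cong) (auto simp: nth_emb)
  also have "\<dots> = fps_nth c k * mfps_nth f a" by simp
  finally show ?thesis .
qed

lemma deriv_Some_emb: "mfps_deriv (Some i) (emb f) = emb (mfps_deriv i f)"
proof (rule option_mfps_eqI)
  fix a k
  have "opt_exp a k + Poly_Mapping.single (Some i) 1 = opt_exp (a + Poly_Mapping.single i 1) k"
    by (rule option_exp_eqI) (simp_all add: lookup_add lookup_single)
  then show "mfps_nth (mfps_deriv (Some i) (emb f)) (opt_exp a k) = mfps_nth (emb (mfps_deriv i f)) (opt_exp a k)"
    by (simp only: nth_deriv nth_emb lookup_opt_exp) simp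
qed

lemma deriv_None_emb:
  fixes f :: "('a::comm_ring_1, 'n::finite) mfps"
  shows "mfps_deriv None (emb f) = 0"
proof (rule option_mfps_eqI)
  fix a :: "'n \<Rightarrow>\<^sub>0 nat" and k
  have "opt_exp a k + Poly_Mapping.single None 1 = opt_exp a (Suc k)"
    by (rule option_exp_eqI) (simp_all add: lookup_add lookup_single)
  then show "mfps_nth (mfps_deriv None (emb f)) (opt_exp a k) = mfps_nth 0 (opt_exp a k)"
    by (simp only: nth_deriv nth_emb) simp
qed

subsection \<open>Logarithmic perturbations of the Jacobian ideal\<close>

lemma power_in_ideal:
  assumes A: "is_ideal A" and "x - f * h \<in> A" "f ^ k \<in> A"
  shows "x ^ k \<in> A"
proof -
  have "x ^ k - (f * h) ^ k \<in> A" using ideal_cong_power[OF A assms(2)] .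
  moreover have "(f * h) ^ k \<in> A" using ideal_mult_right[OF A assms(3)] by (simp add: power_mult_distrib)
  ultimately show ?thesis using ideal_add[OF A] by fastforce
qed

definition log_jac :: "('a::comm_ring_1, 'n::finite) mfps \<Rightarrow> ('n \<Rightarrow> ('a, 'n) mfps) \<Rightarrow> ('a, 'n) mfps set" where
  "log_jac f w = generated_ideal (\<lambda>i. mfps_deriv i f + w i * f)"

abbreviation jac where "jac f \<equiv> generated_ideal (\<lambda>i. mfps_deriv i f)"

lemma is_ideal_log_jac: "is_ideal (log_jac f w)"
  unfolding log_jac_def by (rule is_ideal_gen)

text \<open>Some x_i^N lies in the Jacobian ideal, hence is a multiple of \<open>f\<close> modulo
  \<open>log_jac f w\<close>, where \<open>f\<close> is nilpotent.\<close>

lemma Var_powers_in_log_jac: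
  fixes f :: "('a::field_char_0, 'n::finite) mfps"
  assumes f: "f \<in> mpow 1" and J: "codim_le (jac f) r"
  shows "\<exists>N. \<forall>i. Var i ^ N \<in> log_jac f w"
proof -
  let ?e = "\<lambda>i. mfps_deriv i f + w i * f"
  let ?B = "{g. \<exists>h. g - f * h \<in> generated_ideal ?e}"
  have B: "is_ideal ?B" by (rule is_ideal_plus_principal[OF is_ideal_gen])
  have JB: "jac f \<subseteq> ?B"
    unfolding gen_subset_iff[OF B]
  proof safe
    fix i
    have "mfps_deriv i f - f * (- w i) \<in> generated_ideal ?e" using gen_base[of ?e i] by (simp add: mult.commute)
    then show "\<exists>h. mfps_deriv i f - f * h \<in> generated_ideal ?e" by blast
  qed
  have "\<exists>k. f ^ k \<in> generated_ideal ?e"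
  proof (rule nilpotent_if_logarithmic[OF f])
    show "\<exists>W k. f ^ k * (mfps_deriv i f + W * f) \<in> generated_ideal ?e" for i
      using gen_base[of ?e i] by (intro exI[of _ "w i"] exI[of _ 0]) simp
    show "codim_le ?B r" using codim_le_superset[OF J JB] .
  qed
  then obtain k where k: "f ^ k \<in> generated_ideal ?e" by blast
  have "\<exists>l. Var i ^ l \<in> jac f" for i
    by (rule nilpotent_mod_finite_codim[OF is_ideal_gen J Var_in_mpow])
  then obtain N where N: "\<And>i. Var i ^ N \<in> jac f"
    using finite_codim_if_Var_powers(1)[OF is_ideal_gen] by blast
  have "Var i ^ (N * k) \<in> generated_ideal ?e" for i
  proof -
    obtain h where "Var i ^ N - f * h \<in> generated_ideal ?e" using N[of i] JB by blast
    from power_in_ideal[OF is_ideal_gen this k] show ?thesis by (simp add: power_mult)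
  qed
  then show ?thesis unfolding log_jac_def by blast
qed

lemma eq_uminus_selfD:
  fixes g :: "('a::field_char_0, 'm) mfps"
  assumes "g = - g" shows "g = 0"
proof (rule mfps_eqI)
  fix b
  have "mfps_nth g b = - mfps_nth g b"
    using arg_cong[OF assms, of "\<lambda>g. mfps_nth g b"] unfolding nth_uminus .
  then have "2 * mfps_nth g b = 0" unfolding eq_neg_iff_add_eq_0 mult_2 .
  then show "mfps_nth g b = mfps_nth 0 b" by simp
qed

section \<open>The linear family joining the two ideals\<close>

locale perturbation =
  fixes f :: "('a::field_char_0, 'n::finite) mfps" and w :: "'n \<Rightarrow> ('a, 'n) mfps" and r
  assumes f: "f \<in> mpow 1" and J: "codim_le (jac f) r"
begin

definition T :: "('a, 'n option) mfps" where "T = Var None"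
definition e where "e i = mfps_deriv i f + w i * f"
text \<open>At T = 0 this is \<open>e i\<close>, and formally at T = 1 it is the partial derivative.
  A series in T cannot be evaluated at 1; since \<open>F\<close> is linear in T, this end is reached
  later through polynomial coefficients.\<close>

definition F where "F i = emb (mfps_deriv i f) + (1 - T) * emb (w i) * emb f"

lemma T: "T \<in> mpow 1"
  unfolding T_def by (rule Var_in_mpow)

lemma res_T [simp]: "res T = 0"
  unfolding T_def by (rule res_Var_None)

lemma F: "is_ideal (generated_ideal F)"
  by (rule is_ideal_gen)

lemma gen_e: "generated_ideal e = log_jac f w"
  unfolding log_jac_def e_def[abs_def] ..

lemma res_F: "res (F i) = e i"
  by (simp add: F_def e_def res_add res_mult res_diff)

lemma emb_e: "emb (e i) = F i + T * (emb (w i) * emb f)"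
  by (simp add: F_def e_def emb_add emb_mult algebra_simps)

lemma res_gen_F: "g \<in> generated_ideal F \<Longrightarrow> res g \<in> generated_ideal e"
  by (auto simp: generated_ideal_def res_sum res_mult res_F)

lemma emb_gen_e: "g \<in> generated_ideal e \<Longrightarrow> \<exists>h. emb g - T * h \<in> generated_ideal F"
proof -
  assume "g \<in> generated_ideal e"
  then obtain b where b: "g = (\<Sum>i\<in>UNIV. e i * b i)" by (auto simp: generated_ideal_def)
  have "emb g - T * (\<Sum>i\<in>UNIV. emb (w i) * emb f * emb (b i)) = (\<Sum>i\<in>UNIV. F i * emb (b i))"
    unfolding b by (simp add: emb_sum emb_mult emb_e distrib_right sum.distrib sum_distrib_left mult.assoc)
  also have "\<dots> \<in> generated_ideal F" by (rule gen_memI)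
  finally show ?thesis by (rule exI)
qed

lemma emb_gen_deriv: "g \<in> jac f \<Longrightarrow> \<exists>h. emb g - emb f * h \<in> generated_ideal F"
proof -
  assume "g \<in> jac f"
  then obtain b where b: "g = (\<Sum>i\<in>UNIV. mfps_deriv i f * b i)" by (auto simp: generated_ideal_def)
  have "emb g - emb f * (\<Sum>i\<in>UNIV. - ((1 - T) * emb (w i)) * emb (b i)) = (\<Sum>i\<in>UNIV. F i * emb (b i))"
    unfolding b F_def
    by (simp only: emb_sum emb_mult sum_distrib_left sum_subtractf[symmetric])
      (rule sum.cong[OF refl], simp add: algebra_simps)
  also have "\<dots> \<in> generated_ideal F" by (rule gen_memI)
  finally show ?thesis by (rule exI)
qed

lemma Var_powers_e: "\<exists>N. \<forall>i. Var i ^ N \<in> generated_ideal e"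
  unfolding gen_e by (rule Var_powers_in_log_jac[OF f J])

text \<open>Modulo T the quotient is the fibre at T = 0, which is finite-dimensional; successive
  approximation along T lifts a spanning family of it to generators over K[[T]].\<close>

lemma generated_by_e: "\<exists>(r::nat) x. \<forall>g. \<exists>c. g - (\<Sum>j<r. ev T (c j) * emb (x j)) \<in> generated_ideal F"
proof -
  have "\<exists>r. codim_le (generated_ideal e) r"
    using Var_powers_e by (intro finite_codim_if_Var_powers(2) is_ideal_gen) blast
  then obtain r where "codim_le (generated_ideal e) r" by (rule exE)
  then obtain x where x: "\<forall>g. \<exists>c. g - (\<Sum>j<r. mfps_const (c j) * x j) \<in> generated_ideal e"
    unfolding codim_le_def by (rule exE)
  have "\<exists>c h. g - (\<Sum>j<r. mfps_const (c j) * emb (x j)) - T * h \<in> generated_ideal F" for g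
  proof -
    obtain c where c: "res g - (\<Sum>j<r. mfps_const (c j) * x j) \<in> generated_ideal e" using x by blast
    obtain h where h: "g = emb (res g) + T * h" using emb_res unfolding T_def by blast
    from emb_gen_e[OF c] obtain h' where
      h': "emb (res g) - (\<Sum>j<r. mfps_const (c j) * emb (x j)) - T * h' \<in> generated_ideal F"
      by (auto simp: emb_diff emb_sum emb_mult emb_const)
    have "g - (\<Sum>j<r. mfps_const (c j) * emb (x j)) - T * (h + h') =
       emb (res g) - (\<Sum>j<r. mfps_const (c j) * emb (x j)) - T * h'"
      by (subst h) (simp add: algebra_simps)
    then show ?thesis using h' by metis
  qed
  from generated_by_successive_approximation[OF T this] show ?thesis by blast
qed

text \<open>
  A linear relation over $K[[T]]$ between the powers of \<open>f\<close> yields, after cancelling powers of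
  \<open>f\<close>, an element \<open>a\<close> that makes the quotient finite over $K[[f]]$.
\<close>

lemma f_nilpotent: "\<exists>k. emb f ^ k \<in> generated_ideal F"
proof -
  let ?f = "emb f"
  obtain r :: nat and x where x: "\<forall>g. \<exists>c. g - (\<Sum>j<r. ev T (c j) * emb (x j)) \<in> generated_ideal F"
    using generated_by_e by (elim exE)
  obtain d where d: "\<exists>j\<in>{..r}. d j \<noteq> 0" "(\<Sum>j\<le>r. ev T (d j) * ?f ^ j) \<in> generated_ideal F"
    using linear_dependence_mod_ideal[where ph = "ev T" and I = "generated_ideal F" and J = "{..r}" and
        g = "\<lambda>j. ?f ^ j" and r = r and e = "\<lambda>j. emb (x j)"] x F
    by (auto simp: ev_add[OF T] ev_mult[OF T])
  define k where "k = (LEAST j. d j \<noteq> 0)"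
  have k: "d k \<noteq> 0" unfolding k_def by (rule LeastI_ex) (use d in auto)
  have k': "d j = 0" if "j < k" for j using not_less_Least[of j "\<lambda>j. d j \<noteq> 0"] that by (auto simp: k_def)
  have "k \<le> r" using d(1) k' by (meson atMost_iff le_trans not_le_imp_less)
  \<comment> \<open>The relation divided by f^k: its term free of \<open>f\<close> is the nonzero
    series \<open>d k\<close> in T.\<close>
  define a where "a = (\<Sum>j\<in>{k..r}. ev T (d j) * ?f ^ (j - k))"
  have "(\<Sum>j\<le>r. ev T (d j) * ?f ^ j) = (\<Sum>j\<in>{k..r}. ev T (d j) * ?f ^ j)"
    by (rule sum.mono_neutral_right) (auto simp: k')
  also have "\<dots> = ?f ^ k * a"
    unfolding a_def sum_distrib_left
  proof (rule sum.cong[OF refl])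
    fix j assume "j \<in> {k..r}"
    then have "?f ^ j = ?f ^ k * ?f ^ (j - k)" by (simp flip: power_add)
    then show "ev T (d j) * ?f ^ j = ?f ^ k * (ev T (d j) * ?f ^ (j - k))" by (simp only: mult_ac)
  qed
  finally have fa: "?f ^ k * a \<in> generated_ideal F" using d by simp
  define b where "b = (\<Sum>j\<in>{Suc k..r}. ev T (d j) * ?f ^ (j - Suc k))"
  have "{k..r} = insert k {Suc k..r}" using \<open>k \<le> r\<close> by auto
  then have "a = ev T (d k) + (\<Sum>j\<in>{Suc k..r}. ev T (d j) * ?f ^ (j - k))" by (simp add: a_def)
  also have "(\<Sum>j\<in>{Suc k..r}. ev T (d j) * ?f ^ (j - k)) = ?f * b"
    unfolding b_def sum_distrib_left
  proof (rule sum.cong[OF refl])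
    fix j assume "j \<in> {Suc k..r}"
    then have "?f ^ (j - k) = ?f * ?f ^ (j - Suc k)" by (simp add: Suc_diff_Suc flip: power_Suc)
    then show "ev T (d j) * ?f ^ (j - k) = ?f * (ev T (d j) * ?f ^ (j - Suc k))" by (simp only: mult_ac)
  qed
  finally have ab: "a = ev T (d k) + ?f * b" .
  \<comment> \<open>The series \<open>d k\<close> is T^p times a unit. Since \<open>d k\<close>
    equals \<open>a\<close> up to a multiple of \<open>f\<close>, this makes T nilpotent modulo
    \<open>a\<close> and \<open>f\<close>, and so bounds the codimension also in the parameter
    direction.\<close>
  define p where "p = subdegree (d k)"
  define c where "c = fps_shift p (d k)"
  have dc: "d k = fps_X ^ p * c"
    unfolding c_def by (rule fps_eq_X_power_mult_shift) (auto simp: p_def intro: nth_less_subdegree_zero)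
  have "fps_nth c 0 \<noteq> 0" using k by (simp add: c_def p_def)
  then have "inverse c * d k = fps_X ^ p" by (simp add: dc mult.left_commute inverse_mult_eq_1)
  then have Tp: "T ^ p = ev T (inverse c) * ev T (d k)"
    by (simp flip: ev_mult[OF T] ev_X_power[OF T])
  \<comment> \<open>Adjoining \<open>a\<close> is harmless in the end: f^k * a already lies in the
    ideal of \<open>F\<close>, so a power of \<open>f\<close> in the larger ideal gives a higher
    power in the smaller one.\<close>
  define F' where "F' = case_option a F"
  have F': "is_ideal (generated_ideal F')" by (rule is_ideal_gen)
  have FF': "generated_ideal F \<subseteq> generated_ideal F'"
    unfolding gen_subset_iff[OF F'] using gen_base[of F' "Some i" for i] by (simp add: F'_def)
  have aF': "a \<in> generated_ideal F'" using gen_base[of F' None] by (simp add: F'_def)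
  define B where "B = {g. \<exists>h. g - ?f * h \<in> generated_ideal F'}"
  have B: "is_ideal B" unfolding B_def by (rule is_ideal_plus_principal[OF F'])
  have F'B: "generated_ideal F' \<subseteq> B" by (auto simp: B_def intro!: exI[of _ 0])
  have "ev T (d k) \<in> B"
    unfolding B_def using aF' by (auto simp: ab intro!: exI[of _ "- b"])
  then have TB: "T ^ p \<in> B" unfolding Tp by (intro ideal_mult B)
  obtain N where N: "\<And>i. Var i ^ N \<in> generated_ideal e" using Var_powers_e by blast
  have "\<exists>k. Var v ^ k \<in> B" for v :: "'n option"
  proof (cases v)
    case None
    then show ?thesis using TB by (auto simp: T_def)
  next
    case (Some i)
    from emb_gen_e[OF N[of i]] obtain h where "Var v ^ N - T * h \<in> generated_ideal F"
      by (auto simp: emb_power emb_Var Some)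
    then have "Var v ^ N - T * h \<in> B" using FF' F'B by blast
    from power_in_ideal[OF B this TB] show ?thesis by (auto simp flip: power_mult)
  qed
  from finite_codim_if_Var_powers(2)[OF B this] obtain r' where r': "codim_le B r'" by blast
  have "\<exists>l. ?f ^ l \<in> generated_ideal F'"
  proof (rule nilpotent_if_logarithmic)
    show "?f \<in> mpow 1"
      using f unfolding mpow_1_iff by (simp add: nth_emb'[of f 0]) (metis lookup_zero poly_mapping_eqI lookup_rest_exp)
    show "codim_le {g. \<exists>h. g - ?f * h \<in> generated_ideal F'} r'" using r' by (simp add: B_def)
    fix v :: "'n option"
    show "\<exists>W k. ?f ^ k * (mfps_deriv v ?f + W * ?f) \<in> generated_ideal F'"
    proof (cases v)
      case None
      then show ?thesis
        by (intro exI[of _ 0]) (simp add: deriv_None_emb ideal_zero F')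
    next
      case (Some i)
      have "F i \<in> generated_ideal F'" using FF' gen_base[of F i] by blast
      then show ?thesis
        by (intro exI[of _ "(1 - T) * emb (w i)"] exI[of _ 0]) (simp add: Some deriv_Some_emb F_def)
    qed
  qed
  then obtain l where l: "?f ^ l \<in> generated_ideal F'" by blast
  let ?A = "{g. \<exists>k. ?f ^ k * g \<in> generated_ideal F}"
  have A: "is_ideal ?A" by (rule is_ideal_colon_powers[OF F])
  have "generated_ideal F' \<subseteq> ?A"
    unfolding gen_subset_iff[OF A]
  proof
    fix v
    show "F' v \<in> ?A"
    proof (cases v)
      case None
      then show ?thesis using fa by (auto simp: F'_def)
    next
      case (Some i)
      then show ?thesis using gen_base[of F i] by (auto simp: F'_def intro!: exI[of _ 0])
    qed
  qed
  then obtain m where "?f ^ m * ?f ^ l \<in> generated_ideal F" using l by blast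
  then show ?thesis by (auto simp flip: power_add)
qed

lemma Var_powers_F: "\<exists>N. \<forall>i. Var (Some i) ^ N \<in> generated_ideal F"
proof -
  obtain k where k: "emb f ^ k \<in> generated_ideal F" using f_nilpotent by blast
  have "\<exists>l. Var i ^ l \<in> jac f" for i
    by (rule nilpotent_mod_finite_codim[OF is_ideal_gen J Var_in_mpow])
  then obtain N where N: "\<And>i. Var i ^ N \<in> jac f"
    using finite_codim_if_Var_powers(1)[OF is_ideal_gen] by blast
  have "Var (Some i) ^ (N * k) \<in> generated_ideal F" for i
  proof -
    obtain h where "Var (Some i) ^ N - emb f * h \<in> generated_ideal F"
      using emb_gen_deriv[OF N[of i]] by (auto simp: emb_power emb_Var)
    from power_in_ideal[OF F this k] show ?thesis by (simp add: power_mult)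
  qed
  then show ?thesis by blast
qed

text \<open>Setting T = 0 in T g = sum F_i b_i gives a relation between the \<open>e i\<close>,
  which is a Koszul relation. Its lift to the \<open>F i\<close> with the same skew coefficients
  contributes 0 to the sum, and what remains of each b_i is divisible by T.\<close>

lemma T_regular: "T * g \<in> generated_ideal F \<Longrightarrow> g \<in> generated_ideal F"
proof -
  assume "T * g \<in> generated_ideal F"
  then obtain b where b: "T * g = (\<Sum>i\<in>UNIV. F i * b i)" by (auto simp: generated_ideal_def)
  from arg_cong[OF b, of res] have "(\<Sum>i\<in>UNIV. e i * res (b i)) = 0"
    by (simp add: res_mult res_sum res_F)
  then obtain C where C: "\<And>i j. C i j = - C j i" "\<And>i. res (b i) = (\<Sum>j\<in>UNIV. C i j * e j)"
    using syzygies_of_parameters[of _ e "\<lambda>i. res (b i)"] Var_powers_e by metis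
  have "\<exists>d. b i = (\<Sum>j\<in>UNIV. emb (C i j) * F j) + T * d" for i
  proof -
    have "res (b i - (\<Sum>j\<in>UNIV. emb (C i j) * F j)) = 0"
      by (simp add: res_diff res_sum res_mult res_F C(2))
    then obtain d where "b i - (\<Sum>j\<in>UNIV. emb (C i j) * F j) = T * d"
      using emb_res[of "b i - (\<Sum>j\<in>UNIV. emb (C i j) * F j)"] by (auto simp: T_def)
    then show ?thesis by (auto simp: algebra_simps)
  qed
  then obtain d where d: "\<And>i. b i = (\<Sum>j\<in>UNIV. emb (C i j) * F j) + T * d i" by metis
  let ?s = "\<Sum>i\<in>UNIV. \<Sum>j\<in>UNIV. emb (C i j) * (F i * F j)"
  have "?s = (\<Sum>i\<in>UNIV. \<Sum>j\<in>UNIV. emb (C j i) * (F j * F i))" by (rule sum.swap)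
  also have "\<dots> = (\<Sum>i\<in>UNIV. \<Sum>j\<in>UNIV. - (emb (C i j) * (F i * F j)))"
  proof (intro sum.cong refl)
    fix i j
    have "emb (C j i) = - emb (C i j)" using emb_diff[of 0 "C i j"] C(1)[of j i] by simp
    then show "emb (C j i) * (F j * F i) = - (emb (C i j) * (F i * F j))" by (simp add: mult.commute)
  qed
  also have "\<dots> = - ?s" by (simp add: sum_negf)
  finally have s: "?s = 0" by (rule eq_uminus_selfD)
  have "T * g = ?s + T * (\<Sum>i\<in>UNIV. F i * d i)"
    unfolding b by (simp add: d distrib_left sum.distrib sum_distrib_left mult_ac)
  then have "T * g = T * (\<Sum>i\<in>UNIV. F i * d i)" using s by simp
  then have "g = (\<Sum>i\<in>UNIV. F i * d i)" unfolding T_def by (rule Var_mult_cancel)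
  then show ?thesis by (simp only: gen_memI)
qed

lemma T_power_regular: "T ^ k * g \<in> generated_ideal F \<Longrightarrow> g \<in> generated_ideal F"
  by (induction k) (auto simp: mult.assoc dest: T_regular)

end

subsection \<open>Comparison of codimensions\<close>

text \<open>Dividing a nonzero family by the common power of X - x makes its specialisation at x
  nonzero.\<close>

lemma pull_out_root:
  fixes q :: "'y \<Rightarrow> 'a::field poly"
  assumes "\<exists>y\<in>Y. q y \<noteq> 0"
  shows "\<exists>k q'. (\<forall>y\<in>Y. q y = [:- x, 1:] ^ k * q' y) \<and> (\<exists>y\<in>Y. poly (q' y) x \<noteq> 0)"
proof -
  define k where "k = (LEAST k. \<exists>y\<in>Y. q y \<noteq> 0 \<and> order x (q y) = k)"
  have ex: "\<exists>k. \<exists>y\<in>Y. q y \<noteq> 0 \<and> order x (q y) = k" using assms by blast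
  obtain y0 where y0: "y0 \<in> Y" "q y0 \<noteq> 0" "order x (q y0) = k"
    using LeastI_ex[OF ex] unfolding k_def by blast
  have "\<exists>p. q y = [:- x, 1:] ^ k * p" if y: "y \<in> Y" for y
  proof (cases "q y = 0")
    case True
    then show ?thesis by (intro exI[of _ 0]) simp
  next
    case False
    then have "k \<le> order x (q y)" unfolding k_def using y by (intro Least_le) blast
    then have "[:- x, 1:] ^ k dvd q y" using order_1[of x "q y"] by (meson dvd_trans le_imp_power_dvd)
    then show ?thesis by (auto simp: dvd_def)
  qed
  then have "\<forall>y. \<exists>p. y \<in> Y \<longrightarrow> q y = [:- x, 1:] ^ k * p" by blast
  from choice[OF this] obtain q' where q': "\<And>y. y \<in> Y \<Longrightarrow> q y = [:- x, 1:] ^ k * q' y" by blast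
  have "poly (q' y0) x \<noteq> 0"
  proof
    assume "poly (q' y0) x = 0"
    then have "[:- x, 1:] dvd q' y0" by (simp add: poly_eq_0_iff_dvd)
    then have "[:- x, 1:] ^ Suc k dvd q y0"
      unfolding q'[OF y0(1)] power_Suc2 by (rule mult_dvd_mono[OF dvd_refl])
    then show False using order_2[OF y0(2), of x] y0(3) by simp
  qed
  then show ?thesis using q' y0(1) by blast
qed

text \<open>A spanning subfamily of the least size is independent.\<close>

lemma codim_basis:
  assumes I: "is_ideal I" and "codim_le I r"
  shows "\<exists>S (e :: nat \<Rightarrow> ('a::field, 'm::finite) mfps). finite S \<and>
    (\<forall>g. \<exists>c. g - (\<Sum>j\<in>S. mfps_const (c j) * e j) \<in> I) \<and>
    (\<forall>c. (\<Sum>j\<in>S. mfps_const (c j) * e j) \<in> I \<longrightarrow> (\<forall>j\<in>S. c j = 0))"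
proof -
  from assms(2) obtain e where e: "\<And>g. \<exists>c. g - (\<Sum>j<r. mfps_const (c j) * e j) \<in> I"
    unfolding codim_le_def by blast
  define Q where "Q S \<longleftrightarrow> finite S \<and> (\<forall>g. \<exists>c. g - (\<Sum>j\<in>S. mfps_const (c j) * e j) \<in> I)" for S
  have "Q {..<r}" using e by (auto simp: Q_def)
  then obtain S where S: "Q S" and minimal: "\<And>S'. Q S' \<Longrightarrow> card S \<le> card S'"
    using ex_has_least_nat[of Q _ card] by auto
  have fin: "finite S" using S by (simp add: Q_def)
  have "c i = 0" if rel: "(\<Sum>j\<in>S. mfps_const (c j) * e j) \<in> I" and i: "i \<in> S" for c i
  proof (rule ccontr)
    assume ci: "c i \<noteq> 0"
    define d where "d j = c j / c i" for j
    have "mfps_const (1 / c i) * (\<Sum>j\<in>S. mfps_const (c j) * e j) =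
        (\<Sum>j\<in>S. mfps_const (d j) * e j)"
      by (simp add: sum_distrib_left d_def mult.assoc[symmetric] mfps_const_mult[symmetric])
    then have "(\<Sum>j\<in>S. mfps_const (d j) * e j) \<in> I" using ideal_mult[OF I rel, of "mfps_const (1 / c i)"] by simp
    then have ei: "e i + (\<Sum>j\<in>S-{i}. mfps_const (d j) * e j) \<in> I"
      using ci by (simp add: sum.remove[OF fin i] d_def[of i])
    have "Q (S - {i})"
      unfolding Q_def
    proof safe
      fix g
      obtain b where b: "g - (\<Sum>j\<in>S. mfps_const (b j) * e j) \<in> I" using S by (auto simp: Q_def)
      have "g - (\<Sum>j\<in>S-{i}. mfps_const (b j - b i * d j) * e j) =
         (g - (\<Sum>j\<in>S. mfps_const (b j) * e j)) +
         mfps_const (b i) * (e i + (\<Sum>j\<in>S-{i}. mfps_const (d j) * e j))"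
        by (simp add: sum.remove[OF fin i] mfps_const_diff mfps_const_mult sum_distrib_left
            sum_subtractf algebra_simps)
      also have "\<dots> \<in> I" by (intro ideal_add ideal_mult I b ei)
      finally show "\<exists>c. g - (\<Sum>j\<in>S-{i}. mfps_const (c j) * e j) \<in> I"
        by (rule exI[of _ "\<lambda>j. b j - b i * d j"])
    qed (use fin in auto)
    from minimal[OF this] show False using card_Diff1_less[OF fin i] by simp
  qed
  then show ?thesis using S unfolding Q_def by blast
qed

lemma codim_le_card:
  fixes e :: "nat \<Rightarrow> ('a::field, 'm::finite) mfps"
  assumes fin: "finite S" and S: "\<And>g. \<exists>c. g - (\<Sum>j\<in>S. mfps_const (c j) * e j) \<in> I" and le: "card S \<le> r"
  shows "codim_le I r"
proof -
  obtain b where b: "bij_betw b {..<card S} S"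
    using ex_bij_betw_nat_finite[OF fin] by (auto simp: atLeast0LessThan)
  have "\<exists>c. g - (\<Sum>j<r. mfps_const (c j) * e (b j)) \<in> I" for g
  proof -
    obtain c where c: "g - (\<Sum>j\<in>S. mfps_const (c j) * e j) \<in> I" using S by blast
    have "(\<Sum>j\<in>S. mfps_const (c j) * e j) = (\<Sum>j<card S. mfps_const (c (b j)) * e (b j))"
      by (rule sum.reindex_bij_betw[OF b, symmetric])
    also have "\<dots> = (\<Sum>j<r. mfps_const (if j < card S then c (b j) else 0) * e (b j))"
      using le by (intro sum.mono_neutral_cong_left) auto
    finally have "g - (\<Sum>j<r. mfps_const (if j < card S then c (b j) else 0) * e (b j)) \<in> I"
      using c by simp
    then show ?thesis by (rule exI[of _ "\<lambda>j. if j < card S then c (b j) else 0"])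
  qed
  then show ?thesis unfolding codim_le_def by (intro exI[of _ "\<lambda>j. e (b j)"] allI)
qed

text \<open>
  Modulo the powers \<open>Var i ^ N\<close> a series is a vector of coefficients indexed by the box.
\<close>

definition indep_on_box :: "nat \<Rightarrow> ('a::field, 'n::finite) mfps set \<Rightarrow> bool" where
  "indep_on_box N Y \<longleftrightarrow> finite Y \<and>
     (\<forall>c. (\<forall>b\<in>box UNIV N. (\<Sum>y\<in>Y. c y * mfps_nth y b) = 0) \<longrightarrow> (\<forall>y\<in>Y. c y = 0))"

lemma indep_on_boxD:
  assumes "indep_on_box N Y" "\<And>b. b \<in> box UNIV N \<Longrightarrow> (\<Sum>y\<in>Y. c y * mfps_nth y b) = 0" "y \<in> Y"
  shows "c y = 0"
  using assms(1) unfolding indep_on_box_def by (elim conjE allE[of _ c]) (use assms(2,3) in blast)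

lemma card_indep_on_box:
  fixes Y :: "('a::field, 'n::finite) mfps set"
  assumes "indep_on_box N Y"
  shows "card Y \<le> card (box (UNIV :: 'n set) N)"
proof (rule ccontr)
  assume "\<not> ?thesis"
  then obtain c where "\<exists>y\<in>Y. c y \<noteq> 0" "\<forall>b\<in>box UNIV N. (\<Sum>y\<in>Y. c y * mfps_nth y b) = 0"
    using linear_dependence[of "box UNIV N" Y mfps_nth] assms finite_box
    by (auto simp: indep_on_box_def)
  then show False using assms unfolding indep_on_box_def by blast
qed

text \<open>A maximal independent \<open>Y\<close> in \<open>I\<close> spans, on the box, all of
  \<open>I\<close>. Together with the \<open>r\<close> classes that span the quotient it therefore
  spans all coefficient vectors on the box.\<close>

lemma ex_large_indep_on_box:
  fixes I :: "('a::field, 'n::finite) mfps set"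
  assumes I: "is_ideal I" and codim: "codim_le I r"
  shows "\<exists>Y\<subseteq>I. indep_on_box N Y \<and> card (box (UNIV :: 'n set) N) \<le> card Y + r"
proof -
  let ?B = "box (UNIV :: 'n set) N"
  define P where "P Y \<longleftrightarrow> Y \<subseteq> I \<and> indep_on_box N Y" for Y
  have P0: "P {}" by (simp add: P_def indep_on_box_def)
  have bound: "\<forall>Y. P Y \<longrightarrow> card Y \<le> card ?B" using card_indep_on_box by (auto simp: P_def)
  obtain Y where Y: "P Y" and maximal: "\<And>Y'. P Y' \<Longrightarrow> card Y' \<le> card Y"
    using ex_has_greatest_nat[of P "{}" card, OF P0] bound by (metis le_imp_less_Suc)
  have fin: "finite Y" using Y by (simp add: P_def indep_on_box_def)
  have comb: "\<exists>c. \<forall>b\<in>?B. mfps_nth g b = (\<Sum>y\<in>Y. c y * mfps_nth y b)" if g: "g \<in> I" for g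
  proof (cases "g \<in> Y")
    case True
    have "mfps_nth g b = (\<Sum>y\<in>Y. (if y = g then 1 else 0) * mfps_nth y b)" for b
    proof -
      have "(\<Sum>y\<in>Y. (if y = g then 1 else 0) * mfps_nth y b) = (\<Sum>y\<in>Y. if y = g then mfps_nth g b else 0)"
        by (rule sum.cong) auto
      then show ?thesis using True fin by simp
    qed
    then show ?thesis by (intro exI[of _ "\<lambda>y. if y = g then 1 else 0"] ballI)
  next
    case False
    have "\<not> P (insert g Y)" using maximal[of "insert g Y"] fin False by auto
    then have "\<not> indep_on_box N (insert g Y)" using Y g by (simp add: P_def)
    then obtain c y where c: "\<And>b. b \<in> ?B \<Longrightarrow> (\<Sum>y\<in>insert g Y. c y * mfps_nth y b) = 0"
      "y \<in> insert g Y" "c y \<noteq> 0"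
      using fin unfolding indep_on_box_def by auto
    have sum: "c g * mfps_nth g b + (\<Sum>y\<in>Y. c y * mfps_nth y b) = 0" if "b \<in> ?B" for b
      using c(1)[OF that] fin False by simp
    have cg: "c g \<noteq> 0"
    proof
      assume "c g = 0"
      then have "\<forall>b\<in>?B. (\<Sum>y\<in>Y. c y * mfps_nth y b) = 0" using sum by simp
      then have "\<forall>y\<in>Y. c y = 0" using Y unfolding P_def indep_on_box_def by blast
      then show False using c(2,3) \<open>c g = 0\<close> by auto
    qed
    have "mfps_nth g b = (\<Sum>y\<in>Y. (- c y / c g) * mfps_nth y b)" if "b \<in> ?B" for b
    proof -
      have "(\<Sum>y\<in>Y. (- c y / c g) * mfps_nth y b) = - (\<Sum>y\<in>Y. c y * mfps_nth y b) / c g"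
        by (simp add: sum_negf sum_divide_distrib)
      also have "- (\<Sum>y\<in>Y. c y * mfps_nth y b) = c g * mfps_nth g b"
        using sum[OF that] unfolding neg_eq_iff_add_eq_0 by (simp only: add.commute)
      finally show ?thesis using cg by simp
    qed
    then show ?thesis by (intro exI[of _ "\<lambda>y. - c y / c g"] ballI)
  qed
  from codim obtain x where x: "\<And>g. \<exists>c. g - (\<Sum>j<r. mfps_const (c j) * x j) \<in> I"
    unfolding codim_le_def by blast
  have "\<exists>u v. \<forall>b\<in>?B. mfps_nth g b = (\<Sum>j<r. u j * mfps_nth (x j) b) + (\<Sum>y\<in>Y. v y * mfps_nth y b)" for g
  proof -
    obtain u where u: "g - (\<Sum>j<r. mfps_const (u j) * x j) \<in> I" using x by blast
    from comb[OF u] obtain v where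
      "\<forall>b\<in>?B. mfps_nth (g - (\<Sum>j<r. mfps_const (u j) * x j)) b = (\<Sum>y\<in>Y. v y * mfps_nth y b)" by blast
    then have "\<forall>b\<in>?B. mfps_nth g b = (\<Sum>j<r. u j * mfps_nth (x j) b) + (\<Sum>y\<in>Y. v y * mfps_nth y b)"
      by (simp add: diff_eq_eq add.commute)
    then show ?thesis by (intro exI)
  qed
  then have "\<forall>a. \<exists>u v. \<forall>b\<in>?B. mfps_nth (mfps_monom a) b =
     (\<Sum>j<r. u j * mfps_nth (x j) b) + (\<Sum>y\<in>Y. v y * mfps_nth y b)" by (rule allI)
  from choice[OF this] obtain u where "\<forall>a. \<exists>v. \<forall>b\<in>?B. mfps_nth (mfps_monom a) b =
     (\<Sum>j<r. u a j * mfps_nth (x j) b) + (\<Sum>y\<in>Y. v y * mfps_nth y b)" by (rule exE)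
  from choice[OF this] obtain v where uv: "\<And>a b. b \<in> ?B \<Longrightarrow> mfps_nth (mfps_monom a) b =
     (\<Sum>j<r. u a j * mfps_nth (x j) b) + (\<Sum>y\<in>Y. v a y * mfps_nth y b)" by blast
  have "card ?B \<le> card Y + r"
  proof (rule ccontr)
    \<comment> \<open>The monomials of the box would outnumber these spanning vectors, so their
      coordinate vectors \<open>u\<close> and \<open>v\<close> would be dependent, and with them the
      monomials.\<close>
    assume "\<not> card ?B \<le> card Y + r"
    moreover have "card ({..<r} <+> Y) = r + card Y" using fin by (simp add: card_Plus)
    ultimately obtain t where t: "\<exists>a\<in>?B. t a \<noteq> 0"
      "\<forall>z\<in>{..<r} <+> Y. (\<Sum>a\<in>?B. t a * (case z of Inl j \<Rightarrow> u a j | Inr y \<Rightarrow> v a y)) = 0"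
      using linear_dependence[of "{..<r} <+> Y" ?B "\<lambda>a z. case z of Inl j \<Rightarrow> u a j | Inr y \<Rightarrow> v a y"]
        fin finite_box by auto
    have tu: "(\<Sum>a\<in>?B. t a * u a j) = 0" if "j < r" for j
      using bspec[OF t(2) InlI[of j]] that by simp
    have tv: "(\<Sum>a\<in>?B. t a * v a y) = 0" if "y \<in> Y" for y
      using bspec[OF t(2) InrI[OF that]] by simp
    have "t b = 0" if b: "b \<in> ?B" for b
    proof -
      have "t b = (\<Sum>a\<in>?B. t a * mfps_nth (mfps_monom a) b)"
        using b by (simp add: nth_monom if_distrib finite_box cong: if_cong)
      also have "\<dots> = (\<Sum>a\<in>?B. \<Sum>j<r. t a * u a j * mfps_nth (x j) b) +
          (\<Sum>a\<in>?B. \<Sum>y\<in>Y. t a * v a y * mfps_nth y b)"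
        by (simp add: uv[OF b] distrib_left sum.distrib sum_distrib_left mult.assoc)
      also have "(\<Sum>a\<in>?B. \<Sum>j<r. t a * u a j * mfps_nth (x j) b) = 0"
        by (subst sum.swap) (simp add: tu flip: sum_distrib_right)
      also have "(\<Sum>a\<in>?B. \<Sum>y\<in>Y. t a * v a y * mfps_nth y b) = 0"
        by (subst sum.swap) (simp add: tv flip: sum_distrib_right)
      finally show ?thesis by simp
    qed
    then show False using t(1) by blast
  qed
  then show ?thesis using Y unfolding P_def by blast
qed

section \<open>Comparison of the two ends of the family\<close>

context perturbation
begin

text \<open>Polynomials in T, because the relation below has to be specialised both at 0 and at
  1.\<close>

definition pol :: "'a poly \<Rightarrow> ('a, 'n option) mfps" where "pol p = ev T (fps_of_poly p)"

lemma pol_mult: "pol (p * q) = pol p * pol q"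
  by (simp add: pol_def fps_of_poly_mult ev_mult[OF T])

lemma pol_X_power_mult: "pol ([:0, 1:] ^ k * q) = T ^ k * pol q"
proof -
  have "pol [:0, 1:] = T" by (simp add: pol_def fps_of_poly_fps_X ev_X[OF T])
  moreover have "pol 1 = 1" by (simp add: pol_def ev_1[OF T])
  ultimately have "pol ([:0, 1:] ^ k) = T ^ k" by (induction k) (simp_all only: power_0 power_Suc pol_mult)
  then show ?thesis by (simp add: pol_mult)
qed

lemma nth_pol_mult_emb: "mfps_nth (pol p * emb g) (opt_exp a k) = coeff p k * mfps_nth g a"
  by (simp add: pol_def T_def nth_ev_mult_emb)

lemma res_pol: "res (pol p) = mfps_const (poly p 0)"
  by (simp add: pol_def T_def res_ev poly_0_coeff_0)

text \<open>
  Let \<open>S\<close> index a basis modulo \<open>log_jac f w\<close>, the ideal at \<open>T = 0\<close>, and let \<open>Y\<close> be independent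
  in \<open>jac f\<close>, the ideal at \<open>T = 1\<close>, modulo powers of the variables. If \<open>S\<close> were too large, the
  basis and the deformations of the elements of \<open>Y\<close> would satisfy a linear relation over $K[T]$.
  Specialising at \<open>T = 1\<close> shows that it involves the basis, and then it contradicts the fact
  that \<open>T\<close> is regular modulo \<open>generated_ideal F\<close>.
\<close>

lemma codim_le_log_jac: "codim_le (log_jac f w) r"
proof -
  have Ie: "is_ideal (generated_ideal e)" by (rule is_ideal_gen)
  have "\<exists>r. codim_le (generated_ideal e) r"
    using Var_powers_e by (intro finite_codim_if_Var_powers(2) is_ideal_gen) blast
  then obtain r0 where r0: "codim_le (generated_ideal e) r0" by (rule exE)
  obtain S :: "nat set" and x where fin: "finite S"
    and gens: "\<And>g. \<exists>c. g - (\<Sum>j\<in>S. mfps_const (c j) * x j) \<in> generated_ideal e"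
    and indep: "\<And>c j. (\<Sum>j\<in>S. mfps_const (c j) * x j) \<in> generated_ideal e \<Longrightarrow> j \<in> S \<Longrightarrow> c j = (0::'a)"
    using codim_basis[OF Ie r0] by blast
  have "card S \<le> r"
  proof (rule ccontr)
    assume "\<not> card S \<le> r"
    obtain N where N: "\<And>i. Var (Some i) ^ N \<in> generated_ideal F" using Var_powers_F by blast
    let ?B = "box (UNIV :: 'n set) N"
    obtain Y where Y: "Y \<subseteq> jac f" "indep_on_box N Y" "card ?B \<le> card Y + r"
      using ex_large_indep_on_box[OF is_ideal_gen J] by blast
    have finY: "finite Y" using Y(2) by (simp add: indep_on_box_def)
    have "\<forall>y. \<exists>q. y \<in> Y \<longrightarrow> y = (\<Sum>i\<in>UNIV. mfps_deriv i f * q i)"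
      using Y(1) by (auto simp: generated_ideal_def)
    from choice[OF this] obtain q where q: "\<And>y. y \<in> Y \<Longrightarrow> y = (\<Sum>i\<in>UNIV. mfps_deriv i f * q y i)" by blast
    \<comment> \<open>An element y = sum q_i f_{x_i} of \<open>Y\<close> deforms to sum F_i q_i = a0
      + T a1, whose values at T = 0 and T = 1 are \<open>a0 y\<close> and \<open>y\<close>.\<close>
    define a0 where "a0 y = (\<Sum>i\<in>UNIV. e i * q y i)" for y
    define a1 where "a1 y = (\<Sum>i\<in>UNIV. - (w i * f) * q y i)" for y
    have a01: "a0 y + a1 y = y" if "y \<in> Y" for y
    proof -
      have "a0 y + a1 y = (\<Sum>i\<in>UNIV. mfps_deriv i f * q y i)"
        unfolding a0_def a1_def sum.distrib[symmetric] by (rule sum.cong) (auto simp: e_def algebra_simps)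
      then show ?thesis using q[OF that] by simp
    qed
    have aF: "emb (a0 y) + T * emb (a1 y) \<in> generated_ideal F" for y
    proof -
      have "emb (a0 y) + T * emb (a1 y) = (\<Sum>i\<in>UNIV. F i * emb (q y i))"
        unfolding a0_def a1_def emb_sum sum_distrib_left sum.distrib[symmetric]
      proof (rule sum.cong[OF refl])
        fix i
        have neg: "emb (- (w i * f)) = - (emb (w i) * emb f)"
          using emb_diff[of 0 "w i * f"] by (simp add: emb_mult)
        then show "emb (e i * q y i) + T * emb (- (w i * f) * q y i) = F i * emb (q y i)"
          unfolding emb_mult[of "e i"] emb_mult[of "- (w i * f)"] neg emb_e by (simp add: algebra_simps)
      qed
      then show ?thesis using gen_memI by metis
    qed
    define v where "v z b = (case z of Inl j \<Rightarrow> [:mfps_nth (x j) b:] | Inr y \<Rightarrow> [:mfps_nth (a0 y) b, mfps_nth (a1 y) b:])"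
      for z and b :: "'n \<Rightarrow>\<^sub>0 nat"
    \<comment> \<open>There are more vectors over K[T] than coordinates in the box, since card S >
      r.\<close>
    have "card ?B < card (S <+> Y)" using \<open>\<not> card S \<le> r\<close> Y(3) fin finY by (simp add: card_Plus)
    then obtain c where c: "\<exists>z\<in>S <+> Y. c z \<noteq> 0" "\<forall>b\<in>?B. (\<Sum>z\<in>S <+> Y. c z * v z b) = 0"
      using linear_dependence[of ?B "S <+> Y" v] fin finY finite_box by auto
    have rel: "(\<Sum>j\<in>S. c (Inl j) * [:mfps_nth (x j) b:]) +
       (\<Sum>y\<in>Y. c (Inr y) * [:mfps_nth (a0 y) b, mfps_nth (a1 y) b:]) = 0" if "b \<in> ?B" for b
      using c(2)[rule_format, OF that] fin finY by (simp add: sum.Plus v_def)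
    have "\<exists>j\<in>S. c (Inl j) \<noteq> 0"
    proof (rule ccontr)
      assume no: "\<not> ?thesis"
      then have "\<exists>y\<in>Y. c (Inr y) \<noteq> 0" using c(1) by auto
      from pull_out_root[OF this, of 1] obtain k d where
        d: "\<And>y. y \<in> Y \<Longrightarrow> c (Inr y) = [:- 1, 1:] ^ k * d y" "\<exists>y\<in>Y. poly (d y) 1 \<noteq> 0" by blast
      have zero: "(\<Sum>y\<in>Y. poly (d y) 1 * mfps_nth y b) = 0" if b: "b \<in> ?B" for b
      proof -
        have "0 = (\<Sum>y\<in>Y. c (Inr y) * [:mfps_nth (a0 y) b, mfps_nth (a1 y) b:])"
          using rel[OF b] no by simp
        also have "\<dots> = [:- 1, 1:] ^ k * (\<Sum>y\<in>Y. d y * [:mfps_nth (a0 y) b, mfps_nth (a1 y) b:])"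
          unfolding sum_distrib_left by (rule sum.cong) (simp_all only: d mult.assoc)
        finally have "[:- 1, 1:] ^ k * (\<Sum>y\<in>Y. d y * [:mfps_nth (a0 y) b, mfps_nth (a1 y) b:]) = 0" by (rule sym)
        moreover have "[:- 1, 1 :: 'a:] ^ k \<noteq> 0" by simp
        ultimately have "(\<Sum>y\<in>Y. d y * [:mfps_nth (a0 y) b, mfps_nth (a1 y) b:]) = 0"
          unfolding mult_eq_0_iff by blast
        from arg_cong[OF this, of "\<lambda>p. poly p 1"]
        have "(\<Sum>y\<in>Y. poly (d y) 1 * (mfps_nth (a0 y) b + mfps_nth (a1 y) b)) = 0"
          by (simp add: poly_sum distrib_left mult.commute)
        also have "(\<Sum>y\<in>Y. poly (d y) 1 * (mfps_nth (a0 y) b + mfps_nth (a1 y) b)) =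
           (\<Sum>y\<in>Y. poly (d y) 1 * mfps_nth y b)"
        proof (rule sum.cong[OF refl])
          fix y assume "y \<in> Y"
          have "mfps_nth (a0 y) b + mfps_nth (a1 y) b = mfps_nth (a0 y + a1 y) b" by simp
          then show "poly (d y) 1 * (mfps_nth (a0 y) b + mfps_nth (a1 y) b) = poly (d y) 1 * mfps_nth y b"
            using a01[OF \<open>y \<in> Y\<close>] by simp
        qed
        finally show ?thesis .
      qed
      show False using d(2) indep_on_boxD[OF Y(2), where c = "\<lambda>y. poly (d y) 1", OF zero] by blast
    qed
    \<comment> \<open>The factor T^k is removed from the part of the relation that concerns the
      basis, so that its specialisation at T = 0 is nontrivial; regularity of T justifies this
      below.\<close>
    from pull_out_root[OF this, of 0] obtain k d where
      d: "\<And>j. j \<in> S \<Longrightarrow> c (Inl j) = [:0, 1:] ^ k * d j" "\<exists>j\<in>S. poly (d j) 0 \<noteq> 0" by auto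
    \<comment> \<open>The relation read as a series in x and T, with \<open>pCons 0\<close> as
      multiplication by T. Its coefficients vanish for x-exponents in the box and every T-exponent,
      so that it is a combination of the powers \<open>Var (Some i) ^ N\<close>.\<close>
    define G where "G = (\<Sum>j\<in>S. pol (c (Inl j)) * emb (x j)) +
      (\<Sum>y\<in>Y. pol (c (Inr y)) * emb (a0 y) + pol (pCons 0 (c (Inr y))) * emb (a1 y))"
    have "mfps_nth G b = 0" if b: "b \<in> box (range Some) N" for b
    proof -
      have b': "rest_exp b \<in> ?B" using b by (simp add: box_def)
      define a k where "a = rest_exp b" and "k = Poly_Mapping.lookup b None"
      have b_eq: "b = opt_exp a k" by (simp add: a_def k_def opt_exp_rest_exp)
      have "mfps_nth G b = coeff ((\<Sum>j\<in>S. c (Inl j) * [:mfps_nth (x j) a:]) +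
         (\<Sum>y\<in>Y. c (Inr y) * [:mfps_nth (a0 y) a, mfps_nth (a1 y) a:])) k"
      proof -
        have 1: "coeff (c (Inl j) * [:v:]) k = coeff (c (Inl j)) k * v" for j v
          by (simp add: mult.commute)
        have 2: "coeff (c (Inr y) * [:v0, v1:]) k = coeff (c (Inr y)) k * v0 + coeff (pCons 0 (c (Inr y))) k * v1"
          for y v0 v1 by (cases k) (simp_all add: mult.commute)
        show ?thesis
          unfolding G_def b_eq nth_add nth_sum nth_pol_mult_emb coeff_add coeff_sum 1 2 by (rule refl)
      qed
      then show ?thesis unfolding a_def rel[OF b'] by simp
    qed
    from box_decomposition[OF this mpow_0] obtain h where "G = (\<Sum>i\<in>range Some. Var i ^ N * h i)" by blast
    then have GF: "G \<in> generated_ideal F" using N by (auto intro!: ideal_sum ideal_mult_right F)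
    have "(\<Sum>y\<in>Y. pol (c (Inr y)) * emb (a0 y) + pol (pCons 0 (c (Inr y))) * emb (a1 y)) =
       (\<Sum>y\<in>Y. pol (c (Inr y)) * (emb (a0 y) + T * emb (a1 y)))"
    proof (rule sum.cong[OF refl])
      fix y
      have "pol (pCons 0 (c (Inr y))) = T * pol (c (Inr y))"
        using pol_X_power_mult[of 1 "c (Inr y)"] by simp
      then show "pol (c (Inr y)) * emb (a0 y) + pol (pCons 0 (c (Inr y))) * emb (a1 y) =
         pol (c (Inr y)) * (emb (a0 y) + T * emb (a1 y))" by (simp only: distrib_left mult_ac)
    qed
    also have "\<dots> \<in> generated_ideal F" by (intro ideal_sum ideal_mult F aF)
    finally have "(\<Sum>j\<in>S. pol (c (Inl j)) * emb (x j)) \<in> generated_ideal F"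
      using ideal_diff[OF F GF] unfolding G_def by fastforce
    also have "(\<Sum>j\<in>S. pol (c (Inl j)) * emb (x j)) = T ^ k * (\<Sum>j\<in>S. pol (d j) * emb (x j))"
      unfolding sum_distrib_left by (rule sum.cong) (simp_all only: d pol_X_power_mult mult.assoc)
    finally have "(\<Sum>j\<in>S. pol (d j) * emb (x j)) \<in> generated_ideal F" by (rule T_power_regular)
    from res_gen_F[OF this] have "(\<Sum>j\<in>S. mfps_const (poly (d j) 0) * x j) \<in> generated_ideal e"
      by (simp add: res_sum res_mult res_pol)
    from indep[OF this] show False using d(2) by blast
  qed
  then show ?thesis using codim_le_card[OF fin gens] unfolding gen_e by blast
qed

end

lemma jac_unit_mult:
  assumes "u * u' = 1"
  shows "jac (u * f) = log_jac f (\<lambda>i. u' * mfps_deriv i u)"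
proof
  have eq: "mfps_deriv i (u * f) = u * (mfps_deriv i f + u' * mfps_deriv i u * f)" for i
  proof -
    have "u * (mfps_deriv i f + u' * mfps_deriv i u * f) = u * mfps_deriv i f + (u * u') * mfps_deriv i u * f"
      by (simp add: algebra_simps)
    then show ?thesis by (simp add: assms deriv_mult add.commute mult.commute)
  qed
  show "jac (u * f) \<subseteq> log_jac f (\<lambda>i. u' * mfps_deriv i u)"
    unfolding gen_subset_iff[OF is_ideal_log_jac] eq
    unfolding log_jac_def by (intro allI ideal_mult is_ideal_gen gen_base[where a = "\<lambda>i. mfps_deriv i f + u' * mfps_deriv i u * f"])
  show "log_jac f (\<lambda>i. u' * mfps_deriv i u) \<subseteq> jac (u * f)"
    unfolding log_jac_def gen_subset_iff[OF is_ideal_gen]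
  proof
    fix i
    have "mfps_deriv i f + u' * mfps_deriv i u * f = (u * u') * (mfps_deriv i f + u' * mfps_deriv i u * f)"
      by (simp add: assms)
    also have "\<dots> = u' * mfps_deriv i (u * f)" unfolding eq by (simp only: mult_ac)
    also have "\<dots> \<in> jac (u * f)" by (intro ideal_mult is_ideal_gen gen_base[where a = "\<lambda>i. mfps_deriv i (u * f)"])
    finally show "mfps_deriv i f + u' * mfps_deriv i u * f \<in> jac (u * f)" .
  qed
qed

lemma codim_le_jac_unit_mult:
  fixes f :: "('a::field_char_0, 'n::finite) mfps"
  assumes u: "u dvd 1" and f: "mfps_nth f 0 = 0"
  shows "codim_le (jac (u * f)) r \<longleftrightarrow> codim_le (jac f) r"
proof -
  have imp: "codim_le (jac (u * g)) r" if "u dvd 1" "mfps_nth g 0 = 0" "codim_le (jac g) r" for u g :: "('a, 'n) mfps"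
  proof -
    from that(1) obtain u' where "u * u' = 1" by (auto simp: dvd_def)
    interpret perturbation g "\<lambda>i. u' * mfps_deriv i u" r
      by unfold_locales (use that in \<open>auto simp: mpow_1_iff simp del: One_nat_def\<close>)
    show ?thesis unfolding jac_unit_mult[OF \<open>u * u' = 1\<close>] by (rule codim_le_log_jac)
  qed
  from u obtain u' where u': "u * u' = 1" by (auto simp: dvd_def)
  have "codim_le (jac f) r" if "codim_le (jac (u * f)) r"
  proof -
    have "codim_le (jac (u' * (u * f))) r"
      using u' by (intro imp that) (auto simp: nth_mult_0 f dvd_def mult.commute[of u'] intro!: exI[of _ u])
    moreover have "u' * (u * f) = f" using u' by (simp add: mult.assoc[symmetric] mult.commute[of u'])
    ultimately show ?thesis by simp
  qed
  then show ?thesis using imp[OF u f] by blast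
qed

subsection \<open>Automorphisms\<close>

definition is_auto :: "(('a::comm_ring_1, 'n) mfps \<Rightarrow> ('a, 'n) mfps) \<Rightarrow> bool" where
  "is_auto h \<longleftrightarrow> bij h \<and> (\<forall>x y. h (x + y) = h x + h y) \<and> (\<forall>x y. h (x * y) = h x * h y) \<and>
     (\<forall>c. h (mfps_const c) = mfps_const c)"

lemma is_auto_if_algebra_automorphism: "mfps_algebra_automorphism h \<Longrightarrow> is_auto h"
  by (auto simp: mfps_algebra_automorphism_def is_auto_def ring_iso_def ring_hom_def
      ring_of_type_algebra_def)

lemma is_auto_inv:
  assumes "is_auto h" shows "is_auto (inv_into UNIV h)"
proof -
  have h: "bij h" "\<And>x y. h (x + y) = h x + h y" "\<And>x y. h (x * y) = h x * h y"
    "\<And>c. h (mfps_const c) = mfps_const c" using assms by (auto simp: is_auto_def)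
  have inv_iff: "inv_into UNIV h x = y \<longleftrightarrow> x = h y" for x y
    using h(1) by (metis bij_inv_eq_iff)
  have hinv: "h (inv_into UNIV h x) = x" for x using h(1) by (simp add: bij_is_surj surj_f_inv_f)
  show ?thesis
    unfolding is_auto_def using h(1) by (simp add: bij_imp_bij_inv inv_iff h hinv)
qed

text \<open>Automorphisms preserve non-units, and these are the series without constant term.
  Continuity in the topology of the maximal ideal follows, although it is not part of the
  definition.\<close>

lemma auto_local:
  fixes h :: "('a::field, 'n::finite) mfps \<Rightarrow> ('a, 'n) mfps"
  assumes h: "is_auto h" and f: "f \<in> mpow 1" shows "h f \<in> mpow 1"
proof (rule ccontr)
  assume "h f \<notin> mpow 1"
  then have "mfps_nth (h f) 0 \<noteq> 0" by (simp add: mpow_1_iff del: One_nat_def)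
  from unit_if_const_nonzero[OF this] obtain v where v: "1 = h f * v" by (auto simp: dvd_def)
  have hinv: "inv_into UNIV h (h f) = f" using h by (simp add: is_auto_def bij_is_inj)
  have i: "is_auto (inv_into UNIV h)" by (rule is_auto_inv[OF h])
  then have "inv_into UNIV h 1 = 1" using mfps_const_1 by (metis is_auto_def)
  then have "1 = f * inv_into UNIV h v" using v i hinv by (metis is_auto_def)
  from arg_cong[OF this, of "\<lambda>g. mfps_nth g 0"] show False
    using f by (simp add: mpow_1_iff nth_one nth_mult_0 del: One_nat_def)
qed

lemma auto_sum: "is_auto h \<Longrightarrow> h (sum g A) = (\<Sum>x\<in>A. h (g x))"
proof (induction A rule: infinite_finite_induct)
  case (insert x A)
  then show ?case by (simp add: is_auto_def)
qed (use mfps_const_0 in \<open>metis is_auto_def sum.infinite sum.empty\<close>)+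

text \<open>The defect \<open>D\<close> is additive, satisfies a Leibniz rule along
  \<open>h\<close>, and vanishes on constants and variables. Splitting off one variable writes
  \<open>D g\<close> as a combination of the h(x_j), which have no constant term, with values of
  \<open>D\<close> as coefficients; iteration puts it into every \<open>mpow k\<close>.\<close>

lemma chain_rule_auto:
  fixes h :: "('a::field, 'n::finite) mfps \<Rightarrow> ('a, 'n) mfps"
  assumes h: "is_auto h"
  shows "mfps_deriv i (h g) = (\<Sum>j\<in>UNIV. h (mfps_deriv j g) * mfps_deriv i (h (Var j)))"
proof -
  have hom: "h (x + y) = h x + h y" "h (x * y) = h x * h y" "h (mfps_const c) = mfps_const c" for x y c
    using h by (auto simp: is_auto_def)
  have h0: "h 0 = 0" "h 1 = 1" using hom(3)[of 0] hom(3)[of 1] by simp_all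
  define D where "D g = mfps_deriv i (h g) - (\<Sum>j\<in>UNIV. h (mfps_deriv j g) * mfps_deriv i (h (Var j)))" for g
  have D_add: "D (x + y) = D x + D y" for x y
    by (simp add: D_def hom deriv_add distrib_right sum.distrib)
  have D_const: "D (mfps_const c) = 0" for c by (simp add: D_def hom h0)
  have D_mult: "D (x * y) = h x * D y + h y * D x" for x y
    by (simp add: D_def hom deriv_mult deriv_add distrib_right distrib_left sum.distrib right_diff_distrib sum_distrib_left mult_ac)
  have D_Var: "D (Var k) = 0" for k
  proof -
    have "(\<Sum>j\<in>UNIV. h (mfps_deriv j (Var k)) * mfps_deriv i (h (Var j))) =
       (\<Sum>j\<in>UNIV. if j = k then mfps_deriv i (h (Var k)) else 0)"
      by (rule sum.cong) (auto simp: deriv_Var h0)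
    then show ?thesis by (simp add: D_def)
  qed
  have D_sum: "D (sum x A) = (\<Sum>j\<in>A. D (x j))" for x :: "'n \<Rightarrow> _" and A
    using D_const[of 0] by (induction A rule: infinite_finite_induct) (auto simp: D_add)
  have "D g \<in> mpow k" for k g
  proof (induction k arbitrary: g)
    case (Suc k)
    obtain q where "g = mfps_const (mfps_nth g 0) + (\<Sum>i\<in>UNIV. Var i * q i)"
      using const_plus_Var_decomposition by blast
    from arg_cong[OF this, of D] have "D g = (\<Sum>j\<in>UNIV. h (Var j) * D (q j))"
      by (simp add: D_add D_const D_sum D_mult D_Var)
    also have "\<dots> \<in> mpow (Suc k)"
    proof (intro ideal_sum is_ideal_mpow)
      fix j
      show "h (Var j) * D (q j) \<in> mpow (Suc k)"
        using mpow_mult[OF auto_local[OF h Var_in_mpow] Suc] by simp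
    qed
    finally show ?case .
  qed simp
  then have "D g = 0" by (intro mpow_eqI) simp
  then show ?thesis by (simp add: D_def)
qed

lemma is_ideal_auto_image:
  assumes h: "is_auto h" and I: "is_ideal I" shows "is_ideal (h ` I)"
proof -
  have hom: "h (x + y) = h x + h y" "h (x * y) = h x * h y" "h (mfps_const c) = mfps_const c" for x y c
    using h by (auto simp: is_auto_def)
  have surj: "\<exists>y. x = h y" for x using h unfolding is_auto_def by (meson bij_is_surj surjE)
  show ?thesis
  proof (rule is_idealI; safe?)
    show "0 \<in> h ` I" using hom(3)[of 0] ideal_zero[OF I] by (simp add: rev_image_eqI)
    show "h x + h y \<in> h ` I" if "x \<in> I" "y \<in> I" for x y
      unfolding hom(1)[symmetric] by (intro imageI ideal_add I that)
    show "r * h x \<in> h ` I" if "x \<in> I" for r x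
    proof -
      obtain s where "r = h s" using surj by blast
      then have "r * h x = h (s * x)" by (simp add: hom)
      then show ?thesis using ideal_mult[OF I that] by simp
    qed
  qed
qed

lemma jac_auto_subset:
  fixes h :: "('a::field, 'n::finite) mfps \<Rightarrow> ('a, 'n) mfps"
  assumes h: "is_auto h"
  shows "jac (h g) \<subseteq> h ` jac g"
proof -
  have I: "is_ideal (h ` jac g)" by (rule is_ideal_auto_image[OF h is_ideal_gen])
  show ?thesis
    unfolding gen_subset_iff[OF I]
  proof
    fix i
    have "mfps_deriv i (h g) = (\<Sum>j\<in>UNIV. h (mfps_deriv j g) * mfps_deriv i (h (Var j)))"
      by (rule chain_rule_auto[OF h])
    also have "\<dots> \<in> h ` jac g"
      by (intro ideal_sum ideal_mult_right I imageI gen_base[where a = "\<lambda>j. mfps_deriv j g"])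
    finally show "mfps_deriv i (h g) \<in> h ` jac g" .
  qed
qed

text \<open>The inclusion of Jacobian ideals, applied to the inverse automorphism, gives the
  direction needed to transport a spanning family by \<open>h\<close>.\<close>

lemma codim_le_jac_auto_imp:
  fixes h :: "('a::field, 'n::finite) mfps \<Rightarrow> ('a, 'n) mfps"
  assumes h: "is_auto h" and "codim_le (jac g) r"
  shows "codim_le (jac (h g)) r"
proof -
  have hom: "h (x + y) = h x + h y" "h (x * y) = h x * h y" "h (mfps_const c) = mfps_const c" for x y c
    using h by (auto simp: is_auto_def)
  have bij: "bij h" using h by (simp add: is_auto_def)
  have "jac (inv_into UNIV h (h g)) \<subseteq> inv_into UNIV h ` jac (h g)" by (rule jac_auto_subset[OF is_auto_inv[OF h]])
  then have sub: "h ` jac g \<subseteq> jac (h g)"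
    using bij by (auto simp: bij_is_inj inv_f_f bij_is_surj surj_f_inv_f)
  from assms(2) obtain e where e: "\<And>x. \<exists>c. x - (\<Sum>j<r. mfps_const (c j) * e j) \<in> jac g"
    unfolding codim_le_def by blast
  have "\<exists>c. y - (\<Sum>j<r. mfps_const (c j) * h (e j)) \<in> jac (h g)" for y
  proof -
    obtain x where x: "y = h x" using bij by (meson bij_is_surj surjE)
    obtain c where "x - (\<Sum>j<r. mfps_const (c j) * e j) \<in> jac g" using e by blast
    then have "h (x - (\<Sum>j<r. mfps_const (c j) * e j)) \<in> jac (h g)" using sub by blast
    moreover have "h (x - z) = h x - h z" for z using hom(1)[of "x - z" z] by simp
    ultimately have "y - (\<Sum>j<r. mfps_const (c j) * h (e j)) \<in> jac (h g)"
      by (simp add: x auto_sum[OF h] hom)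
    then show ?thesis by (rule exI[of _ c])
  qed
  then show ?thesis unfolding codim_le_def by (intro exI[of _ "\<lambda>j. h (e j)"] allI)
qed

lemma codim_le_jac_auto:
  fixes h :: "('a::field, 'n::finite) mfps \<Rightarrow> ('a, 'n) mfps"
  assumes h: "is_auto h"
  shows "codim_le (jac (h g)) r \<longleftrightarrow> codim_le (jac g) r"
proof
  assume "codim_le (jac (h g)) r"
  from codim_le_jac_auto_imp[OF is_auto_inv[OF h] this] show "codim_le (jac g) r"
    using h by (simp add: is_auto_def bij_is_inj inv_f_f)
qed (rule codim_le_jac_auto_imp[OF h])

subsection \<open>The Milnor number as a codimension\<close>

abbreviation mfps_ring :: "('a::comm_ring_1, 'n::finite) mfps ring" where "mfps_ring \<equiv> ring_of_type_algebra"

lemma mfps_ring_simps [simp]: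
  "carrier mfps_ring = UNIV" "x \<otimes>\<^bsub>mfps_ring\<^esub> y = x * y" "x \<oplus>\<^bsub>mfps_ring\<^esub> y = x + y" "\<zero>\<^bsub>mfps_ring\<^esub> = 0" "\<one>\<^bsub>mfps_ring\<^esub> = 1"
  by (simp_all add: ring_of_type_algebra_def)

lemma a_inv_mfps_ring: "\<ominus>\<^bsub>mfps_ring\<^esub> x = - x"
proof -
  interpret ring mfps_ring by (rule ring_from_type_algebra)
  show ?thesis by (rule minus_equality) simp_all
qed

lemma ideal_mfps_ring: "is_ideal I \<Longrightarrow> ideal I mfps_ring"
proof (rule idealI)
  show "ring mfps_ring" by (rule ring_from_type_algebra)
  assume I: "is_ideal I"
  interpret ring mfps_ring by (rule ring_from_type_algebra)
  show "subgroup I (add_monoid mfps_ring)"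
  proof (rule add.subgroupI)
    show "I \<noteq> {}" using ideal_zero[OF I] by blast
    show "\<ominus>\<^bsub>mfps_ring\<^esub> a \<in> I" if "a \<in> I" for a unfolding a_inv_mfps_ring using ideal_uminus[OF I that] .
    show "a \<oplus>\<^bsub>mfps_ring\<^esub> b \<in> I" if "a \<in> I" "b \<in> I" for a b using ideal_add[OF I that] by simp
  qed simp
qed (auto intro: ideal_mult ideal_mult_right)

lemma is_ideal_if_ideal_mfps_ring:
  assumes "ideal I mfps_ring" shows "is_ideal I"
proof -
  interpret ideal I mfps_ring by (rule assms)
  show ?thesis
  proof (rule is_idealI)
    show "0 \<in> I" using additive_subgroup.zero_closed[OF is_additive_subgroup] by simp
    show "x + y \<in> I" if "x \<in> I" "y \<in> I" for x y using additive_subgroup.a_closed[OF is_additive_subgroup that] by simp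
    show "r * x \<in> I" if "x \<in> I" for r x using I_l_closed[OF that, of r] by simp
  qed
qed

lemma jacobian_ideal_eq: "jacobian_ideal f = jac f"
proof -
  have "genideal mfps_ring (range (\<lambda>i. mfps_deriv i f)) = jac f"
    unfolding genideal_def
  proof (rule subset_antisym)
    have "ideal (jac f) mfps_ring \<and> range (\<lambda>i. mfps_deriv i f) \<subseteq> jac f"
      using gen_base[of "\<lambda>i. mfps_deriv i f"] by (auto intro: ideal_mfps_ring is_ideal_gen)
    then show "\<Inter>{I. ideal I mfps_ring \<and> range (\<lambda>i. mfps_deriv i f) \<subseteq> I} \<subseteq> jac f" by blast
    show "jac f \<subseteq> \<Inter>{I. ideal I mfps_ring \<and> range (\<lambda>i. mfps_deriv i f) \<subseteq> I}"
    proof (rule Inter_greatest)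
      fix I assume "I \<in> {I. ideal I mfps_ring \<and> range (\<lambda>i. mfps_deriv i f) \<subseteq> I}"
      then show "jac f \<subseteq> I" using gen_subset_iff[of I "\<lambda>i. mfps_deriv i f"] is_ideal_if_ideal_mfps_ring by auto
    qed
  qed
  then show ?thesis by (simp add: jacobian_ideal_def)
qed

text \<open>Thinning a spanning list to a basis never lengthens it; this turns
  \<open>codim_le\<close> into a bound on the dimension.\<close>

lemma (in ring) filter_base_length:
  assumes K: "subfield K R" and "set Us \<subseteq> carrier R"
  shows "\<exists>Vs. independent K Vs \<and> Span K Vs = Span K Us \<and> length Vs \<le> length Us"
  using assms(2)
proof (induction Us)
  case (Cons u Us)
  then obtain Vs where Vs: "independent K Vs" "Span K Vs = Span K Us" "length Vs \<le> length Us"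
    by auto
  show ?case
  proof (cases "u \<in> Span K Us")
    case True
    then have "Span K (u # Us) = Span K Us"
      using Span_base_incl[OF K] mono_Span_subset[OF K] Cons.prems
      by (metis insert_subset list.simps(15) subset_antisym)
    then show ?thesis using Vs by (metis le_SucI length_Cons)
  next
    case False
    then have "independent K (u # Vs)" "Span K (u # Vs) = Span K (u # Us)"
      using li_Cons[of u K Vs] Cons.prems Vs by auto
    then show ?thesis using Vs by (metis Suc_le_mono length_Cons)
  qed
qed auto

section \<open>Spans and dimension in the quotient ring\<close>

context
  fixes I :: "('a::field, 'n::finite) mfps set"
  assumes I: "is_ideal I"
begin

interpretation ideal I mfps_ring by (rule ideal_mfps_ring[OF I])
interpretation Q: ring "mfps_ring Quot I" by (rule quotient_is_ring)
interpretation h: ring_hom_ring mfps_ring "mfps_ring Quot I" "(+>\<^bsub>mfps_ring\<^esub>) I" by (rule rcos_ring_hom_ring)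

lemma coset_eq_iff: "I +>\<^bsub>mfps_ring\<^esub> x = I +>\<^bsub>mfps_ring\<^esub> y \<longleftrightarrow> x - y \<in> I"
proof -
  have eq: "I +>\<^bsub>mfps_ring\<^esub> x = {i + x | i. i \<in> I}" for x by (auto simp: a_r_coset_def')
  show ?thesis
  proof
    assume "I +>\<^bsub>mfps_ring\<^esub> x = I +>\<^bsub>mfps_ring\<^esub> y"
    moreover have "x \<in> I +>\<^bsub>mfps_ring\<^esub> x" unfolding eq using ideal_zero[OF I] by force
    ultimately have "x \<in> I +>\<^bsub>mfps_ring\<^esub> y" by simp
    then show "x - y \<in> I" unfolding eq by auto
  next
    assume xy: "x - y \<in> I"
    have "i + x \<in> I +>\<^bsub>mfps_ring\<^esub> y" if "i \<in> I" for i
      unfolding eq using ideal_add[OF I that xy] by (auto intro!: exI[of _ "i + (x - y)"])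
    moreover have "i + y \<in> I +>\<^bsub>mfps_ring\<^esub> x" if "i \<in> I" for i
      unfolding eq using ideal_diff[OF I that xy] by (auto intro!: exI[of _ "i - (x - y)"])
    ultimately show "I +>\<^bsub>mfps_ring\<^esub> x = I +>\<^bsub>mfps_ring\<^esub> y" by (auto simp: eq)
  qed
qed

lemma carrier_Quot: "carrier (mfps_ring Quot I) = range ((+>\<^bsub>mfps_ring\<^esub>) I)"
  by (auto simp: FactRing_def A_RCOSETS_def')

definition scalars where "scalars = range (\<lambda>c. I +>\<^bsub>mfps_ring\<^esub> mfps_const c)"

lemma Span_map_coset:
  "Q.Span scalars (map ((+>\<^bsub>mfps_ring\<^esub>) I) xs) =
     range (\<lambda>c. I +>\<^bsub>mfps_ring\<^esub> (\<Sum>j<length xs. mfps_const (c j) * xs ! j))"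
proof (induction xs)
  case Nil
  have "\<zero>\<^bsub>mfps_ring Quot I\<^esub> = I +>\<^bsub>mfps_ring\<^esub> 0" using h.hom_zero by simp
  then show ?case by auto
next
  case (Cons x xs)
  let ?c = "(+>\<^bsub>mfps_ring\<^esub>) I"
  have add: "?c y \<oplus>\<^bsub>mfps_ring Quot I\<^esub> ?c z = ?c (y + z)" for y z using h.hom_add[of y z] by simp
  have mult: "?c y \<otimes>\<^bsub>mfps_ring Quot I\<^esub> ?c z = ?c (y * z)" for y z using h.hom_mult[of y z] by simp
  have "Q.Span scalars (map ?c (x # xs)) = Q.line_extension scalars (?c x) (Q.Span scalars (map ?c xs))"
    by simp
  also have "\<dots> = range (\<lambda>c. ?c (\<Sum>j<length (x # xs). mfps_const (c j) * (x # xs) ! j))"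
    (is "?l = ?r")
  proof (rule Set.set_eqI)
    fix z
    have "z \<in> ?l \<longleftrightarrow> (\<exists>k c. z = ?c (mfps_const k * x + (\<Sum>j<length xs. mfps_const (c j) * xs ! j)))"
      unfolding Q.line_extension_mem_iff Cons.IH unfolding scalars_def by (auto simp: add mult)
    also have "\<dots> \<longleftrightarrow> z \<in> ?r"
    proof safe
      fix k and c :: "nat \<Rightarrow> 'a"
      show "?c (mfps_const k * x + (\<Sum>j<length xs. mfps_const (c j) * xs ! j)) \<in> ?r"
        by (rule range_eqI[of _ _ "case_nat k c"]) (simp add: sum.lessThan_Suc_shift del: sum.lessThan_Suc)
    next
      fix c :: "nat \<Rightarrow> 'a"
      show "\<exists>k d. ?c (\<Sum>j<length (x # xs). mfps_const (c j) * (x # xs) ! j) =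
          ?c (mfps_const k * x + (\<Sum>j<length xs. mfps_const (d j) * xs ! j))"
        by (intro exI[of _ "c 0"] exI[of _ "\<lambda>j. c (Suc j)"])
          (simp add: sum.lessThan_Suc_shift del: sum.lessThan_Suc)
    qed
    finally show "z \<in> ?l \<longleftrightarrow> z \<in> ?r" .
  qed
  finally show ?case .
qed

lemma codim_le_iff_Span:
  "codim_le I r \<longleftrightarrow> (\<exists>xs. length xs = r \<and> Q.Span scalars (map ((+>\<^bsub>mfps_ring\<^esub>) I) xs) = carrier (mfps_ring Quot I))"
proof
  assume "codim_le I r"
  then obtain e where e: "\<And>g. \<exists>c. g - (\<Sum>j<r. mfps_const (c j) * e j) \<in> I"
    unfolding codim_le_def by blast
  have "Q.Span scalars (map ((+>\<^bsub>mfps_ring\<^esub>) I) (map e [0..<r])) = carrier (mfps_ring Quot I)"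
    unfolding Span_map_coset carrier_Quot
  proof (rule subset_antisym; safe)
    fix g
    obtain c where "g - (\<Sum>j<r. mfps_const (c j) * e j) \<in> I" using e by blast
    then have eq: "I +>\<^bsub>mfps_ring\<^esub> g = I +>\<^bsub>mfps_ring\<^esub> (\<Sum>j<length (map e [0..<r]). mfps_const (c j) * map e [0..<r] ! j)"
      unfolding coset_eq_iff by simp
    show "I +>\<^bsub>mfps_ring\<^esub> g \<in> range (\<lambda>c. I +>\<^bsub>mfps_ring\<^esub> (\<Sum>j<length (map e [0..<r]). mfps_const (c j) * map e [0..<r] ! j))"
      by (rule range_eqI[of _ _ c]) (rule eq)
  qed auto
  then show "\<exists>xs. length xs = r \<and> Q.Span scalars (map ((+>\<^bsub>mfps_ring\<^esub>) I) xs) = carrier (mfps_ring Quot I)"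
    by (intro exI[of _ "map e [0..<r]"]) simp
next
  assume "\<exists>xs. length xs = r \<and> Q.Span scalars (map ((+>\<^bsub>mfps_ring\<^esub>) I) xs) = carrier (mfps_ring Quot I)"
  then obtain xs where xs: "length xs = r" "Q.Span scalars (map ((+>\<^bsub>mfps_ring\<^esub>) I) xs) = carrier (mfps_ring Quot I)"
    by blast
  have "\<exists>c. g - (\<Sum>j<r. mfps_const (c j) * xs ! j) \<in> I" for g
  proof -
    have "I +>\<^bsub>mfps_ring\<^esub> g \<in> range (\<lambda>c. I +>\<^bsub>mfps_ring\<^esub> (\<Sum>j<r. mfps_const (c j) * xs ! j))"
      using xs unfolding Span_map_coset carrier_Quot by simp
    then show ?thesis by (auto simp: coset_eq_iff)
  qed
  then show "codim_le I r" unfolding codim_le_def by (intro exI[of _ "\<lambda>j. xs ! j"] allI)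
qed

lemma subfield_scalars:
  assumes "1 \<notin> I" shows "subfield scalars (mfps_ring Quot I)"
proof -
  interpret R: cring mfps_ring by (rule cring_from_type_algebra)
  define C where "C = range (mfps_const :: 'a \<Rightarrow> ('a, 'n) mfps)"
  have "subfield C mfps_ring"
  proof (rule R.subfieldI)
    show "subcring (C) mfps_ring"
    proof (rule R.subcringI', rule R.subringI)
      show "\<one>\<^bsub>mfps_ring\<^esub> \<in> C" unfolding C_def mfps_ring_simps by (rule range_eqI[of _ _ 1]) simp
    qed (auto simp: C_def a_inv_mfps_ring mfps_const_uminus[symmetric] mfps_const_mult[symmetric] mfps_const_add[symmetric])
    show "Units (mfps_ring\<lparr>carrier := C\<rparr>) = C - {\<zero>\<^bsub>mfps_ring\<^esub>}"
    proof (rule Set.set_eqI)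
      fix x :: "('a, 'n) mfps"
      have unit: "mfps_const c * mfps_const d = (1 :: ('a, 'n) mfps) \<longleftrightarrow> c * d = 1" for c d :: 'a
      proof
        assume "mfps_const c * mfps_const d = (1 :: ('a, 'n) mfps)"
        from arg_cong[OF this, of "\<lambda>g. mfps_nth g 0"] show "c * d = 1"
          by (simp add: nth_one nth_const)
      qed (simp flip: mfps_const_mult)
      have zero: "mfps_const c = (0 :: ('a, 'n) mfps) \<longleftrightarrow> c = 0" for c :: 'a
      proof
        assume "mfps_const c = (0 :: ('a, 'n) mfps)"
        from arg_cong[OF this, of "\<lambda>g. mfps_nth g 0"] show "c = 0" by (simp add: nth_const)
      qed simp
      show "x \<in> Units (mfps_ring\<lparr>carrier := C\<rparr>) \<longleftrightarrow> x \<in> C - {\<zero>\<^bsub>mfps_ring\<^esub>}"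
      proof
        assume "x \<in> Units (mfps_ring\<lparr>carrier := C\<rparr>)"
        then show "x \<in> C - {\<zero>\<^bsub>mfps_ring\<^esub>}" by (auto simp: Units_def unit zero C_def)
      next
        assume "x \<in> C - {\<zero>\<^bsub>mfps_ring\<^esub>}"
        then obtain c where c: "x = mfps_const c" "c \<noteq> 0" by (auto simp: zero C_def)
        then have "mfps_const (inverse c) * x = 1" "x * mfps_const (inverse c) = 1" by (simp_all add: unit)
        then show "x \<in> Units (mfps_ring\<lparr>carrier := C\<rparr>)"
          using c(1) by (auto simp: Units_def C_def)
      qed
    qed
  qed
  moreover have "\<one>\<^bsub>mfps_ring Quot I\<^esub> \<noteq> \<zero>\<^bsub>mfps_ring Quot I\<^esub>"
  proof
    assume "\<one>\<^bsub>mfps_ring Quot I\<^esub> = \<zero>\<^bsub>mfps_ring Quot I\<^esub>"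
    then have "I +>\<^bsub>mfps_ring\<^esub> 1 = I +>\<^bsub>mfps_ring\<^esub> 0" using h.hom_one h.hom_zero by simp
    then show False using assms by (simp add: coset_eq_iff)
  qed
  ultimately have "subfield ((+>\<^bsub>mfps_ring\<^esub>) I ` C) (mfps_ring Quot I)"
    by (intro h.img_is_subfield(2))
  then show ?thesis by (simp add: scalars_def C_def image_image)
qed

lemma dim_Quot:
  "(if Q.finite_dimension scalars (carrier (mfps_ring Quot I)) then enat (Q.dim scalars (carrier (mfps_ring Quot I))) else \<infinity>) =
   (if \<exists>r. codim_le I r then enat (LEAST r. codim_le I r) else \<infinity>)"
proof -
  let ?D = "\<lambda>n. Q.dimension n scalars (carrier (mfps_ring Quot I))"
  have "(\<exists>n. ?D n \<and> (\<forall>m. ?D m \<longrightarrow> m = n) \<and> codim_le I n \<and> (\<forall>r. codim_le I r \<longrightarrow> n \<le> r)) \<or>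
    (\<forall>n. \<not> ?D n) \<and> (\<forall>r. \<not> codim_le I r)"
  proof (cases "1 \<in> I")
    \<comment> \<open>For the unit ideal the image of K is the zero ring and not a field, so the
      dimension 0 is obtained directly from the inductive rules.\<close>
    case True
    have all: "x \<in> I" for x using ideal_mult[OF I True, of x] by simp
    have "I +>\<^bsub>mfps_ring\<^esub> x = \<zero>\<^bsub>mfps_ring Quot I\<^esub>" for x
    proof -
      have "I +>\<^bsub>mfps_ring\<^esub> x = I +>\<^bsub>mfps_ring\<^esub> 0" unfolding coset_eq_iff by (rule all)
      then show ?thesis using h.hom_zero by simp
    qed
    then have zero: "carrier (mfps_ring Quot I) = {\<zero>\<^bsub>mfps_ring Quot I\<^esub>}" by (auto simp: carrier_Quot)
    have D: "n = 0 \<and> E = {\<zero>\<^bsub>mfps_ring Quot I\<^esub>}" if "Q.dimension n scalars E" for n E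
      using that by (induction rule: Q.dimension.induct) (auto simp: zero)
    have "?D 0" unfolding zero by (rule Q.zero_dim)
    moreover have "codim_le I 0" by (simp add: codim_le_def all)
    ultimately show ?thesis using D by (intro disjI1 exI[of _ 0] conjI allI impI) auto
  next
    case False
    note K = subfield_scalars[OF False]
    have D_codim: "codim_le I n" if D: "?D n" for n
    proof -
      obtain Vs where Vs: "set Vs \<subseteq> carrier (mfps_ring Quot I)" "length Vs = n" "Q.Span scalars Vs = carrier (mfps_ring Quot I)"
        using Q.exists_base[OF K D] by blast
      have "\<exists>xs. Vs = map ((+>\<^bsub>mfps_ring\<^esub>) I) xs"
        using Vs(1) unfolding carrier_Quot by (simp add: ex_map_conv subset_iff image_iff)
      then show ?thesis using Vs unfolding codim_le_iff_Span by auto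
    qed
    have codim_D: "\<exists>n\<le>r. ?D n" if codim: "codim_le I r" for r
    proof -
      from codim obtain xs where xs: "length xs = r"
        "Q.Span scalars (map ((+>\<^bsub>mfps_ring\<^esub>) I) xs) = carrier (mfps_ring Quot I)"
        unfolding codim_le_iff_Span by blast
      have "set (map ((+>\<^bsub>mfps_ring\<^esub>) I) xs) \<subseteq> carrier (mfps_ring Quot I)" by (auto simp: carrier_Quot)
      from Q.filter_base_length[OF K this] obtain Vs where
        Vs: "Q.independent scalars Vs" "Q.Span scalars Vs = carrier (mfps_ring Quot I)" "length Vs \<le> r"
        using xs by auto
      from Q.dimensionI[OF K Vs(1,2)] Vs(3) show ?thesis by blast
    qed
    show ?thesis
    proof (cases "\<exists>n. ?D n")
      case True
      then obtain n where n: "?D n" by blast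
      have inj: "m = n" if "?D m" for m using Q.dimension_is_inj[OF K that n] .
      have "n \<le> r" if r: "codim_le I r" for r
      proof -
        obtain m where "m \<le> r" "?D m" using codim_D[OF r] by blast
        then show ?thesis using inj by simp
      qed
      then show ?thesis using n D_codim[OF n] inj by (intro disjI1 exI[of _ n] conjI allI impI)
    next
      case False
      then have "\<not> codim_le I r" for r using codim_D[of r] by blast
      then show ?thesis using False by (intro disjI2 conjI allI) auto
    qed
  qed
  then show ?thesis
  proof (elim disjE exE conjE)
    fix n assume n: "?D n" "\<forall>m. ?D m \<longrightarrow> m = n" "codim_le I n" "\<forall>r. codim_le I r \<longrightarrow> n \<le> r"
    have "Q.dim scalars (carrier (mfps_ring Quot I)) = n"
      unfolding Q.dim_def by (rule the_equality[where P = ?D, OF n(1)]) (rule n(2)[rule_format])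
    moreover have "(LEAST r. codim_le I r) = n"
      by (rule Least_equality[where P = "codim_le I", OF n(3)]) (rule n(4)[rule_format])
    moreover have "Q.finite_dimension scalars (carrier (mfps_ring Quot I))"
      unfolding Q.finite_dimension_def by (rule exI[of _ n]) (rule n(1))
    moreover have "\<exists>r. codim_le I r" using n(3) by (rule exI)
    ultimately show ?thesis by simp
  next
    assume "\<forall>n. \<not> ?D n" "\<forall>r. \<not> codim_le I r"
    then show ?thesis unfolding Q.finite_dimension_def by simp
  qed
qed

end

lemma milnor_number_eq:
  fixes f :: "('a::field, 'n::finite) mfps"
  shows "milnor_number f = (if \<exists>r. codim_le (jac f) r then enat (LEAST r. codim_le (jac f) r) else \<infinity>)"
  using dim_Quot[OF is_ideal_gen[of "\<lambda>i. mfps_deriv i f"]]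
  unfolding milnor_number_def Let_def milnor_algebra_def milnor_scalars_def jacobian_ideal_eq
    scalars_def[OF is_ideal_gen[of "\<lambda>i. mfps_deriv i f"]] .

theorem theorem1p1:
  fixes f g :: "('a :: {alg_closed_field, field_char_0}, 'n :: finite) mfps"
  assumes "mfps_nth f 0 = 0"
    and "contact_equivalent f g"
  shows "milnor_number f = milnor_number g"
proof -
  obtain h u where h: "is_auto h" and u: "u dvd 1" and f: "f = u * h g"
    using assms(2) is_auto_if_algebra_automorphism unfolding contact_equivalent_def by blast
  from u obtain u' where u': "u * u' = 1" by (auto simp: dvd_def)
  have hg: "mfps_nth (h g) 0 = 0"
  proof -
    have "h g = u' * f" unfolding f using u' by (simp add: mult.assoc[symmetric] mult.commute[of u'])
    then show ?thesis using assms(1) by (simp add: nth_mult_0)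
  qed
  have "codim_le (jac f) r \<longleftrightarrow> codim_le (jac g) r" for r
    unfolding f codim_le_jac_unit_mult[OF u hg] by (rule codim_le_jac_auto[OF h])
  then have "codim_le (jac f) = codim_le (jac g)" by (rule ext)
  then show ?thesis by (simp add: milnor_number_eq)
qed

end
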